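(* Let $E_0<E_1\le E_2\le\cdots$ be real numbers for which there are constants $L>0$ and $\alpha\ge 1$ with $$\lim_{\lambda\to\infty}\frac{\#\{j\ge 0: E_j\le\lambda\}}{L\lambda^\alpha}=1 .$$ Let $t_c$, the temperature $T=T(n)$ with parameter $t>0$, and the random configuration $(N_0,N_1,\ldots)$ (drawn from the canonical Gibbs measure for $n$ bosons at temperature $T$) be as defined in the context. Let $X_1,X_2,\ldots$ be i.i.d. exponential random variables with mean $1$, and consider $$W:=\frac{1}{(L\alpha\Gamma(\alpha)\zeta(\alpha))^{1/\alpha}}\sum_{j=1}^\infty\frac{1-X_j}{E_j-E_0}\quad\text{if }\alpha>1,\qquad W:=\frac1L\sum_{j=1}^\infty\frac{1-X_j}{E_j-E_0}\quad\text{if }\alpha=1,$$ defined whenever the infinite series converges almost surely. Suppose that $0<t<t_c$. Then the following hold. (1) If $\alpha=1$, the infinite series defining $W$ converges almost surely and in $L^2$, and as $n\to\infty$, $$\frac{N_0-\mathbb{E}(N_0)}{n/\log n}\xrightarrow{d}(t/t_c)\,W.$$ (2) If $1<\alpha<2$, the infinite series defining $W$ converges almost surely and in $L^2$, and as $n\to\infty$, $$\frac{N_0-\mathbb{E}(N_0)}{n^{1/\alpha}}\xrightarrow{d}(t/t_c)\,W.$$ (3) If $\alpha=2$, then as $n\to\infty$, $$\frac{N_0-\mathbb{E}(N_0)}{\sqrt{n\log n}}\xrightarrow{d}\mathcal{N}\bigl(0,\,3(t/t_c)^2/\pi^2\bigr).$$ (4) If $\alpha>2$, then as $n\to\infty$,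 $$\frac{N_0-\mathbb{E}(N_0)}{\sqrt{n}}\xrightarrow{d}\mathcal{N}\bigl(0,\,(t/t_c)^\alpha\,\zeta(\alpha-1)/\zeta(\alpha)\bigr).$$
   Context: The numbers $E_0<E_1\le E_2\le\cdots$ are the single-particle energy levels (the eigenvalues, listed with multiplicity, of a Schrödinger operator $-\frac{\hbar^2}{2m}\Delta+V$ with discrete spectrum and unique ground state); only the sequence $(E_j)$ enters. $k_B>0$ is a fixed constant (Boltzmann's constant). $\Gamma$ and $\zeta$ are the Gamma function and the Riemann zeta function. A configuration of $n$ particles is a sequence $\mathbf{n}=(n_0,n_1,\ldots)$ of non-negative integers summing to $n$; its energy is $H(\mathbf{n})=\sum_{j\ge0}n_jE_j$. The canonical Gibbs measure for $n$ bosons at temperature $T>0$ is the probability measure on configurations of $n$ particles that gives $\mathbf{n}$ mass proportional to $e^{-\beta H(\mathbf{n})}$, where $\beta=1/(k_BT)$. Define $t_c:=\dfrac{1}{k_B(L\alpha\Gamma(\alpha)\zeta(\alpha))^{1/\alpha}}$ if $\alpha>1$ and $t_c:=\dfrac{1}{k_BL}$ if $\alpha=1$. Fix $t>0$, and for each $n$ let $T=tn^{1/\alpha}$ if $\alpha>1$ and $T=tn/\log n$ (for $n\ge2$) if $\alpha=1$. $(N_0,N_1,\ldots)$ denotes a random configuration (depending on $n$) drawn from the canonical Gibbs measure for $n$ bosons at temperature $T$. $\xrightarrow{d}$ denotes convergence in distribution, and $\mathcal{N}(\mu,\sigma^2)$ is the normal distribution with mean $\mu$ and variance $\sigma^2$.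 *)

theory Defs
  imports "HOL-Probability.Probability"
begin

text \<open>The Riemann zeta function, by its Dirichlet series; used only at real arguments \<open>s > 1\<close>.\<close>

definition zeta_real :: "real \<Rightarrow> real" where
  "zeta_real s = (\<Sum>k. 1 / real (Suc k) powr s)"

definition configs :: "nat \<Rightarrow> (nat \<Rightarrow> nat) set" where
  "configs n = {c. finite {j. c j \<noteq> 0} \<and> (\<Sum>j | c j \<noteq> 0. c j) = n}"

definition energy :: "(nat \<Rightarrow> real) \<Rightarrow> (nat \<Rightarrow> nat) \<Rightarrow> real" where
  "energy E c = (\<Sum>j | c j \<noteq> 0. real (c j) * E j)"

definition partition_fun :: "(nat \<Rightarrow> real) \<Rightarrow> real \<Rightarrow> nat \<Rightarrow> real" where
  "partition_fun E \<beta> n = (\<Sum>\<^sub>\<infinity>c\<in>configs n. exp (- \<beta> * energy E c))"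

text \<open>The canonical Gibbs measure for \<open>n\<close> bosons at inverse temperature \<open>\<beta>\<close>. It is a probability
  measure whenever the Boltzmann weights are summable over \<open>configs n\<close>
  (see \<open>prob_space_gibbs\<close> below), and the null measure otherwise.\<close>

definition gibbs :: "(nat \<Rightarrow> real) \<Rightarrow> real \<Rightarrow> nat \<Rightarrow> (nat \<Rightarrow> nat) measure" where
  "gibbs E \<beta> n =
     point_measure (configs n) (\<lambda>c. ennreal (exp (- \<beta> * energy E c) / partition_fun E \<beta> n))"

lemma configs_nonempty: "configs n \<noteq> {}"
proof -
  have "(\<lambda>j. if j = 0 then n else 0) \<in> configs n"
  proof (cases "n = 0")
    case False
    then have "{j. (if j = 0 then n else 0) \<noteq> (0::nat)} = {0}" by auto
    then show ?thesis by (simp add: configs_def)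
  qed (simp add: configs_def)
  then show ?thesis by blast
qed

lemma prob_space_gibbs:
  assumes "(\<lambda>c. exp (- \<beta> * energy E c)) summable_on configs n"
  shows "prob_space (gibbs E \<beta> n)"
proof
  let ?f = "\<lambda>c. exp (- \<beta> * energy E c)"
  let ?Z = "partition_fun E \<beta> n"
  obtain c0 where c0: "c0 \<in> configs n" using configs_nonempty by blast
  have "?f c0 = infsum ?f {c0}" by simp
  also have "\<dots> \<le> ?Z"
    unfolding partition_fun_def using assms c0 by (intro infsum_mono_neutral) auto
  finally have Z: "?Z > 0" using exp_gt_zero[of "- \<beta> * energy E c0"] by linarith
  have s: "((\<lambda>c. ?f c / ?Z) has_sum 1) (configs n)"
  proof -
    have "(?f has_sum ?Z) (configs n)"
      unfolding partition_fun_def using assms by (rule has_sum_infsum)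
    from has_sum_cmult_left[OF this, of "inverse ?Z"] Z
    show ?thesis by (simp add: field_simps)
  qed
  have "(\<lambda>c. norm (?f c / ?Z)) summable_on configs n"
    using s Z by (auto simp: summable_on_def)
  then have abs: "Infinite_Set_Sum.abs_summable_on (\<lambda>c. ?f c / ?Z) (configs n)"
    by (simp only: abs_summable_equivalent)
  have "emeasure (gibbs E \<beta> n) (space (gibbs E \<beta> n))
      = (\<integral>\<^sup>+c. ennreal (?f c / ?Z) \<partial>count_space (configs n))"
    unfolding gibbs_def point_measure_def
    by (subst emeasure_density) (auto intro!: nn_integral_cong)
  also have "\<dots> = ennreal (infsetsum (\<lambda>c. ?f c / ?Z) (configs n))"
    using abs Z by (intro nn_integral_conv_infsetsum) (auto intro: divide_nonneg_pos)
  also have "infsetsum (\<lambda>c. ?f c / ?Z) (configs n) = 1"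
    using abs s by (simp add: infsetsum_infsum infsumI)
  also have "ennreal 1 = 1" by simp
  finally show "emeasure (gibbs E \<beta> n) (space (gibbs E \<beta> n)) = 1" .
qed

definition crit_temp :: "real \<Rightarrow> real \<Rightarrow> real \<Rightarrow> real" where
  "crit_temp kB L \<alpha> =
     (if \<alpha> = 1 then 1 / (kB * L)
      else 1 / (kB * (L * \<alpha> * Gamma \<alpha> * zeta_real \<alpha>) powr (1 / \<alpha>)))"

definition temp :: "real \<Rightarrow> real \<Rightarrow> nat \<Rightarrow> real" where
  "temp \<alpha> t n = (if \<alpha> = 1 then t * real n / ln (real n) else t * real n powr (1 / \<alpha>))"

definition W_term :: "(nat \<Rightarrow> real) \<Rightarrow> (nat \<Rightarrow> 'a \<Rightarrow> real) \<Rightarrow> nat \<Rightarrow> 'a \<Rightarrow> real" where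
  "W_term E X j \<omega> = (1 - X j \<omega>) / (E j - E 0)"

text \<open>The series run over \<open>j \<ge> 1\<close>, hence the index shift \<open>Suc j\<close>.\<close>

definition W_rv ::
  "(nat \<Rightarrow> real) \<Rightarrow> real \<Rightarrow> real \<Rightarrow> (nat \<Rightarrow> 'a \<Rightarrow> real) \<Rightarrow> 'a \<Rightarrow> real" where
  "W_rv E L \<alpha> X \<omega> =
     (if \<alpha> = 1 then 1 / L
      else 1 / (L * \<alpha> * Gamma \<alpha> * zeta_real \<alpha>) powr (1 / \<alpha>)) * (\<Sum>j. W_term E X (Suc j) \<omega>)"

text \<open>The series with terms \<open>Y 0, Y 1, \<dots>\<close> has square-integrable terms and its partial sums
  converge to the square-integrable \<open>S\<close> in the \<open>L\<^sup>2\<close> norm. Square integrability is part of the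
  definition because the Bochner integral of a non-integrable function is \<open>0\<close>.\<close>

definition series_converges_L2 :: "'a measure \<Rightarrow> (nat \<Rightarrow> 'a \<Rightarrow> real) \<Rightarrow> ('a \<Rightarrow> real) \<Rightarrow> bool" where
  "series_converges_L2 M Y S \<longleftrightarrow>
     (\<forall>j. Y j \<in> borel_measurable M \<and> integrable M (\<lambda>\<omega>. (Y j \<omega>)\<^sup>2)) \<and>
     S \<in> borel_measurable M \<and> integrable M (\<lambda>\<omega>. (S \<omega>)\<^sup>2) \<and>
     (\<lambda>m. \<integral>\<omega>. ((\<Sum>j<m. Y j \<omega>) - S \<omega>)\<^sup>2 \<partial>M) \<longlonglongrightarrow> 0"

text \<open>The law of \<open>(N\<^sub>0 - \<E>(N\<^sub>0)) / a\<^sub>n\<close>, where \<open>N\<^sub>0\<close> is the coordinate \<open>c 0\<close> of a random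
  configuration \<open>c\<close> drawn from the Gibbs measure at temperature \<open>temp \<alpha> t n\<close>.\<close>

definition N0_law ::
  "real \<Rightarrow> (nat \<Rightarrow> real) \<Rightarrow> real \<Rightarrow> real \<Rightarrow> (nat \<Rightarrow> real) \<Rightarrow> nat \<Rightarrow> real measure" where
  "N0_law kB E \<alpha> t a n =
     (let G = gibbs E (1 / (kB * temp \<alpha> t n)) n
      in distr G borel (\<lambda>c. (real (c 0) - (\<integral>c. real (c 0) \<partial>G)) / a n))"

text \<open>The second parameter is the variance \<open>v > 0\<close>, whereas \<open>normal_density\<close> takes the standard
  deviation.\<close>

definition normal_dist :: "real \<Rightarrow> real \<Rightarrow> real measure" where
  "normal_dist \<mu> v = density lborel (\<lambda>x. ennreal (normal_density \<mu> (sqrt v) x))"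

end

theory Submission
  imports Defs
begin

text \<open>
  Let \<open>e\<^sub>j = E\<^sub>j\<^sub>+\<^sub>1 - E\<^sub>0\<close> be the gaps and \<open>\<beta>\<close> the inverse temperature. The ground state takes whatever
  particles the excited levels leave. Hence, under the canonical measure, \<open>M = n - N\<^sub>0\<close> is distributed
  like a sum of independent geometric variables with parameters \<open>q\<^sub>j = exp (- \<beta> e\<^sub>j)\<close>, conditioned on
  \<open>M \<le> n\<close> (\<open>gibbs_excited\<close>). The unconditioned sum has the generating function
  \<open>\<Prod>j. 1 / (1 - m\<^sub>j (z - 1))\<close> with \<open>m\<^sub>j = q\<^sub>j / (1 - q\<^sub>j)\<close> (\<open>excited_generating_function\<close>). For \<open>z\<close> on the unit
  circle this product is the characteristic function, for real \<open>z\<close> near 1 it gives exponential moments,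
  and these two suffice.

  Below the critical temperature the mean of the unconditioned \<open>M\<close> is asymptotic to \<open>(t / t\<^sub>c)\<^sup>\<alpha> n\<close>
  (\<open>excited_fraction\<close>). So it stays below \<open>n\<close> by a positive fraction of \<open>n\<close>, while the fluctuations are of
  smaller order. The exponential moments then show that the conditioning changes neither the limit
  law nor, to the order of the fluctuations, the mean (\<open>canonical_fluctuations\<close>). What remains is the
  limit of \<open>\<Prod>j. geo_char m\<^sub>j (s / a\<^sub>n)\<close>, where \<open>geo_char\<close> is the characteristic function of a centred
  geometric variable.

  For \<open>\<alpha> < 2\<close> the scale is \<open>a\<^sub>n = 1 / (c \<beta>)\<close> with \<open>c = k\<^sub>B t\<close>, and the lowest levels dominate: \<open>m\<^sub>j / a\<^sub>n\<close> tends
  to \<open>c / e\<^sub>j\<close>, the geometric variables become exponential ones, and the convergence of \<open>\<Sum>j. 1 / e\<^sub>j\<^sup>2\<close> permits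
  passing to the limit in the product (\<open>geo_char_prod_tendsto_exponential\<close>). The limit is the
  characteristic function of a multiple of the random series in \<open>W\<close>, which converges by Kolmogorov's
  maximal inequality (\<open>kolmogorov_maximal\<close>). For \<open>\<alpha> \<ge> 2\<close> no single level matters on the scale \<open>a\<^sub>n\<close>, and
  Lindeberg's replacement argument gives a normal limit (\<open>geo_char_prod_tendsto_gaussian\<close>).

  The variance, like the mean, is expressed by \<open>S(x) = \<Sum>j. exp (- x e\<^sub>j)\<close>: the mean of \<open>M\<close> is
  \<open>\<Sum>k\<ge>1. S(k \<beta>)\<close> and its variance is \<open>\<Sum>k\<ge>1. k S(k \<beta>)\<close>. The level counting hypothesis implies that
  \<open>x\<^sup>\<alpha> S(x)\<close> tends to \<open>L \<Gamma>(\<alpha> + 1)\<close> as \<open>x\<close> tends to 0 (\<open>laplace_tendsto\<close>). Summation over \<open>k\<close> then produces the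
  factors \<open>\<zeta>(\<alpha>)\<close> and \<open>\<zeta>(\<alpha> - 1)\<close>, and in the borderline cases, \<open>\<alpha> = 1\<close> for the mean and \<open>\<alpha> = 2\<close> for the
  variance, a logarithm.
\<close>

section \<open>The generating function of occupation numbers\<close>

definition finite_occupations :: "(nat \<Rightarrow> nat) set" where
  "finite_occupations = {d. finite {j. d j \<noteq> 0}}"

definition occupation_monomial :: "(nat \<Rightarrow> 'a::comm_monoid_mult) \<Rightarrow> (nat \<Rightarrow> nat) \<Rightarrow> 'a" where
  "occupation_monomial y d = (\<Prod>j | d j \<noteq> 0. y j ^ d j)"

text \<open>Boxes are finite, they exhaust \<open>finite_occupations\<close>, and the sum of the monomials over a box is
  a product of finite geometric sums. Unordered sums over \<open>finite_occupations\<close> can therefore be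
  evaluated as limits along the boxes.\<close>

definition occupation_box :: "nat \<Rightarrow> (nat \<Rightarrow> nat) set" where
  "occupation_box J = {d. (\<forall>j<J. d j \<le> J) \<and> (\<forall>j\<ge>J. d j = 0)}"

lemma occupation_monomial_eq:
  assumes "\<And>j. j \<ge> J \<Longrightarrow> d j = 0"
  shows "occupation_monomial y d = (\<Prod>j<J. y j ^ d j)"
  unfolding occupation_monomial_def
proof (rule prod.mono_neutral_left)
  show "{j. d j \<noteq> 0} \<subseteq> {..<J}"
  proof
    fix j assume "j \<in> {j. d j \<noteq> 0}"
    then show "j \<in> {..<J}" using assms[of j] by (cases "J \<le> j") simp_all
  qed
qed simp_all

lemma occupation_box_bij: "bij_betw (\<lambda>g j. if j < J then g j else 0) (PiE {..<J} (\<lambda>_. {..J})) (occupation_box J)"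
  by (rule bij_betwI[where g="\<lambda>d. restrict d {..<J}"])
     (auto simp: occupation_box_def PiE_def extensional_def restrict_def)

lemma finite_occupation_box: "finite (occupation_box J)"
  using bij_betw_finite[OF occupation_box_bij[of J]] by (simp add: finite_PiE)

lemma occupation_box_subset: "occupation_box J \<subseteq> finite_occupations"
proof
  fix d assume "d \<in> occupation_box J"
  then have "j < J" if "d j \<noteq> 0" for j
    using that by (cases "J \<le> j") (simp_all add: occupation_box_def)
  then have "{j. d j \<noteq> 0} \<subseteq> {..<J}" by blast
  then show "d \<in> finite_occupations" by (simp add: finite_occupations_def finite_subset[OF _ finite_lessThan])
qed

lemma sum_occupation_box:
  fixes y :: "nat \<Rightarrow> 'a::comm_semiring_1"
  shows "sum (occupation_monomial y) (occupation_box J) = (\<Prod>j<J. \<Sum>k\<le>J. y j ^ k)"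
proof -
  have "(\<Prod>j<J. \<Sum>k\<le>J. y j ^ k) = (\<Sum>g\<in>PiE {..<J} (\<lambda>_. {..J}). \<Prod>j<J. y j ^ g j)"
    by (rule prod_sum_PiE) auto
  also have "\<dots> = (\<Sum>g\<in>PiE {..<J} (\<lambda>_. {..J}). occupation_monomial y (\<lambda>j. if j < J then g j else 0))"
    by (intro sum.cong refl, subst occupation_monomial_eq[of J]) auto
  also have "\<dots> = sum (occupation_monomial y) (occupation_box J)"
    using occupation_box_bij by (rule sum.reindex_bij_betw)
  finally show ?thesis ..
qed

lemma eventually_subset_occupation_box:
  assumes "finite F" "F \<subseteq> finite_occupations"
  shows "\<forall>\<^sub>F J in sequentially. F \<subseteq> occupation_box J"
proof -
  have "\<forall>\<^sub>F J in sequentially. d \<in> occupation_box J" if "d \<in> F" for d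
  proof -
    let ?A = "{j. d j \<noteq> 0}"
    have fin: "finite ?A" using that assms by (auto simp: finite_occupations_def)
    define N where "N = Suc (Max (insert 0 ?A) + Max (insert 0 (d ` ?A)))"
    have b: "j < N \<and> d j < N" if "j \<in> ?A" for j
      using that fin Max_ge[of "insert 0 ?A" j] Max_ge[of "insert 0 (d ` ?A)" "d j"]
      by (auto simp: N_def less_Suc_eq_le intro: trans_le_add1 trans_le_add2)
    have "d \<in> occupation_box J" if "J \<ge> N" for J
      unfolding occupation_box_def
    proof (intro CollectI conjI allI impI)
      show "d j \<le> J" for j using b[of j] that by (cases "d j = 0") auto
      show "d j = 0" if "J \<le> j" for j using b[of j] that \<open>J \<ge> N\<close> by (cases "d j = 0") auto
    qed
    then show ?thesis by (auto simp: eventually_sequentially)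
  qed
  with assms(1) have "\<forall>\<^sub>F J in sequentially. \<forall>d\<in>F. d \<in> occupation_box J"
    by (simp add: eventually_ball_finite)
  then show ?thesis by eventually_elim blast
qed

lemma filterlim_occupation_box:
  "filterlim occupation_box (finite_subsets_at_top finite_occupations) sequentially"
  unfolding filterlim_iff eventually_finite_subsets_at_top
proof safe
  fix P F assume "finite F" "F \<subseteq> finite_occupations"
    and *: "\<forall>Y. finite Y \<and> F \<subseteq> Y \<and> Y \<subseteq> finite_occupations \<longrightarrow> P Y"
  from eventually_subset_occupation_box[OF this(1,2)]
  show "\<forall>\<^sub>F J in sequentially. P (occupation_box J)"
  proof eventually_elim
    case (elim J)
    then show ?case using *[rule_format, of "occupation_box J"] finite_occupation_box occupation_box_subset by simp
  qed
qed

text \<open>Every finite set of occupations lies in a box, and the sum over a box is at most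
  \<open>\<Prod>j. 1 / (1 - \<bar>y\<^sub>j\<bar>)\<close>, which converges with \<open>\<Sum>j. \<bar>y\<^sub>j\<bar>\<close>.\<close>

lemma abs_summable_occupation_monomial:
  fixes y :: "nat \<Rightarrow> 'a::{real_normed_field, banach}"
  assumes r: "r < 1" "\<And>j. norm (y j) \<le> r" and s: "summable (\<lambda>j. norm (y j))"
  shows "occupation_monomial y abs_summable_on finite_occupations"
proof -
  define B where "B = exp (\<Sum>j. norm (y j) / (1 - r))"
  have r0: "0 \<le> r" using r(2)[of 0] norm_ge_zero order_trans by blast
  have s': "summable (\<lambda>j. norm (y j) / (1 - r))" using s by (rule summable_divide)
  have box: "(\<Sum>d\<in>occupation_box J. norm (occupation_monomial y d)) \<le> B" for J
  proof -
    have "(\<Sum>d\<in>occupation_box J. norm (occupation_monomial y d))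
        = sum (occupation_monomial (\<lambda>j. norm (y j))) (occupation_box J)"
      by (simp add: occupation_monomial_def prod_norm flip: norm_power)
    also have "\<dots> = (\<Prod>j<J. \<Sum>k\<le>J. norm (y j) ^ k)" by (rule sum_occupation_box)
    also have "\<dots> \<le> (\<Prod>j<J. exp (norm (y j) / (1 - r)))"
    proof (intro prod_mono conjI sum_nonneg)
      fix j
      let ?a = "norm (y j)"
      have a: "0 \<le> ?a" "?a < 1" using r(2)[of j] r(1) by auto
      have "(\<Sum>k\<le>J. ?a ^ k) \<le> (\<Sum>k. ?a ^ k)"
        using a by (intro sum_le_suminf summable_geometric) auto
      also have "\<dots> = 1 / (1 - ?a)" using a by (intro suminf_geometric) auto
      also have "\<dots> = 1 + ?a / (1 - ?a)" using a by (simp add: field_simps)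
      also have "\<dots> \<le> 1 + ?a / (1 - r)"
        using a r(1) r(2)[of j] by (intro add_left_mono divide_left_mono) auto
      also have "\<dots> \<le> exp (?a / (1 - r))" by (rule exp_ge_add_one_self)
      finally show "(\<Sum>k\<le>J. ?a ^ k) \<le> exp (?a / (1 - r))" .
    qed simp
    also have "\<dots> = exp (\<Sum>j<J. norm (y j) / (1 - r))" by (simp add: exp_sum)
    also have "\<dots> \<le> B"
      unfolding B_def using s' r(1) by (simp add: sum_le_suminf)
    finally show ?thesis .
  qed
  show ?thesis
    unfolding abs_summable_iff_bdd_above
  proof (rule bdd_aboveI2)
    fix F assume F: "F \<in> {F. F \<subseteq> finite_occupations \<and> finite F}"
    then obtain J where "F \<subseteq> occupation_box J"
      using eventually_happens'[OF sequentially_bot eventually_subset_occupation_box] by blast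
    then have "(\<Sum>d\<in>F. norm (occupation_monomial y d)) \<le> (\<Sum>d\<in>occupation_box J. norm (occupation_monomial y d))"
      by (intro sum_mono2 finite_occupation_box) auto
    also have "\<dots> \<le> B" by (rule box)
    finally show "(\<Sum>d\<in>F. norm (occupation_monomial y d)) \<le> B" .
  qed
qed

text \<open>The sum over the box of side \<open>J\<close> is \<open>\<Prod>j<J. (1 - y\<^sub>j\<^sup>J\<^sup>+\<^sup>1) / (1 - y\<^sub>j)\<close>. The product of the numerators
  tends to 1, because their distances from 1 add up to at most \<open>r\<^sup>J \<Sum>j. \<bar>y\<^sub>j\<bar>\<close>.\<close>

lemma occupation_generating_function:
  fixes y :: "nat \<Rightarrow> 'a::{real_normed_field, banach}"
  assumes r: "r < 1" "\<And>j. norm (y j) \<le> r" and s: "summable (\<lambda>j. norm (y j))"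
  shows "(\<lambda>J. \<Prod>j<J. 1 / (1 - y j)) \<longlonglongrightarrow> infsum (occupation_monomial y) finite_occupations"
proof -
  have r0: "0 \<le> r" using r(2)[of 0] norm_ge_zero order_trans by blast
  have y1: "y j \<noteq> 1" for j using r(1) r(2)[of j] by auto
  define C where "C = (\<Sum>j. norm (y j))"
  have "(occupation_monomial y has_sum infsum (occupation_monomial y) finite_occupations) finite_occupations"
    using abs_summable_summable[OF abs_summable_occupation_monomial[OF assms]] by (rule has_sum_infsum)
  then have "(\<lambda>J. sum (occupation_monomial y) (occupation_box J))
      \<longlonglongrightarrow> infsum (occupation_monomial y) finite_occupations"
    unfolding has_sum_def by (rule filterlim_compose[OF _ filterlim_occupation_box])
  then have box: "(\<lambda>J. \<Prod>j<J. (1 - y j ^ Suc J) / (1 - y j)) \<longlonglongrightarrow> infsum (occupation_monomial y) finite_occupations"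
    using y1 by (simp add: sum_occupation_box sum_gp0)
  have le: "norm ((\<Prod>j<J. 1 + (- (y j ^ Suc J))) - 1) \<le> exp (r ^ J * C) - 1" for J
  proof -
    have "norm ((\<Prod>j<J. 1 + (- (y j ^ Suc J))) - 1) \<le> (\<Prod>j<J. 1 + norm (- (y j ^ Suc J))) - 1"
      by (rule norm_prod_minus1_le_prod_minus1)
    also have "(\<Prod>j<J. 1 + norm (- (y j ^ Suc J))) \<le> (\<Prod>j<J. exp (r ^ J * norm (y j)))"
    proof (intro prod_mono conjI)
      fix j
      have eq: "norm (- (y j ^ Suc J)) = norm (y j) ^ J * norm (y j)" by (simp add: norm_mult norm_power)
      have "norm (- (y j ^ Suc J)) \<le> r ^ J * norm (y j)"
        unfolding eq using r(2) by (intro mult_right_mono power_mono) auto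
      then have "exp (norm (- (y j ^ Suc J))) \<le> exp (r ^ J * norm (y j))" by (simp only: exp_le_cancel_iff)
      with exp_ge_add_one_self show "1 + norm (- (y j ^ Suc J)) \<le> exp (r ^ J * norm (y j))"
        by (rule order_trans)
    qed (simp_all only: add_nonneg_nonneg norm_ge_zero zero_le_one)
    also have "\<dots> = exp (r ^ J * (\<Sum>j<J. norm (y j)))" by (simp add: exp_sum sum_distrib_left)
    also have "\<dots> \<le> exp (r ^ J * C)"
      unfolding C_def using s r0 by (auto intro!: mult_left_mono sum_le_suminf)
    finally show ?thesis by simp
  qed
  have "(\<lambda>J. r ^ J) \<longlonglongrightarrow> 0" using r(1) r0 by (intro LIMSEQ_power_zero) simp
  then have "(\<lambda>J. exp (r ^ J * C) - 1) \<longlonglongrightarrow> exp (0 * C) - 1"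
    by (intro tendsto_diff tendsto_exp tendsto_mult_right tendsto_const)
  then have "(\<lambda>J. (\<Prod>j<J. 1 + (- (y j ^ Suc J))) - 1) \<longlonglongrightarrow> 0"
    by (intro Lim_null_comparison[OF always_eventually[OF allI[OF le]]]) simp
  then have one: "(\<lambda>J. \<Prod>j<J. 1 - y j ^ Suc J) \<longlonglongrightarrow> 1"
    by (simp add: LIM_zero_iff)
  have "(\<lambda>J. (\<Prod>j<J. (1 - y j ^ Suc J) / (1 - y j)) / (\<Prod>j<J. 1 - y j ^ Suc J))
      \<longlonglongrightarrow> infsum (occupation_monomial y) finite_occupations / 1"
    by (intro tendsto_divide box one) simp
  moreover have "1 - y j ^ Suc J \<noteq> 0" for j J
  proof
    assume "1 - y j ^ Suc J = 0"
    then have "norm (y j ^ Suc J) = 1" by (simp only: eq_iff_diff_eq_0[symmetric] norm_one)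
    moreover have "norm (y j) < 1" using r(1) r(2)[of j] by (rule le_less_trans[rotated])
    then have "norm (y j) ^ Suc J < 1" using power_strict_mono[of "norm (y j)" 1 "Suc J"] by simp
    ultimately show False by (simp only: norm_power less_irrefl)
  qed
  then have "(\<Prod>j<J. 1 - y j ^ Suc J) \<noteq> 0" for J by simp
  then have "(\<Prod>j<J. (1 - y j ^ Suc J) / (1 - y j)) / (\<Prod>j<J. 1 - y j ^ Suc J) = (\<Prod>j<J. 1 / (1 - y j))" for J
    by (simp add: prod_dividef divide_simps)
  ultimately show ?thesis by simp
qed

section \<open>Configurations and their excited part\<close>

lemma sum_support_eq:
  fixes f :: "nat \<Rightarrow> 'b::comm_monoid_add"
  assumes "\<And>j. j \<ge> N \<Longrightarrow> c j = (0::nat)" "\<And>j. c j = 0 \<Longrightarrow> f j = 0"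
  shows "(\<Sum>j | c j \<noteq> 0. f j) = (\<Sum>j<N. f j)"
proof (rule sum.mono_neutral_left)
  show "{j. c j \<noteq> 0} \<subseteq> {..<N}"
  proof
    fix j assume "j \<in> {j. c j \<noteq> 0}"
    then show "j \<in> {..<N}" using assms(1)[of j] by (cases "N \<le> j") simp_all
  qed
qed (use assms(2) in auto)

lemma finite_support_bound:
  fixes c :: "nat \<Rightarrow> nat"
  assumes "finite {j. c j \<noteq> (0::nat)}"
  obtains N where "\<And>j. j \<ge> N \<Longrightarrow> c j = 0"
proof -
  from assms[unfolded finite_nat_set_iff_bounded] obtain N where "\<forall>j\<in>{j. c j \<noteq> 0}. j < N" by blast
  then have "c j = 0" if "j \<ge> N" for j using that by (meson linorder_not_less mem_Collect_eq)
  then show ?thesis using that by blast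
qed

lemma finite_occupations_eq: "finite_occupations = (\<Union>m. configs m)"
  by (auto simp: finite_occupations_def configs_def)

lemma configs_disjoint: "d \<in> configs m \<Longrightarrow> d \<in> configs m' \<Longrightarrow> m = m'"
  by (simp add: configs_def)

lemma bij_snd_configs: "bij_betw snd (Sigma UNIV configs) finite_occupations"
  unfolding bij_betw_def inj_on_def finite_occupations_eq
  using configs_disjoint by (force simp: image_iff)

text \<open>The occupation numbers of the excited levels are indexed from 0, so that they are themselves
  configurations (of fewer particles); their entry \<open>i\<close> refers to the level \<open>Suc i\<close>.\<close>

definition add_ground :: "nat \<Rightarrow> (nat \<Rightarrow> nat) \<Rightarrow> nat \<Rightarrow> nat" where
  "add_ground k d = (\<lambda>j. case j of 0 \<Rightarrow> k | Suc i \<Rightarrow> d i)"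

lemma add_ground_simps [simp]: "add_ground k d 0 = k" "add_ground k d (Suc i) = d i"
  by (simp_all add: add_ground_def)

lemma add_ground_bound:
  assumes "\<And>j. j \<ge> N \<Longrightarrow> d j = 0" "j \<ge> Suc N"
  shows "add_ground k d j = 0"
  using assms by (cases j) auto

lemma add_ground_configs:
  assumes "d \<in> configs m"
  shows "add_ground k d \<in> configs (k + m)"
proof -
  have "finite {j. d j \<noteq> 0}" using assms by (simp only: configs_def mem_Collect_eq)
  then obtain N where N: "\<And>j. j \<ge> N \<Longrightarrow> d j = 0" by (rule finite_support_bound, blast)
  have "{j. add_ground k d j \<noteq> 0} \<subseteq> {..<Suc N}"
  proof
    fix j assume "j \<in> {j. add_ground k d j \<noteq> 0}"
    then show "j \<in> {..<Suc N}" using add_ground_bound[OF N, where j=j and k=k] by (cases "Suc N \<le> j") auto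
  qed
  then have "finite {j. add_ground k d j \<noteq> 0}" using finite_subset by blast
  moreover have "(\<Sum>j | add_ground k d j \<noteq> 0. add_ground k d j) = (\<Sum>j<Suc N. add_ground k d j)"
    by (rule sum_support_eq[OF add_ground_bound[OF N]]) auto
  moreover have "\<dots> = k + (\<Sum>j<N. d j)" unfolding sum.lessThan_Suc_shift by simp
  moreover have "(\<Sum>j<N. d j) = m" using assms sum_support_eq[OF N, where f=d] by (simp add: configs_def)
  ultimately show ?thesis by (simp add: configs_def)
qed

lemma tail_configs:
  assumes "c \<in> configs n"
  shows "c 0 \<le> n" "(\<lambda>j. c (Suc j)) \<in> configs (n - c 0)" "c = add_ground (c 0) (\<lambda>j. c (Suc j))"
proof -
  have "finite {j. c j \<noteq> 0}" using assms by (simp only: configs_def mem_Collect_eq)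
  then obtain N where N: "\<And>j. j \<ge> N \<Longrightarrow> c j = 0" by (rule finite_support_bound, blast)
  then have N1: "\<And>j. j \<ge> Suc N \<Longrightarrow> c j = 0" and N2: "\<And>j. j \<ge> N \<Longrightarrow> c (Suc j) = 0" by auto
  have "n = (\<Sum>j<Suc N. c j)" using assms sum_support_eq[OF N1, where f=c] by (simp add: configs_def)
  also have "\<dots> = c 0 + (\<Sum>j<N. c (Suc j))" unfolding sum.lessThan_Suc_shift by simp
  also have "(\<Sum>j<N. c (Suc j)) = (\<Sum>j | c (Suc j) \<noteq> 0. c (Suc j))"
    by (rule sum_support_eq[OF N2, symmetric]) auto
  finally have n: "n = c 0 + (\<Sum>j | c (Suc j) \<noteq> 0. c (Suc j))" .
  have "{j. c (Suc j) \<noteq> 0} \<subseteq> {..<N}"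
  proof
    fix j assume "j \<in> {j. c (Suc j) \<noteq> 0}"
    then show "j \<in> {..<N}" using N2[of j] by (cases "N \<le> j") auto
  qed
  then have "finite {j. c (Suc j) \<noteq> 0}" using finite_subset by blast
  with n show "c 0 \<le> n" "(\<lambda>j. c (Suc j)) \<in> configs (n - c 0)"
    by (simp_all add: configs_def)
  show "c = add_ground (c 0) (\<lambda>j. c (Suc j))"
    by (rule ext) (simp add: add_ground_def split: nat.split)
qed

text \<open>Measuring energies from the ground state splits off a term that depends on the total number of
  particles only. It cancels in the canonical Gibbs measure.\<close>

lemma energy_add_ground:
  assumes "d \<in> configs m"
  shows "energy E (add_ground k d) = real (k + m) * E 0 + energy (\<lambda>j. E (Suc j) - E 0) d"
proof -
  have "finite {j. d j \<noteq> 0}" using assms by (simp only: configs_def mem_Collect_eq)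
  then obtain N where N: "\<And>j. j \<ge> N \<Longrightarrow> d j = 0" by (rule finite_support_bound, blast)
  have "energy E (add_ground k d) = (\<Sum>j<Suc N. real (add_ground k d j) * E j)"
    unfolding energy_def by (rule sum_support_eq[OF add_ground_bound[OF N]]) auto
  also have "\<dots> = real k * E 0 + (\<Sum>j<N. real (d j) * E (Suc j))"
    unfolding sum.lessThan_Suc_shift by simp
  also have "(\<Sum>j<N. real (d j) * E (Suc j)) = real (\<Sum>j<N. d j) * E 0 + (\<Sum>j<N. real (d j) * (E (Suc j) - E 0))"
  proof -
    have "(\<Sum>j<N. real (d j) * E (Suc j)) = (\<Sum>j<N. real (d j) * E 0 + real (d j) * (E (Suc j) - E 0))"
      by (simp add: right_diff_distrib)
    then show ?thesis by (simp only: sum.distrib sum_distrib_right of_nat_sum)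
  qed
  also have "(\<Sum>j<N. d j) = m" using assms sum_support_eq[OF N, where f=d] by (simp add: configs_def)
  also have "(\<Sum>j<N. real (d j) * (E (Suc j) - E 0)) = energy (\<lambda>j. E (Suc j) - E 0) d"
    unfolding energy_def by (rule sum_support_eq[OF N, symmetric]) auto
  finally show ?thesis by (simp add: algebra_simps)
qed

lemma exp_energy: "exp (- \<beta> * energy e d) = occupation_monomial (\<lambda>j. exp (- \<beta> * e j)) d"
proof (cases "finite {j. d j \<noteq> 0}")
  case True
  have "exp (- \<beta> * energy e d) = exp (\<Sum>j | d j \<noteq> 0. real (d j) * (- \<beta> * e j))"
    by (simp add: energy_def sum_distrib_left mult_ac sum_negf)
  also have "\<dots> = (\<Prod>j | d j \<noteq> 0. exp (real (d j) * (- \<beta> * e j)))" using True by (rule exp_sum)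
  finally show ?thesis unfolding occupation_monomial_def by (simp only: exp_of_nat_mult)
qed (simp add: energy_def occupation_monomial_def)

lemma occupation_monomial_scale:
  fixes q :: "nat \<Rightarrow> real" and z :: "'a::real_normed_field"
  assumes "d \<in> configs m"
  shows "occupation_monomial (\<lambda>j. z * of_real (q j)) d = z ^ m * of_real (occupation_monomial q d)"
  using assms
  by (simp add: occupation_monomial_def power_mult_distrib prod.distrib power_sum[symmetric] configs_def)

section \<open>Products of centred geometric characteristic functions\<close>

text \<open>The characteristic function of \<open>G - m\<close> for a geometric random variable \<open>G\<close> on \<open>{0, 1, \<dots>}\<close> with mean
  \<open>m\<close>. The variance of \<open>G\<close> is \<open>m + m\<^sup>2\<close>.\<close>

definition geo_char :: "real \<Rightarrow> real \<Rightarrow> complex" where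
  "geo_char m \<theta> = exp (- (\<i> * of_real (\<theta> * m))) / (1 - of_real m * (exp (\<i> * of_real \<theta>) - 1))"

lemma norm_geo_denominator: 
  assumes "0 \<le> m"
  shows "1 \<le> norm (1 - complex_of_real m * (exp (\<i> * of_real \<theta>) - 1))"
proof -
  have "1 \<le> 1 + m * (1 - cos \<theta>)" using assms by simp
  also have "\<dots> = Re (1 - complex_of_real m * (exp (\<i> * of_real \<theta>) - 1))"
    by (simp add: Re_exp algebra_simps)
  also have "\<dots> \<le> norm (1 - complex_of_real m * (exp (\<i> * of_real \<theta>) - 1))"
    by (rule complex_Re_le_cmod)
  finally show ?thesis .
qed

lemma norm_geo_char_le_1: "0 \<le> m \<Longrightarrow> norm (geo_char m \<theta>) \<le> 1"
  using norm_geo_denominator[of m \<theta>] by (simp add: geo_char_def norm_divide divide_le_eq_1)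

lemma exp_third_order:
  fixes x :: complex
  assumes "norm x \<le> 1"
  shows "norm (exp x - (1 + x + x\<^sup>2 / 2)) \<le> 2 * norm x ^ 3"
proof -
  have "norm (exp x - (\<Sum>k\<le>2. x ^ k / fact k)) \<le> exp \<bar>Re x\<bar> * norm x ^ Suc 2 / fact 2"
    by (rule Taylor_exp)
  also have "\<dots> \<le> exp 1 * norm x ^ Suc 2 / fact 2"
    using assms abs_Re_le_cmod[of x] by (intro divide_right_mono mult_right_mono) auto
  also have "\<dots> \<le> 3 * norm x ^ Suc 2 / fact 2"
    using exp_le by (intro divide_right_mono mult_right_mono) auto
  also have "\<dots> = 3/2 * norm x ^ 3" by (simp add: fact_numeral power3_eq_cube)
  also have "\<dots> \<le> 2 * norm x ^ 3" by (intro mult_right_mono) auto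
  also have "(\<Sum>k\<le>2. x ^ k / fact k) = 1 + x + x\<^sup>2 / 2" by (simp add: numeral_2_eq_2)
  finally show ?thesis .
qed

text \<open>Since \<open>(1 - w) (1 + w + w\<^sup>2) = 1 - w\<^sup>3\<close>, the quadratic Taylor polynomial of \<open>- ln (1 - w)\<close> inverts
  \<open>1 - w\<close> up to third order. This replaces an expansion of the complex logarithm.\<close>

lemma one_minus_times_exp:
  fixes w :: complex
  assumes "norm w \<le> 1/4"
  shows "norm ((1 - w) * exp (w + w\<^sup>2 / 2) - 1) \<le> 6 * norm w ^ 3"
proof -
  define x where "x = w + w\<^sup>2 / 2"
  define R where "R = exp x - (1 + x + x\<^sup>2 / 2)"
  have nx: "norm x \<le> 9/8 * norm w"
  proof -
    have "norm x \<le> norm w + norm w * norm w / 2"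
      unfolding x_def by (rule order_trans[OF norm_triangle_ineq]) (simp add: norm_divide norm_mult power2_eq_square)
    also have "norm w * norm w \<le> norm w * (1/4)" using assms by (intro mult_left_mono) auto
    finally show ?thesis by simp
  qed
  have "norm R \<le> 2 * norm x ^ 3" unfolding R_def using nx assms by (intro exp_third_order) auto
  also have "\<dots> \<le> 2 * (9/8 * norm w) ^ 3" using nx by (intro mult_left_mono power_mono) auto
  also have "\<dots> \<le> 3 * norm w ^ 3" by (simp add: power3_eq_cube)
  finally have R: "norm R \<le> 3 * norm w ^ 3" .
  \<comment> \<open>\<open>1 + x + x\<^sup>2 / 2 = 1 + w + w\<^sup>2 + w\<^sup>3 / 2 + w\<^sup>4 / 8\<close>\<close>
  have "(1 - w) * exp x - 1 = - (w ^ 3) + (1 - w) * (w ^ 3 / 2 + w ^ 4 / 8 + R)"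
    by (simp add: R_def x_def power2_eq_square power3_eq_cube power4_eq_xxxx field_simps)
  then have "norm ((1 - w) * exp x - 1) \<le> norm w ^ 3 + norm (1 - w) * norm (w ^ 3 / 2 + w ^ 4 / 8 + R)"
    by (metis (no_types, opaque_lifting) norm_triangle_ineq norm_minus_cancel norm_mult norm_power)
  also have "\<dots> \<le> norm w ^ 3 + (5/4) * (norm w ^ 3 / 2 + norm w ^ 3 / 32 + 3 * norm w ^ 3)"
  proof (intro add_left_mono mult_mono)
    show "norm (1 - w) \<le> 5/4" using norm_triangle_ineq4[of 1 w] assms by simp
    have "norm (w ^ 3 / 2 + w ^ 4 / 8 + R) \<le> norm w ^ 3 / 2 + norm w ^ 4 / 8 + norm R"
      by (rule order_trans[OF norm_triangle_ineq add_mono[OF norm_triangle_ineq order_refl], THEN order_trans])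
         (simp add: norm_divide norm_power)
    also have "norm w ^ 4 \<le> norm w ^ 3 * (1/4)"
      using mult_left_mono[OF assms, of "norm w ^ 3"] by (simp add: power3_eq_cube power4_eq_xxxx)
    finally show "norm (w ^ 3 / 2 + w ^ 4 / 8 + R) \<le> norm w ^ 3 / 2 + norm w ^ 3 / 32 + 3 * norm w ^ 3"
      using R by simp
  qed auto
  also have "\<dots> \<le> 6 * norm w ^ 3"
    using zero_le_power[of "norm w" 3] by (simp add: power3_eq_cube field_simps)
  finally show ?thesis by (simp add: x_def)
qed

text \<open>Put \<open>w = m (exp (i \<theta>) - 1)\<close>. To second order the logarithm of \<open>geo_char m \<theta>\<close> is
  \<open>- i \<theta> m + w + w\<^sup>2 / 2\<close>, whose expansion in \<open>\<theta>\<close> starts with \<open>- \<theta>\<^sup>2 (m + m\<^sup>2) / 2\<close>. The error is the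
  variance times a \<^emph>\<open>single\<close> factor \<open>1 + m\<close>, as it would be for a third absolute moment. This is what
  makes it summable over the levels: in the applications \<open>\<theta> (1 + m)\<close> tends to 0, but \<open>\<theta> (1 + m)\<^sup>2\<close>
  need not.\<close>

lemma geo_char_gaussian_approximation:
  assumes m: "0 \<le> m" and \<theta>: "\<bar>\<theta>\<bar> \<le> 1" "m * \<bar>\<theta>\<bar> \<le> 1/4"
  shows "norm (geo_char m \<theta> - of_real (exp (- (\<theta>\<^sup>2 * (m + m\<^sup>2) / 2)))) \<le> 6 * \<bar>\<theta>\<bar> ^ 3 * ((m + m\<^sup>2) * (1 + m))"
proof -
  define u where "u = exp (\<i> * complex_of_real \<theta>) - 1"
  define w where "w = complex_of_real m * u"
  \<comment> \<open>\<open>\<rho>\<close> is the error of the exponents, \<open>\<eta>\<close> that of \<open>one_minus_times_exp\<close>\<close>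
  define \<rho> where "\<rho> = - (of_real m * (u - \<i> * \<theta> + \<theta>\<^sup>2 / 2)) - (of_real m)\<^sup>2 * (u\<^sup>2 + of_real (\<theta>\<^sup>2)) / 2"
  define \<eta> where "\<eta> = (1 - w) * exp (w + w\<^sup>2 / 2) - 1"
  define f where "f = geo_char m \<theta>"
  define g where "g = complex_of_real (exp (- (\<theta>\<^sup>2 * (m + m\<^sup>2) / 2)))"
  define q where "q = \<bar>\<theta>\<bar> ^ 3"
  have q0: "0 \<le> q" by (simp add: q_def)
  have u1: "norm u \<le> \<bar>\<theta>\<bar>" using iexp_approx1[of \<theta> 0] by (simp add: u_def)
  have u2: "norm (u - \<i> * \<theta>) \<le> \<bar>\<theta>\<bar>\<^sup>2 / 2" using iexp_approx1[of \<theta> 1] 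
    by (simp add: u_def algebra_simps numeral_2_eq_2)
  have "(\<Sum>k\<le>2. (\<i> * complex_of_real \<theta>) ^ k / fact k) = 1 + \<i> * \<theta> - \<theta>\<^sup>2 / 2"
    by (simp add: numeral_2_eq_2 power_mult_distrib)
  moreover have eq: "u - \<i> * \<theta> + \<theta>\<^sup>2 / 2 = exp (\<i> * \<theta>) - (1 + \<i> * \<theta> - \<theta>\<^sup>2 / 2)"
    by (simp add: u_def)
  moreover have "norm (exp (\<i> * \<theta>) - (\<Sum>k\<le>2. (\<i> * complex_of_real \<theta>) ^ k / fact k)) \<le> q / 6"
    using iexp_approx1[of \<theta> 2] by (simp add: q_def fact_numeral)
  ultimately have u3: "norm (u - \<i> * \<theta> + \<theta>\<^sup>2 / 2) \<le> q / 6" by (simp only: eq)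
  have "u\<^sup>2 + of_real (\<theta>\<^sup>2) = (u - \<i> * \<theta>) * (u + \<i> * \<theta>)"
    by (simp add: power2_eq_square algebra_simps)
  then have "norm (u\<^sup>2 + of_real (\<theta>\<^sup>2)) = norm (u - \<i> * \<theta>) * norm (u + \<i> * \<theta>)"
    by (simp only: norm_mult)
  also have "\<dots> \<le> (\<bar>\<theta>\<bar>\<^sup>2 / 2) * (2 * \<bar>\<theta>\<bar>)"
    using u1 u2 norm_triangle_ineq[of u "\<i> * \<theta>"] by (intro mult_mono) (auto simp: norm_mult)
  finally have u4: "norm (u\<^sup>2 + of_real (\<theta>\<^sup>2)) \<le> q" by (simp add: power2_eq_square power3_eq_cube q_def)
  have w: "norm w \<le> m * \<bar>\<theta>\<bar>" using m u1 by (simp add: w_def norm_mult mult_left_mono)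
  have "norm w ^ 3 \<le> (m * \<bar>\<theta>\<bar>) ^ 3" using w by (intro power_mono) auto
  then have w3: "norm w ^ 3 \<le> m ^ 3 * q" by (simp add: power_mult_distrib q_def)
  have \<eta>: "norm \<eta> \<le> 6 * (m ^ 3 * q)" and w14: "norm w \<le> 1/4"
    using one_minus_times_exp[of w] w \<theta> w3 by (auto simp: \<eta>_def)
  have "norm w ^ 3 \<le> (1/4) ^ 3" using w14 by (intro power_mono) auto
  then have \<eta>1: "norm \<eta> \<le> 1" using one_minus_times_exp[OF w14] by (auto simp: \<eta>_def power3_eq_cube)
  have \<rho>: "norm \<rho> \<le> m * q / 6 + m\<^sup>2 * q / 2"
  proof -
    have "norm \<rho> \<le> norm (of_real m * (u - \<i> * \<theta> + \<theta>\<^sup>2 / 2)) + norm ((of_real m)\<^sup>2 * (u\<^sup>2 + of_real (\<theta>\<^sup>2)) / 2)"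
      unfolding \<rho>_def by (metis norm_minus_cancel norm_triangle_ineq4)
    also have "\<dots> = m * norm (u - \<i> * \<theta> + \<theta>\<^sup>2 / 2) + m\<^sup>2 * norm (u\<^sup>2 + of_real (\<theta>\<^sup>2)) / 2"
      unfolding norm_mult norm_divide norm_power norm_of_real using m by simp
    also have "\<dots> \<le> m * (q / 6) + m\<^sup>2 * q / 2"
      using m by (intro add_mono mult_left_mono divide_right_mono u3 u4) auto
    finally show ?thesis by simp
  qed
  have "m * q = (m * \<bar>\<theta>\<bar>) * (\<bar>\<theta>\<bar> * \<bar>\<theta>\<bar>)" by (simp add: q_def power3_eq_cube)
  also have "\<dots> \<le> (1/4) * (1 * 1)" using \<theta> m by (intro mult_mono) auto
  finally have mq: "m * q \<le> 1/4" by simp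
  have "m\<^sup>2 * q = (m * \<bar>\<theta>\<bar>) * (m * \<bar>\<theta>\<bar>) * \<bar>\<theta>\<bar>" by (simp add: q_def power3_eq_cube power2_eq_square)
  also have "\<dots> \<le> (1/4) * (1/4) * 1" using \<theta> m by (intro mult_mono) auto
  finally have \<rho>1: "norm \<rho> \<le> 1" using \<rho> mq by simp
  have e\<rho>: "norm (exp \<rho> - 1) \<le> 3 * norm \<rho>"
  proof -
    have "norm (exp \<rho> - 1) \<le> exp \<bar>Re \<rho>\<bar> * norm \<rho>" using Taylor_exp[of \<rho> 0] by simp
    also have "\<dots> \<le> exp 1 * norm \<rho>" using \<rho>1 abs_Re_le_cmod[of \<rho>] by (intro mult_right_mono) auto
    also have "\<dots> \<le> 3 * norm \<rho>" using exp_le by (intro mult_right_mono) auto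
    finally show ?thesis .
  qed
  have d: "1 - w \<noteq> 0"
  proof
    assume "1 - w = 0"
    then have "w = 1" by simp
    then show False using w14 by simp
  qed
  have "f = exp (- (\<i> * of_real (\<theta> * m))) / (1 - w)"
    by (simp only: f_def geo_char_def w_def u_def)
  with d have f_eq: "f * (1 - w) = exp (- (\<i> * of_real (\<theta> * m)))" by simp
  have "\<rho> + (- (\<i> * of_real (\<theta> * m))) + (w + w\<^sup>2 / 2) = of_real (- (\<theta>\<^sup>2 * (m + m\<^sup>2) / 2))"
    by (simp add: \<rho>_def w_def power2_eq_square field_simps)
  then have "g = exp \<rho> * exp (- (\<i> * of_real (\<theta> * m))) * exp (w + w\<^sup>2 / 2)"
    by (simp only: g_def exp_of_real[symmetric] exp_add[symmetric])
  also have "\<dots> = f * (exp \<rho> * (1 + \<eta>))" unfolding f_eq[symmetric] \<eta>_def by (simp add: mult_ac)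
  finally have "f - g = f * (1 - exp \<rho> * (1 + \<eta>))" by (simp add: algebra_simps)
  then have "norm (f - g) = norm f * norm (1 - exp \<rho> * (1 + \<eta>))" by (simp add: norm_mult)
  also have "\<dots> \<le> 1 * norm (1 - exp \<rho> * (1 + \<eta>))"
    using norm_geo_char_le_1[OF m] by (intro mult_right_mono) (auto simp: f_def)
  also have "1 - exp \<rho> * (1 + \<eta>) = - ((exp \<rho> - 1) * (1 + \<eta>) + \<eta>)" by (simp add: algebra_simps)
  also have "1 * norm \<dots> \<le> norm (exp \<rho> - 1) * norm (1 + \<eta>) + norm \<eta>"
    unfolding mult_1 norm_minus_cancel norm_mult[symmetric] by (rule norm_triangle_ineq)
  also have "norm (exp \<rho> - 1) * norm (1 + \<eta>) + norm \<eta> \<le> (3 * norm \<rho>) * 2 + norm \<eta>"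
    using e\<rho> \<eta>1 norm_triangle_ineq[of 1 \<eta>] by (intro add_mono mult_mono) auto
  also have "(3 * norm \<rho>) * 2 + norm \<eta> \<le> 6 * (m * q / 6 + m\<^sup>2 * q / 2) + 6 * (m ^ 3 * q)"
    using mult_left_mono[OF \<rho>, of 6] \<eta> by simp
  also have "\<dots> \<le> 6 * q * ((m + m\<^sup>2) * (1 + m))"
  proof -
    have "6 * q * ((m + m\<^sup>2) * (1 + m)) - (6 * (m * q / 6 + m\<^sup>2 * q / 2) + 6 * (m ^ 3 * q))
        = q * (5 * m + 9 * m\<^sup>2)"
      by (simp add: power2_eq_square power3_eq_cube field_simps)
    moreover have "\<dots> \<ge> 0" using q0 m by simp
    ultimately show ?thesis by linarith
  qed
  finally show ?thesis by (simp add: f_def g_def q_def)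
qed

text \<open>When \<open>m \<bar>\<theta>\<bar> > 1/4\<close> the right-hand side exceeds 2, and the estimate is trivial.\<close>

lemma norm_geo_char_minus_1_le:
  assumes m: "0 \<le> m" and \<theta>: "\<bar>\<theta>\<bar> \<le> 1"
  shows "norm (geo_char m \<theta> - 1) \<le> 32 * (\<theta>\<^sup>2 * (m + m\<^sup>2))"
proof (cases "m * \<bar>\<theta>\<bar> \<le> 1/4")
  case True
  define v where "v = \<theta>\<^sup>2 * (m + m\<^sup>2)"
  have v0: "0 \<le> v" using m by (simp add: v_def)
  have 1: "norm (of_real (exp (- (v / 2))) - (1::complex)) \<le> v / 2"
  proof -
    have "norm (of_real (exp (- (v / 2))) - (1::complex)) = \<bar>exp (- (v / 2)) - 1\<bar>"
      by (metis norm_of_real of_real_1 of_real_diff)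
    also have "\<dots> = 1 - exp (- (v / 2))" using v0 by simp
    finally show ?thesis using exp_ge_add_one_self[of "- (v / 2)"] by linarith
  qed
  have "norm (geo_char m \<theta> - of_real (exp (- (v / 2)))) \<le> 6 * \<bar>\<theta>\<bar> ^ 3 * ((m + m\<^sup>2) * (1 + m))"
    unfolding v_def by (rule geo_char_gaussian_approximation[OF m \<theta> True])
  also have "\<dots> = 6 * v * (\<bar>\<theta>\<bar> + m * \<bar>\<theta>\<bar>)"
    by (simp add: v_def power2_eq_square power3_eq_cube algebra_simps flip: abs_mult)
  also have "\<dots> \<le> 6 * v * (1 + 1/4)" using True \<theta> v0 by (intro mult_left_mono add_mono) auto
  finally have 2: "norm (geo_char m \<theta> - of_real (exp (- (v / 2)))) \<le> 15/2 * v" by simp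
  have "norm (geo_char m \<theta> - 1) \<le> norm (geo_char m \<theta> - of_real (exp (- (v / 2)))) + norm (of_real (exp (- (v / 2))) - (1::complex))"
    using norm_triangle_ineq[of "geo_char m \<theta> - of_real (exp (- (v / 2)))" "of_real (exp (- (v / 2))) - 1"] by simp
  then show ?thesis using 1 2 v0 unfolding v_def[symmetric] by linarith
next
  case False
  have "(1/16::real) = (1/4)\<^sup>2" by (simp add: power2_eq_square)
  also have "(1/4)\<^sup>2 \<le> (m * \<bar>\<theta>\<bar>)\<^sup>2" using False by (intro power_mono) auto
  also have "\<dots> = \<theta>\<^sup>2 * m\<^sup>2" by (simp add: power_mult_distrib)
  also have "\<dots> \<le> \<theta>\<^sup>2 * (m + m\<^sup>2)" using m by (intro mult_left_mono) auto
  finally have "2 \<le> 32 * (\<theta>\<^sup>2 * (m + m\<^sup>2))" by simp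
  moreover have "norm (geo_char m \<theta> - 1) \<le> 2"
    using norm_triangle_ineq4[of "geo_char m \<theta>" 1] norm_geo_char_le_1[OF m, of \<theta>] by simp
  ultimately show ?thesis by linarith
qed

lemma norm_infinite_prod_diff_le:
  fixes f g :: "nat \<Rightarrow> complex"
  assumes f: "\<And>j. norm (f j) \<le> 1" and g: "\<And>j. norm (g j) \<le> 1"
    and d: "\<And>j. norm (f j - g j) \<le> d j" "summable d"
    and F: "(\<lambda>J. \<Prod>j<J. f j) \<longlonglongrightarrow> F" and G: "(\<lambda>J. \<Prod>j<J. g j) \<longlonglongrightarrow> G"
  shows "norm (F - G) \<le> suminf d"
proof (rule LIMSEQ_le_const2)
  show "(\<lambda>J. norm ((\<Prod>j<J. f j) - (\<Prod>j<J. g j))) \<longlonglongrightarrow> norm (F - G)"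
    by (intro tendsto_intros F G)
  have "norm ((\<Prod>j<J. f j) - (\<Prod>j<J. g j)) \<le> suminf d" for J
  proof -
    have "norm ((\<Prod>j<J. f j) - (\<Prod>j<J. g j)) \<le> (\<Sum>j<J. norm (f j - g j))"
      by (rule norm_prod_diff) (use f g in auto)
    also have "\<dots> \<le> (\<Sum>j<J. d j)" by (intro sum_mono d)
    also have "\<dots> \<le> suminf d"
      using d norm_ge_zero order_trans by (intro sum_le_suminf) blast+
    finally show ?thesis .
  qed
  then show "\<exists>N. \<forall>n\<ge>N. norm ((\<Prod>j<n. f j) - (\<Prod>j<n. g j)) \<le> suminf d" by blast
qed

text \<open>Lindeberg's replacement argument: exchanging every factor for the Gaussian one with the same
  variance costs at most a constant times \<open>\<bar>\<theta>\<bar> (1 + m\<^sub>0) \<theta>\<^sup>2 \<Sum>j. (m\<^sub>j + m\<^sub>j\<^sup>2)\<close> with \<open>\<theta> = s / a\<close>. This tends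
  to 0 if no single level contributes on the scale \<open>a\<close>.\<close>

lemma geo_char_prod_tendsto_gaussian:
  fixes m :: "nat \<Rightarrow> nat \<Rightarrow> real" and a :: "nat \<Rightarrow> real"
  assumes m0: "\<And>n j. 0 \<le> m n j" and mono: "\<And>n j. m n j \<le> m n 0"
    and summ: "\<And>n. summable (\<lambda>j. m n j + (m n j)\<^sup>2)"
    and a: "filterlim a at_top sequentially"
    and var: "(\<lambda>n. (\<Sum>j. m n j + (m n j)\<^sup>2) / (a n)\<^sup>2) \<longlonglongrightarrow> v"
    and small: "(\<lambda>n. m n 0 / a n) \<longlonglongrightarrow> 0"
    and \<Phi>: "\<And>n. (\<lambda>J. \<Prod>j<J. geo_char (m n j) (s / a n)) \<longlonglongrightarrow> \<Phi> n"
  shows "\<Phi> \<longlonglongrightarrow> of_real (exp (- (s\<^sup>2 * v / 2)))"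
proof -
  define V where "V n = (\<Sum>j. m n j + (m n j)\<^sup>2)" for n
  define \<theta> where "\<theta> n = s / a n" for n
  have \<theta>0: "\<theta> \<longlonglongrightarrow> 0"
    unfolding \<theta>_def by (rule tendsto_divide_0[OF tendsto_const filterlim_at_top_imp_at_infinity[OF a]])
  have \<theta>abs: "(\<lambda>n. \<bar>\<theta> n\<bar>) \<longlonglongrightarrow> 0" using \<theta>0 by (rule tendsto_rabs_zero)
  have m\<theta>: "(\<lambda>n. m n 0 * \<bar>\<theta> n\<bar>) \<longlonglongrightarrow> 0"
  proof -
    have "(\<lambda>n. \<bar>s * (m n 0 / a n)\<bar>) \<longlonglongrightarrow> \<bar>s * 0\<bar>" by (intro tendsto_intros small)
    then show ?thesis using m0 by (simp add: \<theta>_def abs_mult mult.commute)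
  qed
  have \<theta>V: "(\<lambda>n. (\<theta> n)\<^sup>2 * V n) \<longlonglongrightarrow> s\<^sup>2 * v"
    using tendsto_mult_left[OF var, of "s\<^sup>2"] by (simp add: \<theta>_def V_def power_divide)
  have ev: "\<forall>\<^sub>F n in sequentially. norm (\<Phi> n - of_real (exp (- ((\<theta> n)\<^sup>2 * V n / 2))))
      \<le> 6 * (\<bar>\<theta> n\<bar> + m n 0 * \<bar>\<theta> n\<bar>) * ((\<theta> n)\<^sup>2 * V n)"
  proof -
    have "\<forall>\<^sub>F n in sequentially. \<bar>\<theta> n\<bar> < 1" using \<theta>abs by (rule order_tendstoD) simp
    moreover have "\<forall>\<^sub>F n in sequentially. m n 0 * \<bar>\<theta> n\<bar> < 1/4" using m\<theta> by (rule order_tendstoD) simp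
    ultimately show ?thesis
    proof eventually_elim
      case (elim n)
      let ?v = "\<lambda>j. m n j + (m n j)\<^sup>2"
      let ?K = "6 * (\<bar>\<theta> n\<bar> + m n 0 * \<bar>\<theta> n\<bar>) * (\<theta> n)\<^sup>2"
      have "norm (\<Phi> n - of_real (exp (- ((\<theta> n)\<^sup>2 * V n / 2)))) \<le> (\<Sum>j. ?K * ?v j)"
      proof (rule norm_infinite_prod_diff_le)
        show "norm (geo_char (m n j) (\<theta> n)) \<le> 1" for j by (rule norm_geo_char_le_1[OF m0])
        show "norm (complex_of_real (exp (- ((\<theta> n)\<^sup>2 * ?v j / 2)))) \<le> 1" for j using m0[of n j] by simp
        show "norm (geo_char (m n j) (\<theta> n) - of_real (exp (- ((\<theta> n)\<^sup>2 * ?v j / 2)))) \<le> ?K * ?v j" for j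
        proof -
          have le: "m n j * \<bar>\<theta> n\<bar> \<le> m n 0 * \<bar>\<theta> n\<bar>" using mono[of n j] by (intro mult_right_mono) auto
          have "norm (geo_char (m n j) (\<theta> n) - of_real (exp (- ((\<theta> n)\<^sup>2 * ?v j / 2)))) \<le> 6 * \<bar>\<theta> n\<bar> ^ 3 * (?v j * (1 + m n j))"
            using elim le by (intro geo_char_gaussian_approximation m0) auto
          also have "\<dots> = 6 * (\<bar>\<theta> n\<bar> + m n j * \<bar>\<theta> n\<bar>) * (\<theta> n)\<^sup>2 * ?v j"
            by (simp add: power2_eq_square power3_eq_cube algebra_simps flip: abs_mult)
          also have "\<dots> \<le> ?K * ?v j" using le m0[of n j] by (intro mult_right_mono[of _ _ "?v j"] mult_right_mono[of _ _ "(\<theta> n)\<^sup>2"]) auto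
          finally show ?thesis .
        qed
        show "summable (\<lambda>j. ?K * ?v j)" using summ by (rule summable_mult)
        show "(\<lambda>J. \<Prod>j<J. geo_char (m n j) (\<theta> n)) \<longlonglongrightarrow> \<Phi> n" using \<Phi> by (simp add: \<theta>_def)
        have "(\<lambda>J. exp (- ((\<theta> n)\<^sup>2 * (\<Sum>j<J. ?v j) / 2))) \<longlonglongrightarrow> exp (- ((\<theta> n)\<^sup>2 * V n / 2))"
          unfolding V_def by (intro tendsto_intros summable_LIMSEQ summ) auto
        from tendsto_of_real[OF this, where 'a=complex]
        show "(\<lambda>J. \<Prod>j<J. complex_of_real (exp (- ((\<theta> n)\<^sup>2 * ?v j / 2)))) \<longlonglongrightarrow> of_real (exp (- ((\<theta> n)\<^sup>2 * V n / 2)))"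
          by (simp add: exp_sum[symmetric] sum_negf sum_distrib_left sum_divide_distrib flip: of_real_prod)
      qed
      also have "\<dots> = ?K * V n" unfolding V_def by (rule suminf_mult[OF summ])
      finally show ?case by (simp add: mult_ac)
    qed
  qed
  have "(\<lambda>n. 6 * (\<bar>\<theta> n\<bar> + m n 0 * \<bar>\<theta> n\<bar>) * ((\<theta> n)\<^sup>2 * V n)) \<longlonglongrightarrow> 6 * (0 + 0) * (s\<^sup>2 * v)"
    by (intro tendsto_intros \<theta>V \<theta>abs m\<theta>)
  then have "(\<lambda>n. \<Phi> n - of_real (exp (- ((\<theta> n)\<^sup>2 * V n / 2)))) \<longlonglongrightarrow> 0"
    by (intro Lim_null_comparison[OF ev]) simp
  moreover have "(\<lambda>n. complex_of_real (exp (- ((\<theta> n)\<^sup>2 * V n / 2)))) \<longlonglongrightarrow> of_real (exp (- (s\<^sup>2 * v / 2)))"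
    by (intro tendsto_intros \<theta>V) auto
  ultimately show ?thesis using tendsto_add by fastforce
qed

text \<open>A geometric variable with large mean, divided by a multiple of its mean, is nearly exponential;
  the limit is the characteristic function of \<open>c (X - 1)\<close> at \<open>s\<close>, where \<open>X\<close> is exponential with mean 1.\<close>

lemma geo_char_tendsto:
  assumes a: "filterlim a at_top sequentially" and m: "(\<lambda>n. m n / a n) \<longlonglongrightarrow> c"
  shows "(\<lambda>n. geo_char (m n) (s / a n)) \<longlonglongrightarrow> exp (- (\<i> * of_real (s * c))) / (1 - \<i> * of_real (s * c))"
proof -
  define \<theta> where "\<theta> n = s / a n" for n
  have \<theta>0: "\<theta> \<longlonglongrightarrow> 0"
    unfolding \<theta>_def by (rule tendsto_divide_0[OF tendsto_const filterlim_at_top_imp_at_infinity[OF a]])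
  have m\<theta>: "(\<lambda>n. \<theta> n * m n) \<longlonglongrightarrow> s * c"
    using tendsto_mult_left[OF m, of s] by (simp add: \<theta>_def)
  define r where "r n = of_real (m n) * (exp (\<i> * complex_of_real (\<theta> n)) - 1 - \<i> * of_real (\<theta> n))" for n
  have r_le: "norm (r n) \<le> \<bar>\<theta> n * m n\<bar> * \<bar>\<theta> n\<bar>" for n
  proof -
    have "norm (exp (\<i> * complex_of_real (\<theta> n)) - 1 - \<i> * of_real (\<theta> n)) \<le> \<bar>\<theta> n\<bar>\<^sup>2 / 2"
      using iexp_approx1[of "\<theta> n" 1] by (simp add: algebra_simps numeral_2_eq_2)
    then have "norm (r n) \<le> \<bar>m n\<bar> * (\<bar>\<theta> n\<bar>\<^sup>2 / 2)" unfolding r_def norm_mult norm_of_real by (rule mult_left_mono) simp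
    also have "\<dots> \<le> \<bar>m n\<bar> * \<bar>\<theta> n\<bar>\<^sup>2" by (intro mult_left_mono) auto
    finally show ?thesis by (simp add: abs_mult power2_eq_square mult_ac)
  qed
  have "(\<lambda>n. \<bar>\<theta> n * m n\<bar> * \<bar>\<theta> n\<bar>) \<longlonglongrightarrow> \<bar>s * c\<bar> * \<bar>0\<bar>" by (intro tendsto_mult tendsto_rabs m\<theta> \<theta>0)
  then have "(\<lambda>n. \<bar>\<theta> n * m n\<bar> * \<bar>\<theta> n\<bar>) \<longlonglongrightarrow> 0" by simp
  then have r0: "r \<longlonglongrightarrow> 0"
    by (rule Lim_null_comparison[OF always_eventually[OF allI[OF r_le]]])
  have nz: "1 - (\<i> * complex_of_real (s * c) + 0) \<noteq> 0" by (simp add: complex_eq_iff)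
  have "(\<lambda>n. exp (- (\<i> * of_real (\<theta> n * m n))) / (1 - (\<i> * of_real (\<theta> n * m n) + r n)))
      \<longlonglongrightarrow> exp (- (\<i> * of_real (s * c))) / (1 - (\<i> * of_real (s * c) + 0))"
    by (intro tendsto_intros m\<theta> r0 nz)
  moreover have "geo_char (m n) (\<theta> n) = exp (- (\<i> * of_real (\<theta> n * m n))) / (1 - (\<i> * of_real (\<theta> n * m n) + r n))" for n
    by (simp add: geo_char_def r_def algebra_simps)
  ultimately show ?thesis by (simp add: \<theta>_def)
qed

text \<open>Up to a small error, finitely many levels determine the limit. Each factor converges, and it differs from 1 by at
  most a multiple of its variance on the scale \<open>a\<close>; the summable bound \<open>B\<close> on these variances allows
  passing to the limit under the infinite product.\<close>

lemma geo_char_prod_tendsto_exponential: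
  fixes m :: "nat \<Rightarrow> nat \<Rightarrow> real" and a :: "nat \<Rightarrow> real"
  assumes m0: "\<And>n j. 0 \<le> m n j"
    and a: "filterlim a at_top sequentially"
    and dom: "\<forall>\<^sub>F n in sequentially. \<forall>j. (m n j + (m n j)\<^sup>2) / (a n)\<^sup>2 \<le> B j" and B: "summable B"
    and lim: "\<And>j. (\<lambda>n. m n j / a n) \<longlonglongrightarrow> c j"
    and \<Phi>: "\<And>n. (\<lambda>J. \<Prod>j<J. geo_char (m n j) (s / a n)) \<longlonglongrightarrow> \<Phi> n"
    and \<Psi>: "(\<lambda>J. \<Prod>j<J. exp (- (\<i> * of_real (s * c j))) / (1 - \<i> * of_real (s * c j))) \<longlonglongrightarrow> \<Psi>"
  shows "\<Phi> \<longlonglongrightarrow> \<Psi>"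
proof -
  define g where "g j = exp (- (\<i> * of_real (s * c j))) / (1 - \<i> * complex_of_real (s * c j))" for j
  have fg: "(\<lambda>n. geo_char (m n j) (s / a n)) \<longlonglongrightarrow> g j" for j
    unfolding g_def by (rule geo_char_tendsto[OF a lim])
  have \<theta>0: "(\<lambda>n. \<bar>s / a n\<bar>) \<longlonglongrightarrow> 0"
    by (rule tendsto_rabs_zero) (rule tendsto_divide_0[OF tendsto_const filterlim_at_top_imp_at_infinity[OF a]])
  have "\<forall>\<^sub>F n in sequentially. \<bar>s / a n\<bar> < 1" using \<theta>0 by (rule order_tendstoD) simp
  with dom have bd: "\<forall>\<^sub>F n in sequentially. \<forall>j. norm (geo_char (m n j) (s / a n) - 1) \<le> 32 * s\<^sup>2 * B j"
  proof eventually_elim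
    case (elim n)
    show ?case
    proof
      fix j
      have "norm (geo_char (m n j) (s / a n) - 1) \<le> 32 * ((s / a n)\<^sup>2 * (m n j + (m n j)\<^sup>2))"
        using elim by (intro norm_geo_char_minus_1_le m0) auto
      also have "\<dots> = 32 * s\<^sup>2 * ((m n j + (m n j)\<^sup>2) / (a n)\<^sup>2)" by (simp add: power_divide)
      also have "\<dots> \<le> 32 * s\<^sup>2 * B j" using elim by (intro mult_left_mono) auto
      finally show "norm (geo_char (m n j) (s / a n) - 1) \<le> 32 * s\<^sup>2 * B j" .
    qed
  qed
  have g_bd: "norm (g j - 1) \<le> 32 * s\<^sup>2 * B j" for j
  proof (rule tendsto_upperbound)
    show "(\<lambda>n. norm (geo_char (m n j) (s / a n) - 1)) \<longlonglongrightarrow> norm (g j - 1)" by (intro tendsto_intros fg)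
    show "\<forall>\<^sub>F n in sequentially. norm (geo_char (m n j) (s / a n) - 1) \<le> 32 * s\<^sup>2 * B j"
      using bd by eventually_elim blast
  qed simp
  have g1: "norm (g j) \<le> 1" for j
  proof (rule tendsto_upperbound)
    show "(\<lambda>n. norm (geo_char (m n j) (s / a n))) \<longlonglongrightarrow> norm (g j)" by (intro tendsto_intros fg)
  qed (auto simp: norm_geo_char_le_1 m0)
  define b where "b n j = norm (geo_char (m n j) (s / a n) - g j)" for n j
  have b_bd: "\<forall>\<^sub>F n in sequentially. \<forall>j. b n j \<le> 64 * s\<^sup>2 * B j"
    using bd
  proof eventually_elim
    case (elim n)
    show ?case
    proof
      fix j
      have "b n j \<le> norm (geo_char (m n j) (s / a n) - 1) + norm (g j - 1)"
        unfolding b_def using norm_triangle_ineq4[of "geo_char (m n j) (s / a n) - 1" "g j - 1"] by simp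
      then show "b n j \<le> 64 * s\<^sup>2 * B j" using elim[rule_format, of j] g_bd[of j] by linarith
    qed
  qed
  have sB: "summable (\<lambda>j. 64 * s\<^sup>2 * B j)" using B by (rule summable_mult)
  have "(\<lambda>n. \<Sum>j. b n j) \<longlonglongrightarrow> (\<Sum>j. 0)"
  proof (rule tannerys_theorem[THEN conjunct2, THEN conjunct2])
    show "(\<lambda>n. b n j) \<longlonglongrightarrow> 0" for j
      unfolding b_def using fg[of j] by (intro tendsto_norm_zero) (simp add: LIM_zero)
    show "\<forall>\<^sub>F (j, n) in at_top \<times>\<^sub>F sequentially. norm (b n j) \<le> 64 * s\<^sup>2 * B j"
      by (rule eventually_mono[OF eventually_prodI[OF eventually_True b_bd]]) (auto simp: b_def)
  qed (use sB in auto)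
  then have "(\<lambda>n. \<Sum>j. b n j) \<longlonglongrightarrow> 0" by simp
  moreover have "\<forall>\<^sub>F n in sequentially. norm (\<Phi> n - \<Psi>) \<le> (\<Sum>j. b n j)"
    using b_bd
  proof eventually_elim
    case (elim n)
    show ?case
    proof (rule norm_infinite_prod_diff_le)
      show "norm (geo_char (m n j) (s / a n) - g j) \<le> b n j" for j by (simp add: b_def)
      show "summable (b n)"
        by (rule summable_comparison_test[OF _ sB]) (use elim in \<open>auto simp: b_def\<close>)
      show "(\<lambda>J. \<Prod>j<J. g j) \<longlonglongrightarrow> \<Psi>" using \<Psi> by (simp add: g_def)
    qed (use g1 norm_geo_char_le_1[OF m0] \<Phi> in auto)
  qed
  ultimately have "(\<lambda>n. \<Phi> n - \<Psi>) \<longlonglongrightarrow> 0" by (rule Lim_null_comparison[rotated])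
  then show ?thesis by (simp add: LIM_zero_iff)
qed

section \<open>The grand canonical number of excited particles\<close>

lemma exp_minus_1_le_quadratic:
  fixes x :: real
  assumes "\<bar>x\<bar> \<le> 1"
  shows "exp x - 1 - x \<le> x\<^sup>2"
proof (cases "0 \<le> x")
  case True
  then show ?thesis using exp_bound[of x] assms by simp
next
  case False
  define y where "y = - x"
  have y: "0 \<le> y" "y \<le> 1" using False assms by (auto simp: y_def)
  have "(1 - y + y\<^sup>2) * (1 + y + y\<^sup>2 / 2) - 1 = y\<^sup>2 / 2 + y ^ 3 / 2 + y ^ 4 / 2"
    by (simp add: power2_eq_square power3_eq_cube power4_eq_xxxx field_simps)
  moreover have "\<dots> \<ge> 0" using y by simp
  ultimately have "1 \<le> (1 - y + y\<^sup>2) * (1 + y + y\<^sup>2 / 2)" by linarith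
  also have "\<dots> \<le> (1 - y + y\<^sup>2) * exp y"
    using exp_lower_Taylor_quadratic[OF y(1)] y by (intro mult_left_mono) auto
  finally have "exp (- y) \<le> 1 - y + y\<^sup>2" by (simp add: exp_minus divide_simps)
  then show ?thesis by (simp add: y_def)
qed

lemma one_minus_inverse_le:
  fixes y :: real
  assumes "\<bar>y\<bar> \<le> 1/2"
  shows "1 / (1 - y) \<le> exp (y + 2 * y\<^sup>2)"
proof -
  have "\<bar>ln (1 + - y) - - y\<bar> \<le> 2 * (- y)\<^sup>2" using assms by (intro abs_ln_one_plus_x_minus_x_bound) simp
  then have "- ln (1 - y) \<le> y + 2 * y\<^sup>2" by (simp add: abs_le_iff)
  then have "exp (- ln (1 - y)) \<le> exp (y + 2 * y\<^sup>2)" by simp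
  then show ?thesis using assms by (simp add: exp_minus inverse_eq_divide)
qed

text \<open>The numbers \<open>q\<^sub>j\<close> are the factors \<open>exp (- \<beta> (E\<^sub>j\<^sub>+\<^sub>1 - E\<^sub>0))\<close>. Under the grand canonical measure, with the
  chemical potential at the ground state energy, the occupation numbers of the excited levels are
  independent geometric variables with these parameters. Only the law of their sum is constructed
  here; it gives \<open>k\<close> a mass proportional to the partition function \<open>shell k\<close>.\<close>

locale boltzmann_factors =
  fixes q :: "nat \<Rightarrow> real"
  assumes q_pos: "\<And>j. 0 < q j" and q_le: "\<And>j. q j \<le> q 0" and q_lt_1: "q 0 < 1" and q_summable: "summable q"
begin

text \<open>The canonical partition function of \<open>m\<close> particles on the excited levels.\<close>

definition shell :: "nat \<Rightarrow> real" where
  "shell m = infsum (occupation_monomial q) (configs m)"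

text \<open>The grand canonical partition function of the excited levels.\<close>

definition Z :: real where
  "Z = infsum (occupation_monomial q) finite_occupations"

text \<open>The mean of a geometric variable with parameter \<open>q\<^sub>j\<close>.\<close>

definition mean_occ :: "nat \<Rightarrow> real" where "mean_occ j = q j / (1 - q j)"

lemma monomial_pos: "0 < occupation_monomial q d"
  unfolding occupation_monomial_def by (rule prod_pos) (simp add: q_pos)

lemma q_less_1: "q j < 1" using q_le[of j] q_lt_1 by simp

lemma mean_occ_pos: "0 < mean_occ j" using q_pos[of j] q_less_1[of j] by (simp add: mean_occ_def)

lemma mean_occ_le: "mean_occ j \<le> mean_occ 0"
  unfolding mean_occ_def using q_pos[of j] q_less_1 q_le[of j] q_lt_1 by (intro frac_le) (auto intro: less_imp_le)

lemma mean_occ_summable: "summable mean_occ"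
proof -
  have "mean_occ j \<le> q j / (1 - q 0)" for j
    unfolding mean_occ_def using q_pos[of j] q_less_1 q_le[of j] q_lt_1 by (intro divide_left_mono) (auto intro: less_imp_le)
  then have "norm (mean_occ j) \<le> q j / (1 - q 0)" for j using mean_occ_pos[of j] by simp
  then show ?thesis using summable_divide[OF q_summable] summable_comparison_test'[where N=0] by blast
qed

lemma monomial_summable: "occupation_monomial q summable_on finite_occupations"
  using abs_summable_occupation_monomial[of "q 0" q] q_lt_1 q_le q_pos q_summable
  by (simp add: abs_of_pos monomial_pos less_imp_le)

lemma shell_has_sum: "(occupation_monomial q has_sum shell k) (configs k)"
  unfolding shell_def
  by (rule has_sum_infsum[OF summable_on_subset_banach[OF monomial_summable]]) (auto simp: finite_occupations_eq)

lemma shell_pos: "0 < shell k"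
proof -
  obtain d where d: "d \<in> configs k" using configs_nonempty by blast
  have "0 < occupation_monomial q d" by (rule monomial_pos)
  also have "\<dots> = sum (occupation_monomial q) {d}" by simp
  also have "\<dots> \<le> shell k"
    unfolding shell_def
    by (rule finite_sum_le_infsum[OF has_sum_imp_summable[OF shell_has_sum]])
       (use d monomial_pos in \<open>auto intro: less_imp_le\<close>)
  finally show ?thesis .
qed

lemma shell_generating_function:
  fixes z :: "'a::{real_normed_field, banach}"
  assumes "norm z * q 0 < 1"
  defines "G \<equiv> infsum (occupation_monomial (\<lambda>j. z * of_real (q j))) finite_occupations"
  shows "((\<lambda>k. z ^ k * of_real (shell k)) has_sum G) UNIV"
    and "(\<lambda>J. \<Prod>j<J. 1 / (1 - z * of_real (q j))) \<longlonglongrightarrow> G"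
proof -
  let ?y = "\<lambda>j. z * of_real (q j) :: 'a"
  have y: "norm (?y j) \<le> norm z * q 0" for j
    using q_pos[of j] q_le[of j] by (simp add: norm_mult abs_of_pos mult_left_mono)
  have s: "summable (\<lambda>j. norm (?y j))"
    using summable_mult[OF q_summable, of "norm z"] q_pos by (simp add: norm_mult abs_of_pos)
  show "(\<lambda>J. \<Prod>j<J. 1 / (1 - z * of_real (q j))) \<longlonglongrightarrow> G"
    unfolding G_def by (rule occupation_generating_function[OF assms(1) y s])
  have "(occupation_monomial ?y has_sum G) finite_occupations"
    unfolding G_def by (rule has_sum_infsum[OF abs_summable_summable[OF abs_summable_occupation_monomial[OF assms(1) y s]]])
  then have "((\<lambda>p. occupation_monomial ?y (snd p)) has_sum G) (Sigma UNIV configs)"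
    by (subst has_sum_reindex_bij_betw[OF bij_snd_configs])
  then show "((\<lambda>k. z ^ k * of_real (shell k)) has_sum G) UNIV"
  proof (rule has_sum_SigmaD)
    fix k
    have "((\<lambda>d. z ^ k * of_real (occupation_monomial q d)) has_sum z ^ k * of_real (shell k)) (configs k)"
      by (intro has_sum_cmult_right) (simp add: has_sum_of_real_iff shell_has_sum)
    then show "((\<lambda>d. occupation_monomial ?y (snd (k, d))) has_sum z ^ k * of_real (shell k)) (configs k)"
      by (rule has_sum_cong[THEN iffD1, rotated]) (simp add: occupation_monomial_scale)
  qed
qed

lemma Z_sums: "(shell has_sum Z) UNIV"
  using shell_generating_function(1)[of "1::real"] q_lt_1 by (simp add: Z_def)

lemma Z_pos: "0 < Z"
proof -
  have "0 < shell 0" by (rule shell_pos)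
  also have "shell 0 = sum shell {0}" by simp
  also have "\<dots> \<le> infsum shell UNIV"
    by (rule finite_sum_le_infsum[OF has_sum_imp_summable[OF Z_sums]]) (auto intro: less_imp_le shell_pos)
  also have "\<dots> = Z" using Z_sums by (rule infsumI)
  finally show ?thesis .
qed

definition excited :: "nat pmf" where "excited = embed_pmf (\<lambda>k. shell k / Z)"

lemma pmf_excited: "pmf excited k = shell k / Z"
  unfolding excited_def
proof (rule pmf_embed_pmf)
  show "0 \<le> shell k / Z" for k using shell_pos[of k] Z_pos by simp
  have "shell sums Z" using Z_sums by (rule has_sum_imp_sums)
  then have "(\<lambda>k. shell k / Z) sums 1" using sums_divide[of shell Z Z] Z_pos by simp
  then show "(\<integral>\<^sup>+k. ennreal (shell k / Z) \<partial>count_space UNIV) = 1"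
    using shell_pos Z_pos by (simp add: nn_integral_count_space_nat suminf_ennreal2 less_imp_le sums_iff)
qed

text \<open>Divide the generating function by its value at 1 and use
  \<open>(1 - q) / (1 - z q) = 1 / (1 - m (z - 1))\<close> for \<open>m = q / (1 - q)\<close>.\<close>

lemma excited_generating_function:
  fixes z :: "'a::{real_normed_field, banach, second_countable_topology}"
  assumes z: "norm z * q 0 < 1"
  shows "integrable excited (\<lambda>k. z ^ k)"
    and "(\<lambda>J. \<Prod>j<J. 1 / (1 - of_real (mean_occ j) * (z - 1))) \<longlonglongrightarrow> (\<integral>k. z ^ k \<partial>excited)"
proof -
  have excited: "measure_pmf excited = density (count_space UNIV) (\<lambda>k. ennreal (shell k / Z))"
    by (simp add: measure_pmf_eq_density pmf_excited)
  have nn: "0 \<le> shell k / Z" for k using shell_pos[of k] Z_pos by simp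
  have "((\<lambda>k. norm z ^ k * shell k) has_sum infsum (occupation_monomial (\<lambda>j. norm z * q j)) finite_occupations) UNIV"
    using shell_generating_function(1)[of "norm z"] z by simp
  then have "summable (\<lambda>k. norm z ^ k * shell k)" by (meson has_sum_imp_sums sums_summable)
  from summable_divide[OF this, of Z] have s: "summable (\<lambda>k. norm ((shell k / Z) *\<^sub>R z ^ k))"
    using Z_pos by (simp add: norm_power mult_ac abs_of_pos shell_pos)
  then have ic: "integrable (count_space UNIV) (\<lambda>k. (shell k / Z) *\<^sub>R z ^ k)"
    by (simp only: integrable_count_space_nat_iff)
  then show "integrable excited (\<lambda>k. z ^ k)"
    unfolding excited by (subst integrable_density) (use nn in auto)
  let ?G = "\<lambda>z. infsum (occupation_monomial (\<lambda>j. z * of_real (q j))) finite_occupations"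
  have "(\<integral>k. z ^ k \<partial>excited) = (\<Sum>k. (shell k / Z) *\<^sub>R z ^ k)"
    unfolding excited by (subst integral_density) (use nn ic in \<open>auto simp: integral_count_space_nat\<close>)
  also have "(\<lambda>k. (shell k / Z) *\<^sub>R z ^ k) sums (?G z / of_real Z)"
    using sums_divide[OF has_sum_imp_sums[OF shell_generating_function(1)[OF z]], of "of_real Z"]
    by (simp add: scaleR_conv_of_real mult_ac)
  then have "(\<Sum>k. (shell k / Z) *\<^sub>R z ^ k) = ?G z / of_real Z" by (rule sums_unique[symmetric])
  finally have eq: "(\<integral>k. z ^ k \<partial>excited) = ?G z / of_real Z" .
  have "?G (1::'a) = of_real Z"
  proof -
    have "((\<lambda>k. of_real (shell k) :: 'a) has_sum of_real Z) UNIV"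
      using Z_sums by (simp only: has_sum_of_real_iff)
    moreover have "((\<lambda>k. of_real (shell k) :: 'a) has_sum ?G 1) UNIV"
      using shell_generating_function(1)[of "1::'a"] q_lt_1 by simp
    ultimately show ?thesis by (rule has_sum_unique[rotated])
  qed
  with shell_generating_function(2)[of "1::'a"] q_lt_1
  have "(\<lambda>J. \<Prod>j<J. 1 / (1 - of_real (q j))) \<longlonglongrightarrow> (of_real Z :: 'a)" by simp
  from tendsto_divide[OF shell_generating_function(2)[OF z] this]
  have "(\<lambda>J. (\<Prod>j<J. 1 / (1 - z * of_real (q j))) / (\<Prod>j<J. 1 / (1 - of_real (q j)))) \<longlonglongrightarrow> ?G z / of_real Z"
    using Z_pos by simp
  moreover have "(\<Prod>j<J. 1 / (1 - z * of_real (q j))) / (\<Prod>j<J. 1 / (1 - of_real (q j))) = (\<Prod>j<J. 1 / (1 - of_real (mean_occ j) * (z - 1)))" for J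
    unfolding prod_dividef[symmetric]
  proof (rule prod.cong[OF refl])
    fix j
    have 1: "(1 - of_real (q j) :: 'a) = of_real (1 - q j)" by simp
    have nz: "(of_real (1 - q j) :: 'a) \<noteq> 0" using q_less_1[of j] by (simp only: of_real_eq_0_iff)
    have "1 - of_real (mean_occ j) * (z - 1) = (1 - z * of_real (q j)) / of_real (1 - q j)"
      unfolding mean_occ_def of_real_divide using nz by (simp add: field_simps)
    then show "1 / (1 - z * of_real (q j)) / (1 / (1 - of_real (q j))) = 1 / (1 - of_real (mean_occ j) * (z - 1))"
      unfolding 1 by simp
  qed
  ultimately show "(\<lambda>J. \<Prod>j<J. 1 / (1 - of_real (mean_occ j) * (z - 1))) \<longlonglongrightarrow> (\<integral>k. z ^ k \<partial>excited)"
    by (simp add: eq)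
qed

text \<open>\<open>mu\<close> and \<open>V\<close> are the mean and the variance of a sum of independent geometric variables with
  parameters \<open>q\<^sub>j\<close>.\<close>

definition mu :: real where "mu = (\<Sum>j. mean_occ j)"

definition V :: real where "V = (\<Sum>j. mean_occ j + (mean_occ j)\<^sup>2)"

lemma V_summable: "summable (\<lambda>j. mean_occ j + (mean_occ j)\<^sup>2)"
proof (rule summable_add[OF mean_occ_summable])
  show "summable (\<lambda>j. (mean_occ j)\<^sup>2)"
  proof (rule summable_comparison_test'[where N=0])
    show "summable (\<lambda>j. mean_occ 0 * mean_occ j)" by (rule summable_mult[OF mean_occ_summable])
    show "norm ((mean_occ j)\<^sup>2) \<le> mean_occ 0 * mean_occ j" for j
      using mean_occ_pos[of j] mean_occ_le[of j] by (simp add: power2_eq_square mult_right_mono)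
  qed
qed

lemma centred_char_excited:
  "(\<lambda>J. \<Prod>j<J. geo_char (mean_occ j) \<theta>) \<longlonglongrightarrow> (\<integral>k. iexp (\<theta> * (real k - mu)) \<partial>excited)"
proof -
  let ?z = "iexp \<theta>"
  have z: "norm ?z * q 0 < 1" using q_lt_1 by simp
  have "(\<lambda>J. exp (- (\<i> * of_real (\<theta> * (\<Sum>j<J. mean_occ j))))) \<longlonglongrightarrow> exp (- (\<i> * complex_of_real (\<theta> * mu)))"
    unfolding mu_def by (intro tendsto_intros summable_LIMSEQ mean_occ_summable)
  from tendsto_mult[OF this excited_generating_function(2)[OF z]]
  have "(\<lambda>J. exp (- (\<i> * of_real (\<theta> * (\<Sum>j<J. mean_occ j)))) * (\<Prod>j<J. 1 / (1 - of_real (mean_occ j) * (?z - 1))))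
      \<longlonglongrightarrow> exp (- (\<i> * complex_of_real (\<theta> * mu))) * (\<integral>k. ?z ^ k \<partial>excited)" .
  moreover have "exp (- (\<i> * of_real (\<theta> * (\<Sum>j<J. mean_occ j)))) * (\<Prod>j<J. 1 / (1 - of_real (mean_occ j) * (?z - 1))) = (\<Prod>j<J. geo_char (mean_occ j) \<theta>)" for J
  proof -
    have "exp (- (\<i> * of_real (\<theta> * (\<Sum>j<J. mean_occ j)))) = (\<Prod>j<J. exp (- (\<i> * complex_of_real (\<theta> * mean_occ j))))"
      by (simp add: exp_sum[symmetric] sum_negf sum_distrib_left)
    then show ?thesis by (simp add: geo_char_def prod.distrib[symmetric])
  qed
  moreover have "exp (- (\<i> * complex_of_real (\<theta> * mu))) * (\<integral>k. ?z ^ k \<partial>excited) = (\<integral>k. iexp (\<theta> * (real k - mu)) \<partial>excited)"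
  proof -
    have "exp (- (\<i> * complex_of_real (\<theta> * mu))) * ?z ^ k = iexp (\<theta> * (real k - mu))" for k
      by (simp add: exp_of_nat_mult[symmetric] exp_add[symmetric] algebra_simps)
    then show ?thesis using integral_mult_right_zero[of excited "exp (- (\<i> * complex_of_real (\<theta> * mu)))" "\<lambda>k. ?z ^ k"] by simp
  qed
  ultimately show ?thesis by simp
qed

text \<open>With \<open>x = m\<^sub>j (exp \<theta> - 1)\<close> the factors of the generating function satisfy
  \<open>- ln (1 - x) \<le> x + 2 x\<^sup>2\<close>. The terms linear in \<open>\<theta>\<close> cancel against the centring, and the remainder is at most a
  multiple of \<open>\<theta>\<^sup>2 (m\<^sub>j + m\<^sub>j\<^sup>2)\<close>.\<close>

lemma exponential_moment:
  assumes \<theta>: "\<bar>\<theta>\<bar> \<le> 1" "mean_occ 0 * \<bar>\<theta>\<bar> \<le> 1/4"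
  shows "integrable excited (\<lambda>k. exp (\<theta> * (real k - mu)))"
    and "(\<integral>k. exp (\<theta> * (real k - mu)) \<partial>excited) \<le> exp (9 * \<theta>\<^sup>2 * V)"
proof -
  define w where "w = exp \<theta> - 1"
  have w1: "w - \<theta> \<le> \<theta>\<^sup>2"
    using exp_minus_1_le_quadratic[OF \<theta>(1)] by (simp add: w_def)
  have w2: "\<bar>w\<bar> \<le> 2 * \<bar>\<theta>\<bar>"
  proof -
    have "\<theta>\<^sup>2 \<le> \<bar>\<theta>\<bar>" using mult_left_mono[OF \<theta>(1), of "\<bar>\<theta>\<bar>"] by (simp add: power2_eq_square flip: abs_mult)
    moreover have "\<theta> \<le> w" using exp_ge_add_one_self[of \<theta>] unfolding w_def by linarith
    ultimately show ?thesis using w1 by linarith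
  qed
  have mw: "\<bar>mean_occ j * w\<bar> \<le> 1/2" for j
  proof -
    have "\<bar>mean_occ j * w\<bar> \<le> mean_occ 0 * (2 * \<bar>\<theta>\<bar>)" using mean_occ_pos[of j] mean_occ_le[of j] w2 by (simp add: abs_mult mult_mono)
    then show ?thesis using \<theta>(2) by simp
  qed
  have z: "norm (exp \<theta>) * q 0 < 1"
  proof -
    have "mean_occ 0 * w < 1" using mw[of 0] by (simp add: abs_le_iff)
    then show ?thesis using q_lt_1 by (simp add: mean_occ_def w_def divide_less_eq algebra_simps)
  qed
  have eq: "exp (\<theta> * (real k - mu)) = exp (- (\<theta> * mu)) * exp \<theta> ^ k" for k
    by (simp add: exp_of_nat_mult[symmetric] exp_add[symmetric] algebra_simps)
  show "integrable excited (\<lambda>k. exp (\<theta> * (real k - mu)))"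
    unfolding eq by (intro integrable_mult_right excited_generating_function(1)[OF z])
  have "(\<lambda>J. exp (- (\<theta> * (\<Sum>j<J. mean_occ j)))) \<longlonglongrightarrow> exp (- (\<theta> * mu))"
    unfolding mu_def by (intro tendsto_intros summable_LIMSEQ mean_occ_summable)
  from tendsto_mult[OF this excited_generating_function(2)[OF z]]
  have lim: "(\<lambda>J. exp (- (\<theta> * (\<Sum>j<J. mean_occ j))) * (\<Prod>j<J. 1 / (1 - mean_occ j * w))) \<longlonglongrightarrow> (\<integral>k. exp (\<theta> * (real k - mu)) \<partial>excited)"
    unfolding eq by (simp add: w_def)
  have "exp (- (\<theta> * (\<Sum>j<J. mean_occ j))) * (\<Prod>j<J. 1 / (1 - mean_occ j * w)) \<le> exp (9 * \<theta>\<^sup>2 * V)" for J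
  proof -
    have "(\<Prod>j<J. 1 / (1 - mean_occ j * w)) \<le> (\<Prod>j<J. exp (\<theta> * mean_occ j + 9 * \<theta>\<^sup>2 * (mean_occ j + (mean_occ j)\<^sup>2)))"
    proof (intro prod_mono conjI)
      fix j
      show "0 \<le> 1 / (1 - mean_occ j * w)" using mw[of j] by (simp add: abs_le_iff)
      have "1 / (1 - mean_occ j * w) \<le> exp (mean_occ j * w + 2 * (mean_occ j * w)\<^sup>2)" by (rule one_minus_inverse_le[OF mw])
      also have "mean_occ j * w + 2 * (mean_occ j * w)\<^sup>2 \<le> \<theta> * mean_occ j + 9 * \<theta>\<^sup>2 * (mean_occ j + (mean_occ j)\<^sup>2)"
      proof -
        have "mean_occ j * w \<le> mean_occ j * (\<theta> + \<theta>\<^sup>2)" using w1 mean_occ_pos[of j] by (intro mult_left_mono) auto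
        then have 1: "mean_occ j * w \<le> \<theta> * mean_occ j + \<theta>\<^sup>2 * mean_occ j" by (simp add: algebra_simps)
        have "w\<^sup>2 \<le> (2 * \<bar>\<theta>\<bar>)\<^sup>2" using w2 by (metis abs_ge_zero power2_abs power_mono)
        then have "(mean_occ j)\<^sup>2 * w\<^sup>2 \<le> (mean_occ j)\<^sup>2 * (4 * \<theta>\<^sup>2)" by (simp add: power_mult_distrib mult_left_mono)
        then have 2: "(mean_occ j * w)\<^sup>2 \<le> 4 * (\<theta>\<^sup>2 * (mean_occ j)\<^sup>2)" by (simp add: power_mult_distrib mult_ac)
        have 3: "0 \<le> \<theta>\<^sup>2 * mean_occ j" "0 \<le> \<theta>\<^sup>2 * (mean_occ j)\<^sup>2" using mean_occ_pos[of j] by simp_all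
        have 4: "9 * \<theta>\<^sup>2 * (mean_occ j + (mean_occ j)\<^sup>2) = 9 * (\<theta>\<^sup>2 * mean_occ j) + 9 * (\<theta>\<^sup>2 * (mean_occ j)\<^sup>2)" by (simp add: algebra_simps)
        show ?thesis unfolding 4 using 1 2 3 by linarith
      qed
      finally show "1 / (1 - mean_occ j * w) \<le> exp (\<theta> * mean_occ j + 9 * \<theta>\<^sup>2 * (mean_occ j + (mean_occ j)\<^sup>2))" by simp
    qed
    also have "\<dots> = exp (\<theta> * (\<Sum>j<J. mean_occ j) + 9 * \<theta>\<^sup>2 * (\<Sum>j<J. mean_occ j + (mean_occ j)\<^sup>2))"
    proof -
      have "(\<Sum>j<J. \<theta> * mean_occ j + 9 * \<theta>\<^sup>2 * (mean_occ j + (mean_occ j)\<^sup>2)) = \<theta> * (\<Sum>j<J. mean_occ j) + 9 * \<theta>\<^sup>2 * (\<Sum>j<J. mean_occ j + (mean_occ j)\<^sup>2)"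
        by (subst sum.distrib) (simp only: sum_distrib_left)
      then show ?thesis by (simp only: exp_sum[symmetric] finite_lessThan)
    qed
    finally have "exp (- (\<theta> * (\<Sum>j<J. mean_occ j))) * (\<Prod>j<J. 1 / (1 - mean_occ j * w))
        \<le> exp (- (\<theta> * (\<Sum>j<J. mean_occ j))) * exp (\<theta> * (\<Sum>j<J. mean_occ j) + 9 * \<theta>\<^sup>2 * (\<Sum>j<J. mean_occ j + (mean_occ j)\<^sup>2))"
      by (intro mult_left_mono) auto
    also have "\<dots> = exp (9 * \<theta>\<^sup>2 * (\<Sum>j<J. mean_occ j + (mean_occ j)\<^sup>2))" by (simp add: exp_add[symmetric])
    also have "\<dots> \<le> exp (9 * \<theta>\<^sup>2 * V)"
    proof -
      have "0 \<le> mean_occ j + (mean_occ j)\<^sup>2" for j using mean_occ_pos[of j] by simp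
      then have "(\<Sum>j<J. mean_occ j + (mean_occ j)\<^sup>2) \<le> V" unfolding V_def by (intro sum_le_suminf V_summable) auto
      then show ?thesis unfolding exp_le_cancel_iff by (intro mult_left_mono) auto
    qed
    finally show ?thesis .
  qed
  then show "(\<integral>k. exp (\<theta> * (real k - mu)) \<partial>excited) \<le> exp (9 * \<theta>\<^sup>2 * V)"
    by (intro LIMSEQ_le_const2[OF lim]) auto
qed

text \<open>By \<open>exp x \<ge> 1 + x\<close> the exponential moment at \<open>\<theta>\<close> is at least \<open>1 + \<theta> m\<close>, where \<open>m\<close> is the mean of the
  centred variable; it is also at most \<open>1 + O(\<theta>\<^sup>2)\<close>. Dividing by \<open>\<theta>\<close> and letting \<open>\<theta>\<close> tend to 0 from either
  side gives \<open>m = 0\<close>.\<close>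

lemma mean_excited: "integrable excited (\<lambda>k. real k - mu)" "(\<integral>k. real k - mu \<partial>excited) = 0"
proof -
  \<comment> \<open>the range in which \<open>exponential_moment\<close> applies\<close>
  define \<theta>0 where "\<theta>0 = 1 / (4 * (1 + mean_occ 0))"
  have \<theta>0: "0 < \<theta>0" "\<theta>0 \<le> 1" "mean_occ 0 * \<theta>0 \<le> 1/4" using mean_occ_pos[of 0] by (auto simp: \<theta>0_def field_simps)
  have ok: "\<bar>\<theta>\<bar> \<le> 1 \<and> mean_occ 0 * \<bar>\<theta>\<bar> \<le> 1/4" if "\<bar>\<theta>\<bar> \<le> \<theta>0" for \<theta>
  proof -
    have "mean_occ 0 * \<bar>\<theta>\<bar> \<le> mean_occ 0 * \<theta>0" using that mean_occ_pos[of 0] by (intro mult_left_mono) auto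
    then show ?thesis using that \<theta>0 by linarith
  qed
  show int: "integrable excited (\<lambda>k. real k - mu)"
  proof (rule Bochner_Integration.integrable_bound)
    show "integrable excited (\<lambda>k. (exp (\<theta>0 * (real k - mu)) + exp (- \<theta>0 * (real k - mu))) / \<theta>0)"
      using ok[of \<theta>0] ok[of "- \<theta>0"] \<theta>0
      by (intro integrable_divide Bochner_Integration.integrable_add exponential_moment) auto
    have "\<bar>real k - mu\<bar> \<le> (exp (\<theta>0 * (real k - mu)) + exp (- \<theta>0 * (real k - mu))) / \<theta>0" for k
    proof -
      define x where "x = \<theta>0 * (real k - mu)"
      have "\<bar>x\<bar> \<le> exp x + exp (- x)"
        using exp_ge_add_one_self[of x] exp_ge_add_one_self[of "- x"] exp_gt_zero[of x] exp_gt_zero[of "- x"] by linarith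
      moreover have "\<bar>real k - mu\<bar> = \<bar>x\<bar> / \<theta>0" using \<theta>0 by (simp add: x_def abs_mult)
      ultimately show ?thesis using \<theta>0 by (simp add: x_def divide_right_mono)
    qed
    then show "AE k in excited. norm (real k - mu) \<le> norm ((exp (\<theta>0 * (real k - mu)) + exp (- \<theta>0 * (real k - mu))) / \<theta>0)"
      using \<theta>0 by simp
  qed simp
  define E where "E = (\<integral>k. real k - mu \<partial>excited)"
  have le: "\<theta> * E \<le> exp (9 * \<theta>\<^sup>2 * V) - 1" if "\<bar>\<theta>\<bar> \<le> \<theta>0" for \<theta>
  proof -
    have "1 + \<theta> * E = (\<integral>k. 1 + \<theta> * (real k - mu) \<partial>excited)" unfolding E_def using int by simp
    also have "\<dots> \<le> (\<integral>k. exp (\<theta> * (real k - mu)) \<partial>excited)"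
      using ok[OF that] int by (intro integral_mono exponential_moment) (auto simp: exp_ge_add_one_self)
    also have "\<dots> \<le> exp (9 * \<theta>\<^sup>2 * V)" using ok[OF that] by (intro exponential_moment) auto
    finally show ?thesis by simp
  qed
  define h where "h x = (exp (9 * x\<^sup>2 * V) - 1) / x" for x :: real
  have h0: "(h \<longlongrightarrow> 0) (at_right 0)"
  proof -
    have "((\<lambda>x. exp (9 * x\<^sup>2 * V)) has_real_derivative 0) (at 0)" by (auto intro!: derivative_eq_intros)
    then have "((\<lambda>x. (exp (9 * x\<^sup>2 * V) - exp (9 * 0\<^sup>2 * V)) / (x - 0)) \<longlongrightarrow> 0) (at 0)"
      by (simp add: has_field_derivative_iff)
    then have "(h \<longlongrightarrow> 0) (at 0)" by (simp add: h_def[abs_def])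
    then show ?thesis by (rule tendsto_mono[OF at_le, rotated]) simp
  qed
  have ev: "\<forall>\<^sub>F x in at_right 0. 0 < x \<and> x \<le> \<theta>0"
    using \<theta>0(1) by (auto simp: eventually_at_right_field intro: exI[of _ \<theta>0])
  have "\<forall>\<^sub>F x in at_right 0. E \<le> h x"
    using ev
  proof eventually_elim
    case (elim x)
    then show ?case using le[of x] by (simp add: h_def pos_le_divide_eq mult.commute)
  qed
  with h0 have 1: "E \<le> 0" by (rule tendsto_lowerbound) simp
  have "\<forall>\<^sub>F x in at_right 0. - E \<le> h x"
    using ev
  proof eventually_elim
    case (elim x)
    then show ?case using le[of "- x"] by (simp add: h_def pos_le_divide_eq mult.commute)
  qed
  with h0 have 2: "- E \<le> 0" by (rule tendsto_lowerbound) simp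
  show "(\<integral>k. real k - mu \<partial>excited) = 0" using 1 2 unfolding E_def by simp
qed

end

section \<open>The canonical ensemble as a conditioned grand canonical one\<close>

lemma nn_integral_count_space_has_sum:
  fixes f :: "'b \<Rightarrow> real"
  assumes "(f has_sum s) A" "\<And>x. x \<in> A \<Longrightarrow> 0 \<le> f x"
  shows "(\<integral>\<^sup>+x. ennreal (f x) \<partial>count_space A) = ennreal s"
proof -
  have "(\<lambda>x. norm (f x)) summable_on A"
    using has_sum_imp_summable[OF assms(1)] by (rule summable_on_cong[THEN iffD1, rotated]) (use assms(2) in simp)
  then have abs: "Infinite_Set_Sum.abs_summable_on f A" by (simp only: abs_summable_equivalent)
  then have "(\<integral>\<^sup>+x. ennreal (f x) \<partial>count_space A) = ennreal (infsetsum f A)"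
    using assms(2) by (rule nn_integral_conv_infsetsum)
  also have "infsetsum f A = s" using abs assms(1) by (simp add: infsetsum_infsum infsumI)
  finally show ?thesis .
qed

lemma bij_add_ground:
  "bij_betw (\<lambda>(m, d). add_ground (n - m) d) (Sigma {..n} configs) (configs n)"
proof (rule bij_betwI[where g="\<lambda>c. (n - c 0, \<lambda>j. c (Suc j))"])
  show "(\<lambda>(m, d). add_ground (n - m) d) \<in> Sigma {..n} configs \<rightarrow> configs n"
  proof (clarsimp)
    fix m d assume "m \<le> n" "d \<in> configs m"
    then show "add_ground (n - m) d \<in> configs n" using add_ground_configs[of d m "n - m"] by simp
  qed
  show "(\<lambda>c. (n - c 0, \<lambda>j. c (Suc j))) \<in> configs n \<rightarrow> Sigma {..n} configs"
    by (auto intro: tail_configs(2))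
  show "(case case x of (m, d) \<Rightarrow> add_ground (n - m) d of c \<Rightarrow> (n - c 0, \<lambda>j. c (Suc j))) = x"
    if "x \<in> Sigma {..n} configs" for x
    using that by auto
  show "(case (n - y 0, \<lambda>j. y (Suc j)) of (m, d) \<Rightarrow> add_ground (n - m) d) = y"
    if "y \<in> configs n" for y
    using tail_configs(1,3)[OF that] by simp
qed

context boltzmann_factors
begin

lemma excited_not_empty: "set_pmf excited \<inter> {..n} \<noteq> {}"
proof -
  have "pmf excited 0 \<noteq> 0" using shell_pos[of 0] Z_pos by (simp add: pmf_excited)
  then have "0 \<in> set_pmf excited" by (simp add: set_pmf_iff)
  then show ?thesis by auto
qed

lemma sum_shell_pos: "0 < (\<Sum>k\<le>n. shell k)"
  by (rule sum_pos) (auto simp: shell_pos)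

lemma measure_excited_atMost: "measure excited {..n} = (\<Sum>k\<le>n. shell k) / Z"
  by (simp add: measure_measure_pmf_finite pmf_excited sum_divide_distrib)

context
  fixes E :: "nat \<Rightarrow> real" and \<beta> :: real and n :: nat
  assumes q_eq: "\<And>j. q j = exp (- \<beta> * (E (Suc j) - E 0))"
begin

lemma weight_add_ground:
  assumes "k \<le> n" "d \<in> configs k"
  shows "exp (- \<beta> * energy E (add_ground (n - k) d)) = exp (- \<beta> * (real n * E 0)) * occupation_monomial q d"
proof -
  have "q = (\<lambda>j. exp (- \<beta> * (E (Suc j) - E 0)))" using q_eq by auto
  then have "occupation_monomial q d = exp (- \<beta> * energy (\<lambda>j. E (Suc j) - E 0) d)"
    by (simp only: exp_energy)
  moreover have "energy E (add_ground (n - k) d) = real n * E 0 + energy (\<lambda>j. E (Suc j) - E 0) d"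
    using energy_add_ground[OF assms(2), of E "n - k"] assms(1) by simp
  ultimately show ?thesis by (simp add: exp_add[symmetric] algebra_simps)
qed

lemma weights_has_sum:
  "((\<lambda>c. exp (- \<beta> * energy E c)) has_sum exp (- \<beta> * (real n * E 0)) * (\<Sum>k\<le>n. shell k)) (configs n)"
proof -
  let ?K = "exp (- \<beta> * (real n * E 0))"
  let ?f = "\<lambda>p. ?K * occupation_monomial q (snd p)"
  have "(\<lambda>p. occupation_monomial q (snd p)) summable_on Sigma UNIV configs"
    using monomial_summable by (subst summable_on_reindex_bij_betw[OF bij_snd_configs])
  then have "(\<lambda>p. occupation_monomial q (snd p)) summable_on Sigma {..n} configs"
    by (rule summable_on_subset_banach) auto
  then have s: "?f summable_on Sigma {..n} configs" by (rule summable_on_cmult_right)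
  have "(?f has_sum (\<Sum>k\<le>n. ?K * shell k)) (Sigma {..n} configs)"
  proof (rule has_sum_SigmaI[OF _ _ s])
    show "((\<lambda>d. ?f (k, d)) has_sum ?K * shell k) (configs k)" for k
      using has_sum_cmult_right[OF shell_has_sum[of k], of ?K] by simp
    show "((\<lambda>k. ?K * shell k) has_sum (\<Sum>k\<le>n. ?K * shell k)) {..n}"
      by (rule has_sum_finite) simp
  qed
  then have "((\<lambda>p. exp (- \<beta> * energy E (case p of (k, d) \<Rightarrow> add_ground (n - k) d))) has_sum (\<Sum>k\<le>n. ?K * shell k)) (Sigma {..n} configs)"
  proof (rule has_sum_cong[THEN iffD1, rotated])
    fix p assume "p \<in> Sigma {..n} configs"
    then show "?f p = exp (- \<beta> * energy E (case p of (k, d) \<Rightarrow> add_ground (n - k) d))"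
      by (cases p) (simp only: mem_Sigma_iff prod.case snd_conv weight_add_ground atMost_iff)
  qed
  then have "((\<lambda>c. exp (- \<beta> * energy E c)) has_sum (\<Sum>k\<le>n. ?K * shell k)) (configs n)"
    by (subst (asm) has_sum_reindex_bij_betw[OF bij_add_ground])
  then show ?thesis by (simp add: sum_distrib_left)
qed

lemma partition_fun_eq: "partition_fun E \<beta> n = exp (- \<beta> * (real n * E 0)) * (\<Sum>k\<le>n. shell k)"
  unfolding partition_fun_def using weights_has_sum by (rule infsumI)

lemma prob_space_canonical_gibbs: "prob_space (gibbs E \<beta> n)"
  by (rule prob_space_gibbs[OF has_sum_imp_summable[OF weights_has_sum]])

text \<open>A configuration of \<open>n\<close> particles is determined by its excited part, and its Gibbs weight is the monomial
  of that part up to a constant factor. Summing over the excited parts with \<open>k\<close> particles, one sees that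
  both measures give \<open>k \<le> n\<close> a mass proportional to \<open>shell k\<close>.\<close>

lemma gibbs_excited:
  "distr (gibbs E \<beta> n) (count_space UNIV) (\<lambda>c. n - c 0) = measure_pmf (cond_pmf excited {..n})"
proof (rule measure_eqI_countable[where A=UNIV])
  fix k :: nat
  let ?w = "\<lambda>c. ennreal (exp (- \<beta> * energy E c) / partition_fun E \<beta> n)"
  let ?X = "(\<lambda>c. n - c 0) -` {k} \<inter> configs n"
  have "emeasure (distr (gibbs E \<beta> n) (count_space UNIV) (\<lambda>c. n - c 0)) {k} = emeasure (gibbs E \<beta> n) ?X"
    by (subst emeasure_distr) (auto simp: gibbs_def space_point_measure sets_point_measure measurable_def)
  also have "\<dots> = (\<integral>\<^sup>+c. ?w c * indicator ?X c \<partial>count_space (configs n))"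
    unfolding gibbs_def point_measure_def by (subst emeasure_density) auto
  also have "\<dots> = (\<integral>\<^sup>+c. ?w c \<partial>count_space ?X)"
  proof -
    have "(\<integral>\<^sup>+c. ?w c * indicator ?X c \<partial>count_space (configs n)) = (\<integral>\<^sup>+c. ?w c * indicator ?X c \<partial>count_space UNIV)"
      by (rule nn_integral_count_space_eq) auto
    also have "\<dots> = (\<integral>\<^sup>+c. ?w c \<partial>count_space ?X)"
      by (rule nn_integral_count_space_indicator[symmetric]) (simp add: NO_MATCH_def)
    finally show ?thesis .
  qed
  also have "\<dots> = ennreal (pmf (cond_pmf excited {..n}) k)"
  proof (cases "k \<le> n")
    case True
    have bij: "bij_betw (add_ground (n - k)) (configs k) ?X"
    proof (rule bij_betwI[where g="\<lambda>c j. c (Suc j)"])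
      show "add_ground (n - k) \<in> configs k \<rightarrow> ?X"
        using True add_ground_configs[of _ k "n - k"] by auto
      show "(\<lambda>c j. c (Suc j)) \<in> ?X \<rightarrow> configs k" using tail_configs(2) by auto
      show "add_ground (n - k) (\<lambda>j. c (Suc j)) = c" if "c \<in> ?X" for c
        using that tail_configs(1,3)[of c n] by auto
    qed auto
    have "(\<integral>\<^sup>+c. ?w c \<partial>count_space ?X) = (\<integral>\<^sup>+d. ?w (add_ground (n - k) d) \<partial>count_space (configs k))"
      by (rule nn_integral_bij_count_space[OF bij, symmetric])
    also have "\<dots> = (\<integral>\<^sup>+d. ennreal (inverse (\<Sum>k\<le>n. shell k) * occupation_monomial q d) \<partial>count_space (configs k))"
    proof (rule nn_integral_cong)
      fix d assume "d \<in> space (count_space (configs k))"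
      then have d: "d \<in> configs k" by simp
      show "?w (add_ground (n - k) d) = ennreal (inverse (\<Sum>k\<le>n. shell k) * occupation_monomial q d)"
        unfolding weight_add_ground[OF True d] partition_fun_eq mult_divide_mult_cancel_left[OF exp_not_eq_zero]
        by (simp only: divide_inverse mult.commute)
    qed
    also have "\<dots> = ennreal (inverse (\<Sum>k\<le>n. shell k) * shell k)"
      using sum_shell_pos monomial_pos
      by (intro nn_integral_count_space_has_sum has_sum_cmult_right shell_has_sum) (simp add: less_imp_le)
    also have "inverse (\<Sum>k\<le>n. shell k) * shell k = pmf (cond_pmf excited {..n}) k"
      using True Z_pos by (simp add: pmf_cond[OF excited_not_empty] pmf_excited measure_excited_atMost divide_inverse)
    finally show ?thesis .
  next
    case False
    then have "?X = {}" by auto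
    then have "(\<integral>\<^sup>+c. ?w c \<partial>count_space ?X) = 0" by (simp add: nn_integral_empty)
    then show ?thesis using False by (simp add: pmf_cond[OF excited_not_empty])
  qed
  finally show "emeasure (distr (gibbs E \<beta> n) (count_space UNIV) (\<lambda>c. n - c 0)) {k} = emeasure (measure_pmf (cond_pmf excited {..n})) {k}"
    by (simp add: emeasure_pmf_single)
qed auto

end

lemma integrable_cond_excited [simp]:
  fixes f :: "nat \<Rightarrow> 'b::{banach, second_countable_topology}"
  shows "integrable (cond_pmf excited {..n}) f"
  by (rule integrable_measure_pmf_finite) (simp add: set_cond_pmf[OF excited_not_empty])

lemma N0_law_excited:
  assumes q_eq: "\<And>j. q j = exp (- (1 / (kB * temp \<alpha> t n)) * (E (Suc j) - E 0))"
  defines "p \<equiv> cond_pmf excited {..n}"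
  shows "N0_law kB E \<alpha> t a n = distr p borel (\<lambda>k. - ((real k - (\<integral>k. real k \<partial>p)) / a n))"
proof -
  define G where "G = gibbs E (1 / (kB * temp \<alpha> t n)) n"
  have spG: "space G = configs n" by (simp add: G_def gibbs_def space_point_measure)
  have D: "distr G (count_space UNIV) (\<lambda>c. n - c 0) = measure_pmf p"
    unfolding G_def p_def by (rule gibbs_excited[OF q_eq])
  interpret G: prob_space G unfolding G_def by (rule prob_space_canonical_gibbs[OF q_eq])
  have m1: "(\<lambda>c. n - c 0) \<in> measurable G (count_space UNIV)"
    by (simp add: G_def gibbs_def measurable_def space_point_measure sets_point_measure)
  have c0: "real (c 0) = real n - real (n - c 0)" if "c \<in> space G" for c
    using tail_configs(1)[of c n] that by (simp add: spG of_nat_diff)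
  have "(\<integral>c. real (c 0) \<partial>G) = (\<integral>c. real n - real (n - c 0) \<partial>G)"
    by (rule Bochner_Integration.integral_cong) (use c0 in auto)
  also have "\<dots> = (\<integral>k. real n - real k \<partial>p)"
    unfolding D[symmetric] by (subst integral_distr[OF m1]) auto
  also have "\<dots> = real n - (\<integral>k. real k \<partial>p)" by (simp add: p_def)
  finally have mean: "(\<integral>c. real (c 0) \<partial>G) = real n - (\<integral>k. real k \<partial>p)" .
  have "N0_law kB E \<alpha> t a n = distr G borel (\<lambda>c. (real (c 0) - (\<integral>c. real (c 0) \<partial>G)) / a n)"
    by (simp add: N0_law_def G_def Let_def)
  also have "\<dots> = distr G borel ((\<lambda>k. - ((real k - (\<integral>k. real k \<partial>p)) / a n)) \<circ> (\<lambda>c. n - c 0))"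
    by (rule distr_cong) (auto simp: mean c0 field_simps diff_divide_distrib)
  also have "\<dots> = distr (distr G (count_space UNIV) (\<lambda>c. n - c 0)) borel (\<lambda>k. - ((real k - (\<integral>k. real k \<partial>p)) / a n))"
    by (rule distr_distr[symmetric, OF _ m1]) simp
  finally show ?thesis unfolding D .
qed

end

lemma integral_cond_pmf:
  fixes f :: "'b \<Rightarrow> 'c::{banach, second_countable_topology}"
  assumes "set_pmf p \<inter> A \<noteq> {}"
  shows "(\<integral>x. f x \<partial>cond_pmf p A) = (\<integral>x. indicat_real A x *\<^sub>R f x \<partial>p) /\<^sub>R measure p A"
proof -
  have pos: "0 < measure p A" using assms by (meson disjoint_iff measure_pmf_posI)
  have "measure_pmf (cond_pmf p A) = density (measure_pmf p) (\<lambda>x. ennreal (indicator A x / measure p A))"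
    unfolding cond_pmf.rep_eq[OF assms] uniform_measure_def
  proof (intro density_cong AE_I2)
    fix x
    show "indicator A x / emeasure (measure_pmf p) A = ennreal (indicator A x / measure p A)"
      unfolding ennreal_indicator[symmetric] measure_pmf.emeasure_eq_measure
      by (rule divide_ennreal) (use pos in auto)
  qed auto
  then have "(\<integral>x. f x \<partial>cond_pmf p A) = (\<integral>x. (indicator A x / measure p A) *\<^sub>R f x \<partial>p)"
    by (simp add: integral_density)
  also have "\<dots> = (\<integral>x. (1 / measure p A) *\<^sub>R (indicat_real A x *\<^sub>R f x) \<partial>p)" by simp
  also have "\<dots> = (\<integral>x. indicat_real A x *\<^sub>R f x \<partial>p) /\<^sub>R measure p A"
    by (subst integral_scaleR_right) (simp add: inverse_eq_divide)
  finally show ?thesis .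
qed

text \<open>Conditioning on \<open>A\<close> removes a part of total mass \<open>\<pi>\<close> from the integral of a function bounded by 1 and
  renormalises by \<open>1 - \<pi>\<close>; it moves the mean of \<open>Y\<close> from 0 to \<open>- r / (1 - \<pi>)\<close>.\<close>

lemma char_conditioned:
  fixes Y :: "'b \<Rightarrow> real" and p :: "'b pmf"
  assumes ne: "set_pmf p \<inter> A \<noteq> {}" and int: "integrable p Y" and mean: "(\<integral>x. Y x \<partial>p) = 0"
  defines "r \<equiv> (\<integral>x. Y x * indicator (- A) x \<partial>p)" and "\<pi> \<equiv> measure p (- A)"
  defines "\<kappa> \<equiv> (\<integral>x. Y x \<partial>cond_pmf p A)"
  shows "norm ((CLINT x|cond_pmf p A. iexp (u * (Y x - \<kappa>))) - (CLINT x|p. iexp (u * Y x))) \<le> (\<bar>u\<bar> * \<bar>r\<bar> + 2 * \<pi>) / (1 - \<pi>)"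
proof -
  have pos: "0 < measure p A" using ne by (meson disjoint_iff measure_pmf_posI)
  have A: "measure p A = 1 - \<pi>" unfolding \<pi>_def using measure_pmf.prob_compl[of A p] by (simp add: Compl_eq_Diff_UNIV)
  have \<pi>: "0 \<le> \<pi>" "\<pi> < 1" using pos A by (auto simp: \<pi>_def)
  define \<phi> where "\<phi> = (CLINT x|p. iexp (u * Y x))"
  define c where "c = (CLINT x|cond_pmf p A. iexp (u * Y x))"
  define d where "d = (CLINT x|p. indicat_real (- A) x *\<^sub>R iexp (u * Y x))"
  have ie: "integrable p (\<lambda>x. iexp (u * Y x))" by (intro measure_pmf.integrable_const_bound[where B=1]) auto
  have split: "(\<integral>x. indicat_real A x *\<^sub>R f x \<partial>p) = (\<integral>x. f x \<partial>p) - (\<integral>x. indicat_real (- A) x *\<^sub>R f x \<partial>p)"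
    if "integrable p f" for f :: "'b \<Rightarrow> 'c::{banach, second_countable_topology}"
  proof -
    have i: "integrable p (\<lambda>x. indicat_real (- A) x *\<^sub>R f x)"
      using that by (rule integrable_mult_indicator[rotated]) simp
    have "indicat_real A x *\<^sub>R f x = f x - indicat_real (- A) x *\<^sub>R f x" for x by (simp add: indicator_def)
    then show ?thesis using that i by simp
  qed
  have "\<kappa> = (0 - r) / (1 - \<pi>)"
    unfolding \<kappa>_def integral_cond_pmf[OF ne] split[OF int] A mean r_def by (simp add: divide_inverse mult_ac)
  then have \<kappa>: "\<bar>\<kappa>\<bar> = \<bar>r\<bar> / (1 - \<pi>)" using \<pi> by (simp add: abs_divide)
  have c_eq: "c = (\<phi> - d) /\<^sub>R (1 - \<pi>)"
    unfolding c_def integral_cond_pmf[OF ne] split[OF ie] A \<phi>_def d_def ..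
  have "norm d \<le> (\<integral>x. norm (indicat_real (- A) x *\<^sub>R iexp (u * Y x)) \<partial>p)"
    unfolding d_def by (rule integral_norm_bound)
  also have "\<dots> = \<pi>" by (simp add: \<pi>_def)
  finally have d: "norm d \<le> \<pi>" .
  have \<phi>: "norm \<phi> \<le> 1"
    unfolding \<phi>_def by (rule order_trans[OF integral_norm_bound]) simp
  have "c - \<phi> = (of_real \<pi> * \<phi> - d) /\<^sub>R (1 - \<pi>)"
    unfolding c_eq using \<pi> by (simp add: scaleR_conv_of_real field_simps)
  then have "norm (c - \<phi>) = norm (of_real \<pi> * \<phi> - d) / (1 - \<pi>)"
    using \<pi> by (simp add: divide_inverse mult.commute)
  also have "\<dots> \<le> (\<pi> * 1 + \<pi>) / (1 - \<pi>)"
  proof (rule divide_right_mono)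
    have "norm (of_real \<pi> * \<phi> - d) \<le> \<pi> * norm \<phi> + norm d"
      using norm_triangle_ineq4[of "of_real \<pi> * \<phi>" d] \<pi> by (simp add: norm_mult)
    also have "\<dots> \<le> \<pi> * 1 + \<pi>" using \<pi> \<phi> d by (intro add_mono mult_left_mono)
    finally show "norm (of_real \<pi> * \<phi> - d) \<le> \<pi> * 1 + \<pi>" .
  qed (use \<pi> in simp)
  finally have 1: "norm (c - \<phi>) \<le> 2 * \<pi> / (1 - \<pi>)" by simp
  have "(CLINT x|cond_pmf p A. iexp (u * (Y x - \<kappa>))) = (CLINT x|cond_pmf p A. iexp (- (u * \<kappa>)) * iexp (u * Y x))"
    by (intro Bochner_Integration.integral_cong refl) (simp add: exp_add[symmetric] algebra_simps)
  also have "\<dots> = iexp (- (u * \<kappa>)) * c" unfolding c_def by (rule integral_mult_right_zero)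
  finally have eq: "(CLINT x|cond_pmf p A. iexp (u * (Y x - \<kappa>))) - c = (iexp (- (u * \<kappa>)) - 1) * c"
    by (simp add: algebra_simps)
  have c1: "norm c \<le> 1"
    unfolding c_def by (rule order_trans[OF integral_norm_bound]) simp
  have "norm ((iexp (- (u * \<kappa>)) - 1) * c) \<le> \<bar>u * \<kappa>\<bar> * 1"
    unfolding norm_mult using iexp_approx1[of "- (u * \<kappa>)" 0] c1 by (intro mult_mono) auto
  then have 2: "norm ((CLINT x|cond_pmf p A. iexp (u * (Y x - \<kappa>))) - c) \<le> \<bar>u\<bar> * (\<bar>r\<bar> / (1 - \<pi>))"
    unfolding eq by (simp add: abs_mult \<kappa>)
  have "norm ((CLINT x|cond_pmf p A. iexp (u * (Y x - \<kappa>))) - \<phi>) \<le> \<bar>u\<bar> * (\<bar>r\<bar> / (1 - \<pi>)) + 2 * \<pi> / (1 - \<pi>)"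
    using norm_triangle_ineq[of "(CLINT x|cond_pmf p A. iexp (u * (Y x - \<kappa>))) - c" "c - \<phi>"] 1 2 by simp
  then show ?thesis unfolding \<phi>_def by (simp add: add_divide_distrib)
qed

text \<open>From \<open>(s y)\<^sup>2 / 2 \<le> exp (s y)\<close> one gets \<open>y \<le> 2 exp (s y) / (s\<^sup>2 b)\<close> for \<open>y \<ge> b\<close>.\<close>

lemma exponential_moment_tail:
  fixes Y :: "'b \<Rightarrow> real" and p :: "'b pmf"
  assumes int: "integrable p Y" and eint: "integrable p (\<lambda>x. exp (s * Y x))" and K: "(\<integral>x. exp (s * Y x) \<partial>p) \<le> K"
    and s: "0 < s" and b: "0 < b" and A: "\<And>x. x \<notin> A \<Longrightarrow> b \<le> Y x"
  shows "0 \<le> (\<integral>x. Y x * indicator (- A) x \<partial>p)" "(\<integral>x. Y x * indicator (- A) x \<partial>p) \<le> 2 * K / (s\<^sup>2 * b)"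
    and "measure p (- A) \<le> 2 * K / (s\<^sup>2 * b\<^sup>2)"
proof -
  have i: "integrable p (\<lambda>x. Y x * indicator (- A) x)"
    using int by (rule integrable_real_mult_indicator[rotated]) simp
  show "0 \<le> (\<integral>x. Y x * indicator (- A) x \<partial>p)"
  proof (rule Bochner_Integration.integral_nonneg)
    show "0 \<le> Y x * indicator (- A) x" for x using A[of x] b by (cases "x \<in> A") auto
  qed
  have "(\<integral>x. Y x * indicator (- A) x \<partial>p) \<le> (\<integral>x. 2 / (s\<^sup>2 * b) * exp (s * Y x) \<partial>p)"
  proof (rule integral_mono[OF i])
    show "integrable p (\<lambda>x. 2 / (s\<^sup>2 * b) * exp (s * Y x))" by (intro integrable_mult_right eint)
    show "Y x * indicator (- A) x \<le> 2 / (s\<^sup>2 * b) * exp (s * Y x)" for x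
    proof (cases "x \<in> A")
      case True then show ?thesis using s b by simp
    next
      case False
      then have y: "b \<le> Y x" by (rule A)
      have "1 + s * Y x + (s * Y x)\<^sup>2 / 2 \<le> exp (s * Y x)"
        using s b y by (intro exp_lower_Taylor_quadratic) auto
      moreover have "0 \<le> s * Y x" using s b y by simp
      ultimately have "(s * Y x)\<^sup>2 / 2 \<le> exp (s * Y x)" by linarith
      moreover have "s\<^sup>2 * b * Y x \<le> (s * Y x)\<^sup>2"
        using s b y by (simp add: power_mult_distrib power2_eq_square mult_mono)
      ultimately have "s\<^sup>2 * b * Y x \<le> 2 * exp (s * Y x)" by linarith
      then show ?thesis using False s b by (simp add: field_simps)
    qed
  qed
  also have "\<dots> = 2 / (s\<^sup>2 * b) * (\<integral>x. exp (s * Y x) \<partial>p)" by simp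
  also have "\<dots> \<le> 2 / (s\<^sup>2 * b) * K" using s b by (intro mult_left_mono K) auto
  finally show r: "(\<integral>x. Y x * indicator (- A) x \<partial>p) \<le> 2 * K / (s\<^sup>2 * b)" by simp
  have "b * measure p (- A) = (\<integral>x. b * indicator (- A) x \<partial>p)" by simp
  also have "\<dots> \<le> (\<integral>x. Y x * indicator (- A) x \<partial>p)"
  proof (rule integral_mono[OF _ i])
    show "integrable p (\<lambda>x. b * indicat_real (- A) x)" by (rule integrable_real_mult_indicator) simp_all
    show "b * indicat_real (- A) x \<le> Y x * indicator (- A) x" for x using A[of x] by (cases "x \<in> A") auto
  qed
  finally have "b * measure p (- A) \<le> 2 * K / (s\<^sup>2 * b)" using r by linarith
  then show "measure p (- A) \<le> 2 * K / (s\<^sup>2 * b\<^sup>2)" using b s by (simp add: field_simps power2_eq_square)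
qed

text \<open>The canonical and the grand canonical number of excited particles, each centred at its own mean,
  have the same limiting fluctuations. Indeed, an exponential moment of the centred grand canonical
  number is bounded on the scale \<open>a\<close>, and the \<open>\<nu>\<close> particles exceed the mean by many multiples of \<open>a\<close>.
  Hence the event that more than \<open>\<nu>\<close> particles are excited is negligible, both in probability and in
  its contribution to the mean.\<close>

lemma canonical_fluctuations:
  fixes q :: "nat \<Rightarrow> nat \<Rightarrow> real" and a :: "nat \<Rightarrow> real" and \<nu> :: "nat \<Rightarrow> nat"
  defines "p \<equiv> \<lambda>n. boltzmann_factors.excited (q n)"
    and "\<mu> \<equiv> \<lambda>n. boltzmann_factors.mu (q n)"
  defines "c \<equiv> \<lambda>n. cond_pmf (p n) {..\<nu> n}"
  assumes q: "\<And>n. boltzmann_factors (q n)"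
    and a: "filterlim a at_top sequentially"
    and var: "\<forall>\<^sub>F n in sequentially. boltzmann_factors.V (q n) / (a n)\<^sup>2 \<le> C"
    and small: "\<forall>\<^sub>F n in sequentially. boltzmann_factors.mean_occ (q n) 0 / a n \<le> C"
    and room: "filterlim (\<lambda>n. (real (\<nu> n) - \<mu> n) / a n) at_top sequentially"
    and char: "(\<lambda>n. CLINT k|p n. iexp (u / a n * (real k - \<mu> n))) \<longlonglongrightarrow> \<psi>"
  shows "(\<lambda>n. CLINT k|c n. iexp (u * ((real k - (\<integral>k. real k \<partial>c n)) / a n))) \<longlonglongrightarrow> \<psi>"
proof -
  define b where "b n = (real (\<nu> n) - \<mu> n) / a n" for n
  define C' where "C' = max C 0"
  \<comment> \<open>small enough for \<open>exponential_moment\<close> at \<open>s / a n\<close>, since \<open>mean_occ 0 / a n \<le> C'\<close>\<close>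
  define s where "s = 1 / (4 * (C' + 1))"
  have C': "0 \<le> C'" "C \<le> C'" by (auto simp: C'_def)
  have s: "0 < s" "s \<le> 1" "C' * s \<le> 1/4" using C' by (auto simp: s_def field_simps)
  define K where "K = exp (9 * s\<^sup>2 * C')"
  define Y where "Y n k = (real k - \<mu> n) / a n" for n and k :: nat
  define D where "D n = (\<bar>u\<bar> * (2 * K / (s\<^sup>2 * b n)) + 2 * (2 * K / (s\<^sup>2 * (b n)\<^sup>2))) / (1 - 2 * K / (s\<^sup>2 * (b n)\<^sup>2))" for n
  have binf: "filterlim b at_top sequentially" using room by (simp add: b_def[abs_def])
  have b0: "(\<lambda>n. 1 / b n) \<longlonglongrightarrow> 0"
    by (rule tendsto_divide_0[OF tendsto_const filterlim_at_top_imp_at_infinity[OF binf]])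
  have 1: "(\<lambda>n. 2 * K / (s\<^sup>2 * b n)) \<longlonglongrightarrow> 0"
    using tendsto_mult_left[OF b0, of "2 * K / s\<^sup>2"] by simp
  have 2: "(\<lambda>n. 2 * K / (s\<^sup>2 * (b n)\<^sup>2)) \<longlonglongrightarrow> 0"
    using tendsto_mult_left[OF tendsto_power[OF b0, of 2], of "2 * K / s\<^sup>2"] by (simp add: power_divide)
  have "D \<longlonglongrightarrow> (\<bar>u\<bar> * 0 + 2 * 0) / (1 - 0)"
    unfolding D_def by (intro tendsto_divide tendsto_add tendsto_mult tendsto_diff tendsto_const 1 2) simp
  then have D0: "D \<longlonglongrightarrow> 0" by simp
  have "\<forall>\<^sub>F n in sequentially. norm ((CLINT k|c n. iexp (u * ((real k - (\<integral>k. real k \<partial>c n)) / a n))) - (CLINT k|p n. iexp (u / a n * (real k - \<mu> n)))) \<le> D n"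
  proof -
    have e1: "\<forall>\<^sub>F n in sequentially. 1 \<le> a n" using a by (rule filterlim_at_top[THEN iffD1, rule_format])
    have e2: "\<forall>\<^sub>F n in sequentially. 1 \<le> b n" using binf by (rule filterlim_at_top[THEN iffD1, rule_format])
    have e3: "\<forall>\<^sub>F n in sequentially. 2 * K / (s\<^sup>2 * (b n)\<^sup>2) < 1" using 2 by (rule order_tendstoD) simp
    from var small e1 e2 e3 show ?thesis
    proof eventually_elim
      case (elim n)
      interpret q: boltzmann_factors "q n" by (rule q)
      have p: "p n = q.excited" and \<mu>: "\<mu> n = q.mu" by (simp_all add: p_def \<mu>_def)
      have ne: "set_pmf (p n) \<inter> {..\<nu> n} \<noteq> {}"
        unfolding p by (rule q.excited_not_empty)
      have an: "0 < a n" using elim by simp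
      have intY: "integrable (p n) (Y n)" and meanY: "(\<integral>k. Y n k \<partial>p n) = 0"
        unfolding Y_def p \<mu> using q.mean_excited by simp_all
      have \<theta>: "\<bar>s / a n\<bar> \<le> 1" "q.mean_occ 0 * \<bar>s / a n\<bar> \<le> 1/4"
      proof -
        have "s / a n \<le> 1" using s elim by (simp add: divide_le_eq)
        then show "\<bar>s / a n\<bar> \<le> 1" using s an by simp
        have "q.mean_occ 0 * \<bar>s / a n\<bar> = s * (q.mean_occ 0 / a n)" using s an by simp
        also have "\<dots> \<le> s * C'" using elim C' s by (intro mult_left_mono) auto
        finally show "q.mean_occ 0 * \<bar>s / a n\<bar> \<le> 1/4" using s(3) by (simp add: mult.commute)
      qed
      have sY: "s * Y n k = s / a n * (real k - q.mu)" for k by (simp add: Y_def \<mu>)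
      have eint: "integrable (p n) (\<lambda>k. exp (s * Y n k))"
        unfolding sY p by (rule q.exponential_moment[OF \<theta>])
      have eK: "(\<integral>k. exp (s * Y n k) \<partial>p n) \<le> K"
      proof -
        have "(\<integral>k. exp (s * Y n k) \<partial>p n) \<le> exp (9 * (s / a n)\<^sup>2 * q.V)"
          unfolding sY p by (rule q.exponential_moment[OF \<theta>])
        also have "9 * (s / a n)\<^sup>2 * q.V = 9 * s\<^sup>2 * (q.V / (a n)\<^sup>2)" by (simp add: power_divide)
        also have "exp \<dots> \<le> K"
          unfolding K_def exp_le_cancel_iff using elim C' by (intro mult_left_mono) auto
        finally show ?thesis .
      qed
      have far: "b n \<le> Y n k" if "k \<notin> {..\<nu> n}" for k
        unfolding b_def Y_def using that an by (intro divide_right_mono) auto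
      have bn: "0 < b n" using elim by simp
      note tail = exponential_moment_tail[where A="{..\<nu> n}", OF intY eint eK s(1) bn far]
      let ?r = "\<integral>k. Y n k * indicator (- {..\<nu> n}) k \<partial>p n" and ?\<pi> = "measure (p n) (- {..\<nu> n})"
      have "norm ((CLINT k|c n. iexp (u * (Y n k - (\<integral>k. Y n k \<partial>c n)))) - (CLINT k|p n. iexp (u * Y n k))) \<le> (\<bar>u\<bar> * \<bar>?r\<bar> + 2 * ?\<pi>) / (1 - ?\<pi>)"
        unfolding c_def by (rule char_conditioned[OF ne intY meanY])
      also have "\<dots> \<le> D n"
        unfolding D_def
      proof (rule frac_le)
        have r: "\<bar>?r\<bar> \<le> 2 * K / (s\<^sup>2 * b n)" using tail(1,2) by simp
        show "\<bar>u\<bar> * \<bar>?r\<bar> + 2 * ?\<pi> \<le> \<bar>u\<bar> * (2 * K / (s\<^sup>2 * b n)) + 2 * (2 * K / (s\<^sup>2 * (b n)\<^sup>2))"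
          by (intro add_mono mult_left_mono r tail(3)) auto
        have "0 \<le> 2 * K / (s\<^sup>2 * b n)" using r by linarith
        moreover have "0 \<le> 2 * K / (s\<^sup>2 * (b n)\<^sup>2)" by (rule order_trans[OF measure_nonneg tail(3)])
        ultimately show "0 \<le> \<bar>u\<bar> * (2 * K / (s\<^sup>2 * b n)) + 2 * (2 * K / (s\<^sup>2 * (b n)\<^sup>2))"
          by (intro add_nonneg_nonneg mult_nonneg_nonneg) auto
        show "0 < 1 - 2 * K / (s\<^sup>2 * (b n)\<^sup>2)" using elim by simp
        show "1 - 2 * K / (s\<^sup>2 * (b n)\<^sup>2) \<le> 1 - ?\<pi>" using tail(3) by simp
      qed
      finally have le: "norm ((CLINT k|c n. iexp (u * (Y n k - (\<integral>k. Y n k \<partial>c n)))) - (CLINT k|p n. iexp (u * Y n k))) \<le> D n" .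
      have 1: "Y n k - (\<integral>k. Y n k \<partial>c n) = (real k - (\<integral>k. real k \<partial>c n)) / a n" for k
      proof -
        have "(\<integral>k. Y n k \<partial>c n) = ((\<integral>k. real k \<partial>c n) - \<mu> n) / a n"
          unfolding Y_def c_def p by simp
        then show ?thesis by (simp add: Y_def diff_divide_distrib)
      qed
      have 2: "u * Y n k = u / a n * (real k - \<mu> n)" for k by (simp add: Y_def)
      show ?case using le unfolding 1 2 .
    qed
  qed
  then have "(\<lambda>n. (CLINT k|c n. iexp (u * ((real k - (\<integral>k. real k \<partial>c n)) / a n))) - (CLINT k|p n. iexp (u / a n * (real k - \<mu> n)))) \<longlonglongrightarrow> 0"
    using D0 by (rule Lim_null_comparison)
  from tendsto_add[OF this char] show ?thesis by simp
qed

section \<open>Sums over the energy levels\<close>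

text \<open>The gaps \<open>e\<^sub>j = E\<^sub>j\<^sub>+\<^sub>1 - E\<^sub>0\<close>, subject to a Weyl law with exponent \<open>\<alpha>\<close>.\<close>

locale level_gaps =
  fixes e :: "nat \<Rightarrow> real" and L \<alpha> :: real
  assumes e_pos: "0 < e 0" and e_mono: "mono e"
    and L_pos: "0 < L" and \<alpha>_ge: "1 \<le> \<alpha>"
    and count: "((\<lambda>x. real (card {j. e j \<le> x}) / x powr \<alpha>) \<longlongrightarrow> L) at_top"
begin

definition level_count :: "real \<Rightarrow> nat" where "level_count x = card {j. e j \<le> x}"

text \<open>The single-particle partition function of the excited levels at inverse temperature \<open>x\<close>.\<close>

definition laplace :: "real \<Rightarrow> real" where "laplace x = (\<Sum>j. exp (- x * e j))"

lemma e_gt_0: "0 < e j"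
  using e_pos monoD[OF e_mono, of 0 j] by simp

lemma level_count_tendsto: "((\<lambda>x. real (level_count x) / x powr \<alpha>) \<longlongrightarrow> L) at_top"
  using count by (simp add: level_count_def)

lemma finite_levels: "finite {j. e j \<le> x}"
proof -
  have "\<forall>\<^sub>F x in at_top. real (level_count x) / x powr \<alpha> > 0"
    using level_count_tendsto L_pos by (rule order_tendstoD)
  then have "\<forall>\<^sub>F y in at_top. y \<ge> x \<and> real (level_count y) / y powr \<alpha> > 0"
    using eventually_ge_at_top[of x] by eventually_elim simp
  then obtain y where y: "y \<ge> x" "real (level_count y) / y powr \<alpha> > 0"
    using eventually_happens'[OF trivial_limit_at_top_linorder] by blast
  then have "card {j. e j \<le> y} \<noteq> 0" unfolding level_count_def by (intro notI) simp
  then have "finite {j. e j \<le> y}" by (rule contrapos_np) simp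
  then show ?thesis by (rule rev_finite_subset) (use y in auto)
qed

lemma level_count_mono: "x \<le> y \<Longrightarrow> level_count x \<le> level_count y"
  unfolding level_count_def by (intro card_mono finite_levels) auto

lemma level_count_eq_0: "x < e 0 \<Longrightarrow> level_count x = 0"
proof -
  assume x: "x < e 0"
  have "\<not> e j \<le> x" for j using x monoD[OF e_mono, of 0 j] by simp
  then show ?thesis by (simp add: level_count_def)
qed

text \<open>As no gap is smaller than \<open>e 0 > 0\<close>, the bound extends from large \<open>x\<close> to all \<open>x\<close> and from the exponent
  \<open>\<alpha>\<close> to every larger one.\<close>

lemma level_count_le_powr:
  assumes "p \<ge> \<alpha>"
  obtains C where "C > 0" "\<And>x. real (level_count x) \<le> C * x powr p"
proof -
  have "\<forall>\<^sub>F x in at_top. real (level_count x) / x powr \<alpha> < L + 1"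
    using level_count_tendsto by (rule order_tendstoD) simp
  then obtain X where X: "\<And>x. x \<ge> X \<Longrightarrow> real (level_count x) / x powr \<alpha> < L + 1"
    unfolding eventually_at_top_linorder by blast
  define Y where "Y = max X 1"
  define C where "C = (L + 1) + real (level_count Y) / e 0 powr p"
  have p: "0 < p" using assms \<alpha>_ge by simp
  have C: "C > 0" unfolding C_def using L_pos e_pos by (intro add_pos_nonneg) auto
  have "real (level_count x) \<le> C * x powr p" for x
  proof -
    consider "x < e 0" | "e 0 \<le> x" "x \<le> Y" | "Y \<le> x" by linarith
    then show ?thesis
    proof cases
      case 1 then show ?thesis using C by (simp add: level_count_eq_0)
    next
      case 2
      have "real (level_count x) \<le> real (level_count Y)" using level_count_mono[OF 2(2)] by simp
      also have "\<dots> = real (level_count Y) / e 0 powr p * e 0 powr p" using e_pos by simp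
      also have "\<dots> \<le> C * x powr p" unfolding C_def
        using L_pos e_pos 2 p by (intro mult_mono powr_mono2) auto
      finally show ?thesis .
    next
      case 3
      then have x: "x \<ge> 1" "x \<ge> X" by (auto simp: Y_def)
      have "real (level_count x) \<le> (L + 1) * x powr \<alpha>"
        using X[OF x(2)] x(1) by (simp add: divide_less_eq)
      also have "\<dots> \<le> C * x powr p" unfolding C_def
        using L_pos e_pos x assms by (intro mult_mono powr_mono) auto
      finally show ?thesis .
    qed
  qed
  with C that show ?thesis by blast
qed

lemma measurable_level_count [measurable]: "(\<lambda>x. real (level_count x)) \<in> borel_measurable borel"
  by (rule borel_measurable_mono) (simp add: mono_def level_count_mono)

text \<open>Tonelli's theorem, applied to \<open>exp (- x e\<^sub>j) = \<integral> exp (- y) dy\<close> over \<open>y \<ge> x e\<^sub>j\<close>.\<close>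

lemma exp_levels_nn_integral:
  assumes x: "0 < x"
  shows "(\<Sum>j. ennreal (exp (- x * e j))) = (\<integral>\<^sup>+y. ennreal (exp (- y) * real (level_count (y / x))) \<partial>lborel)"
proof -
  have 1: "ennreal (exp (- x * e j)) = (\<integral>\<^sup>+y. ennreal (exp (- y)) * indicator {x * e j..} y \<partial>lborel)" for j
  proof -
    have "(\<integral>\<^sup>+y. ennreal (exp (- y)) * indicator {x * e j..} y \<partial>lborel) = ennreal (0 - (- exp (- (x * e j))))"
    proof (rule nn_integral_FTC_atLeast)
      show "((\<lambda>y::real. - exp (- y)) \<longlongrightarrow> 0) at_top"
        using tendsto_minus[OF filterlim_compose[OF exp_at_bot filterlim_uminus_at_bot_at_top]] by simp
    qed (auto intro!: derivative_eq_intros)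
    then show ?thesis by simp
  qed
  have 2: "(\<Sum>j. ennreal (exp (- y)) * indicator {x * e j..} y) = ennreal (exp (- y) * real (level_count (y / x)))" for y
  proof -
    have "(\<Sum>j. ennreal (exp (- y)) * indicator {x * e j..} y) = (\<Sum>j\<in>{j. e j \<le> y / x}. ennreal (exp (- y)) * indicator {x * e j..} y)"
      by (rule suminf_finite[OF finite_levels]) (use x in \<open>auto simp: indicator_def field_simps\<close>)
    also have "\<dots> = (\<Sum>j\<in>{j. e j \<le> y / x}. ennreal (exp (- y)))"
      by (rule sum.cong) (use x in \<open>auto simp: indicator_def field_simps\<close>)
    also have "\<dots> = ennreal (exp (- y) * real (level_count (y / x)))"
      by (simp add: level_count_def ennreal_mult ennreal_of_nat_eq_real_of_nat mult.commute)
    finally show ?thesis .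
  qed
  have "(\<Sum>j. ennreal (exp (- x * e j))) = (\<integral>\<^sup>+y. (\<Sum>j. ennreal (exp (- y)) * indicator {x * e j..} y) \<partial>lborel)"
    unfolding 1 by (rule nn_integral_suminf[symmetric]) auto
  then show ?thesis by (simp only: 2)
qed

lemma integrable_Gamma_integrand:
  assumes "0 < (s::real)"
  shows "integrable lborel (\<lambda>y::real. indicator {0..} y * (y powr (s - 1) * exp (- y)))"
    and "(\<integral>y. indicator {0..} (y::real) * (y powr (s - 1) * exp (- y)) \<partial>lborel) = Gamma s"
proof -
  have "has_bochner_integral lborel (\<lambda>y::real. indicator {0..} y * (y powr (s - 1) * exp (- y))) (Gamma s)"
  proof (rule has_bochner_integral_nn_integral)
    show "(\<integral>\<^sup>+y. ennreal (indicator {0..} y * (y powr (s - 1) * exp (- y))) \<partial>lborel) = ennreal (Gamma s)"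
      using Gamma_conv_nn_integral_real[OF assms] by (simp add: exp_minus divide_inverse mult.assoc)
    show "0 \<le> Gamma s" using Gamma_real_pos[OF assms] by simp
  qed auto
  then show "integrable lborel (\<lambda>y::real. indicator {0..} y * (y powr (s - 1) * exp (- y)))"
    and "(\<integral>y. indicator {0..} (y::real) * (y powr (s - 1) * exp (- y)) \<partial>lborel) = Gamma s"
    by (auto simp: has_bochner_integral_iff)
qed

lemma integrable_level_count:
  assumes x: "0 < x"
  shows "integrable lborel (\<lambda>y. exp (- y) * real (level_count (y / x)))"
    and level_count_integral_le: "\<And>C p. p \<ge> \<alpha> \<Longrightarrow> C > 0 \<Longrightarrow> (\<And>x. real (level_count x) \<le> C * x powr p) \<Longrightarrow>
      (\<integral>y. exp (- y) * real (level_count (y / x)) \<partial>lborel) \<le> C * Gamma (p + 1) / x powr p"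
proof -
  have *: "integrable lborel (\<lambda>y. exp (- y) * real (level_count (y / x))) \<and>
      (\<integral>y. exp (- y) * real (level_count (y / x)) \<partial>lborel) \<le> C * Gamma (p + 1) / x powr p"
    if p: "p \<ge> \<alpha>" and C: "C > 0" "\<And>x. real (level_count x) \<le> C * x powr p" for C p
  proof -
    let ?w = "\<lambda>y. C / x powr p * (indicator {0..} y * (y powr (p + 1 - 1) * exp (- y)))"
    have p1: "0 < p + 1" using p \<alpha>_ge by simp
    have w: "integrable lborel ?w"
      using integrable_Gamma_integrand(1)[OF p1] by (rule integrable_mult_right)
    have le: "exp (- y) * real (level_count (y / x)) \<le> ?w y" for y
    proof (cases "y \<ge> 0")
      case True
      have "exp (- y) * real (level_count (y / x)) \<le> exp (- y) * (C * (y / x) powr p)"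
        using C by (intro mult_left_mono) auto
      then show ?thesis using True x by (simp add: powr_divide mult_ac)
    next
      case False
      then have "y / x < e 0" using x e_pos by (smt (verit) divide_neg_pos)
      then show ?thesis using False by (simp add: level_count_eq_0)
    qed
    have i: "integrable lborel (\<lambda>y. exp (- y) * real (level_count (y / x)))"
      by (rule Bochner_Integration.integrable_bound[OF w])
         (use order_trans[OF le abs_ge_self] in \<open>simp_all add: abs_mult\<close>)
    moreover have "(\<integral>y. exp (- y) * real (level_count (y / x)) \<partial>lborel) \<le> (\<integral>y. ?w y \<partial>lborel)"
      by (rule integral_mono[OF i w le])
    then have "(\<integral>y. exp (- y) * real (level_count (y / x)) \<partial>lborel) \<le> C * Gamma (p + 1) / x powr p"
      using integrable_Gamma_integrand(2)[OF p1] by simp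
    ultimately show ?thesis by simp
  qed
  from level_count_le_powr[OF order_refl] * show "integrable lborel (\<lambda>y. exp (- y) * real (level_count (y / x)))"
    by (metis order_refl)
  fix C p assume "p \<ge> \<alpha>" "C > 0" "\<And>x. real (level_count x) \<le> C * x powr p"
  from *[OF this] show "(\<integral>y. exp (- y) * real (level_count (y / x)) \<partial>lborel) \<le> C * Gamma (p + 1) / x powr p" by simp
qed

lemma laplace_sums:
  assumes x: "0 < x"
  shows "summable (\<lambda>j. exp (- x * e j))"
    and "laplace x = (\<integral>y. exp (- y) * real (level_count (y / x)) \<partial>lborel)"
proof -
  have "(\<integral>\<^sup>+y. ennreal (exp (- y) * real (level_count (y / x))) \<partial>lborel) = ennreal (\<integral>y. exp (- y) * real (level_count (y / x)) \<partial>lborel)"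
    using integrable_level_count(1)[OF x] by (rule nn_integral_eq_integral) auto
  then have s: "(\<Sum>j. ennreal (exp (- x * e j))) = ennreal (\<integral>y. exp (- y) * real (level_count (y / x)) \<partial>lborel)"
    using exp_levels_nn_integral[OF x] by simp
  show sm: "summable (\<lambda>j. exp (- x * e j))"
  proof (rule summable_suminf_not_top)
    show "(\<Sum>j. ennreal (exp (- x * e j))) \<noteq> top" unfolding s by simp
  qed simp
  have "(\<Sum>j. ennreal (exp (- x * e j))) = ennreal (laplace x)"
    unfolding laplace_def by (rule suminf_ennreal2[OF _ sm]) simp
  with s have "ennreal (laplace x) = ennreal (\<integral>y. exp (- y) * real (level_count (y / x)) \<partial>lborel)" by simp
  moreover have "0 \<le> laplace x" unfolding laplace_def by (rule suminf_nonneg[OF sm]) simp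
  ultimately show "laplace x = (\<integral>y. exp (- y) * real (level_count (y / x)) \<partial>lborel)" by simp
qed

lemma laplace_nonneg: "0 < x \<Longrightarrow> 0 \<le> laplace x"
  unfolding laplace_def by (intro suminf_nonneg laplace_sums) auto

text \<open>The exponent \<open>\<alpha>\<close> gives the order of growth at 0, larger exponents give decay at infinity.\<close>

lemma laplace_le:
  assumes "p \<ge> \<alpha>"
  obtains C where "C > 0" "\<And>x. 0 < x \<Longrightarrow> x powr p * laplace x \<le> C"
proof -
  from level_count_le_powr[OF assms] obtain C where C: "C > 0" "\<And>x. real (level_count x) \<le> C * x powr p" by blast
  have "0 < p + 1" using assms \<alpha>_ge by simp
  then have "C * Gamma (p + 1) > 0" using C(1) by (simp add: Gamma_real_pos)
  moreover have "x powr p * laplace x \<le> C * Gamma (p + 1)" if "0 < x" for x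
    using level_count_integral_le[OF that assms C] that by (simp add: laplace_sums(2) field_simps)
  ultimately show ?thesis using that by blast
qed

text \<open>An Abelian theorem: \<open>x\<^sup>\<alpha> laplace x\<close> is the integral of \<open>exp (- y) x\<^sup>\<alpha> level_count (y / x)\<close>, and the integrand
  tends to \<open>L y\<^sup>\<alpha> exp (- y)\<close>, dominated by a multiple of this function.\<close>

lemma laplace_tendsto: "((\<lambda>x. x powr \<alpha> * laplace x) \<longlongrightarrow> L * Gamma (\<alpha> + 1)) (at_right 0)"
proof -
  from level_count_le_powr[OF order_refl] obtain C where C: "C > 0" "\<And>x. real (level_count x) \<le> C * x powr \<alpha>" by blast
  have \<alpha>1: "0 < \<alpha> + 1" using \<alpha>_ge by simp
  let ?g = "\<lambda>y. indicator {0..} y * (y powr (\<alpha> + 1 - 1) * exp (- y))"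
  let ?s = "\<lambda>t y. exp (- y) * real (level_count (y * t)) / t powr \<alpha>"
  have "((\<lambda>t. \<integral>y. ?s t y \<partial>lborel) \<longlongrightarrow> (\<integral>y. L * ?g y \<partial>lborel)) at_top"
  proof (rule integral_dominated_convergence_at_top[where w="\<lambda>y. C * ?g y"])
    show "integrable lborel (\<lambda>y. C * ?g y)"
      using integrable_Gamma_integrand(1)[OF \<alpha>1] by (rule integrable_mult_right)
    show "\<forall>\<^sub>F t in at_top. AE y in lborel. norm (?s t y) \<le> C * ?g y"
      using eventually_gt_at_top[of 0]
    proof eventually_elim
      case (elim t)
      have "norm (?s t y) \<le> C * ?g y" for y
      proof (cases "y \<ge> 0")
        case True
        have "exp (- y) * real (level_count (y * t)) \<le> exp (- y) * (C * (y * t) powr \<alpha>)"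
          using C by (intro mult_left_mono) auto
        then show ?thesis using True elim by (simp add: powr_mult field_simps)
      next
        case False
        then have "y * t < e 0" using elim e_pos by (smt (verit) mult_neg_pos)
        then show ?thesis using False by (simp add: level_count_eq_0)
      qed
      then show ?case by simp
    qed
    show "AE y in lborel. ((\<lambda>t. ?s t y) \<longlongrightarrow> L * ?g y) at_top"
      using AE_lborel_singleton[of 0]
    proof eventually_elim
      case (elim y)
      show ?case
      proof (cases "y > 0")
        case True
        have "filterlim (\<lambda>t. y * t) at_top at_top"
          using True by (intro filterlim_tendsto_pos_mult_at_top[OF tendsto_const _ filterlim_ident])
        from filterlim_compose[OF level_count_tendsto this]
        have "((\<lambda>t. exp (- y) * y powr \<alpha> * (real (level_count (y * t)) / (y * t) powr \<alpha>)) \<longlongrightarrow> exp (- y) * y powr \<alpha> * L) at_top"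
          by (rule tendsto_mult_left)
        then have "((\<lambda>t. ?s t y) \<longlongrightarrow> exp (- y) * y powr \<alpha> * L) at_top"
        proof (rule Lim_transform_eventually)
          show "\<forall>\<^sub>F t in at_top. exp (- y) * y powr \<alpha> * (real (level_count (y * t)) / (y * t) powr \<alpha>) = ?s t y"
            using eventually_gt_at_top[of 0]
            by eventually_elim (use True in \<open>simp add: powr_mult field_simps\<close>)
        qed
        then show ?thesis using True by (simp add: mult_ac)
      next
        case False
        have "\<forall>\<^sub>F t in at_top. ?s t y = 0"
          using eventually_gt_at_top[of 0]
        proof eventually_elim
          fix t :: real assume "0 < t"
          then have "y * t < e 0" using False elim e_pos by (smt (verit) mult_neg_pos)
          then show "?s t y = 0" by (simp add: level_count_eq_0)
        qed
        then show ?thesis using False elim by (simp add: tendsto_eventually)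
      qed
    qed
  qed auto
  then have "((\<lambda>t. \<integral>y. ?s t y \<partial>lborel) \<longlongrightarrow> L * Gamma (\<alpha> + 1)) at_top"
    using integrable_Gamma_integrand(2)[OF \<alpha>1] by simp
  from filterlim_compose[OF this filterlim_inverse_at_top_right]
  show ?thesis
  proof (rule Lim_transform_eventually)
    show "\<forall>\<^sub>F x in at_right 0. (\<integral>y. ?s (inverse x) y \<partial>lborel) = x powr \<alpha> * laplace x"
      using eventually_at_right_less[of 0]
    proof eventually_elim
      case (elim x)
      have "(\<integral>y. ?s (inverse x) y \<partial>lborel) = (\<integral>y. x powr \<alpha> * (exp (- y) * real (level_count (y / x))) \<partial>lborel)"
        by (rule Bochner_Integration.integral_cong)
           (use elim in \<open>auto simp: powr_minus inverse_eq_divide powr_divide field_simps\<close>)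
      also have "\<dots> = x powr \<alpha> * laplace x"
        using elim laplace_sums(2)[of x] by simp
      finally show ?case .
    qed
  qed
qed

text \<open>At least \<open>j + 1\<close> gaps do not exceed \<open>e\<^sub>j\<close>, so \<open>e\<^sub>j\<close> is at least of order \<open>j\<^sup>1\<^sup>/\<^sup>\<alpha>\<close>.\<close>

lemma summable_inverse_square_gaps:
  assumes "\<alpha> < 2"
  shows "summable (\<lambda>j. 1 / (e j)\<^sup>2)"
proof -
  from level_count_le_powr[OF order_refl] obtain C where C: "C > 0" "\<And>x. real (level_count x) \<le> C * x powr \<alpha>" by blast
  have le: "norm (1 / (e j)\<^sup>2) \<le> C powr (2 / \<alpha>) * real (Suc j) powr (- (2 / \<alpha>))" for j
  proof -
    have "card {..j} \<le> level_count (e j)"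
      unfolding level_count_def using monoD[OF e_mono] by (intro card_mono finite_levels) auto
    then have "real (Suc j) \<le> C * e j powr \<alpha>" using C(2)[of "e j"] by simp
    then have "real (Suc j) powr (2 / \<alpha>) \<le> (C * e j powr \<alpha>) powr (2 / \<alpha>)"
      using \<alpha>_ge by (intro powr_mono2) auto
    also have "\<dots> = C powr (2 / \<alpha>) * (e j)\<^sup>2"
      using C(1) e_gt_0[of j] \<alpha>_ge by (simp add: powr_mult powr_powr powr_numeral)
    finally show ?thesis using e_gt_0[of j] by (simp add: powr_minus divide_simps mult_ac)
  qed
  have "summable (\<lambda>j. C powr (2 / \<alpha>) * real (Suc j) powr (- (2 / \<alpha>)))"
  proof (rule summable_mult)
    have "summable (\<lambda>j. real j powr (- (2 / \<alpha>)))"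
      using assms \<alpha>_ge by (simp add: summable_real_powr_iff)
    then show "summable (\<lambda>j. real (Suc j) powr (- (2 / \<alpha>)))" by (rule summable_Suc_iff[THEN iffD2])
  qed
  then show ?thesis by (rule summable_comparison_test'[where N=0, OF _ le])
qed

end

lemma harm_le_1_ln: "0 < n \<Longrightarrow> harm n \<le> 1 + ln (real n)"
proof -
  assume "0 < n"
  then obtain k where k: "n = Suc k" by (cases n) auto
  have "harm (Suc k) - ln (real (Suc k)) \<le> harm (Suc 0) - ln (real (Suc 0))"
    using decseqD[OF decseq_harm_diff_ln, of 0 k] by simp
  then show ?thesis by (simp add: k harm_expand)
qed

lemma inverse_square_tail:
  fixes K :: nat
  shows "summable (\<lambda>k. 1 / (real (Suc (k + K)))\<^sup>2)" "(\<Sum>k. 1 / (real (Suc (k + K)))\<^sup>2) \<le> 2 / real (Suc K)"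
proof -
  let ?g = "\<lambda>k. 1 / real (Suc (k + K))"
  have "?g \<longlonglongrightarrow> 0"
    using LIMSEQ_ignore_initial_segment[OF LIMSEQ_inverse_real_of_nat, of K] by (simp add: inverse_eq_divide)
  from telescope_sums'[OF this] have t: "(\<lambda>k. ?g k - ?g (Suc k)) sums (1 / real (Suc K))" by simp
  have "1 / (real (Suc (k + K)))\<^sup>2 \<le> 2 * (?g k - ?g (Suc k))" for k
  proof -
    define a where "a = real (Suc (k + K))"
    have a: "1 \<le> a" "real (Suc (Suc k + K)) = a + 1" by (auto simp: a_def)
    have "2 * (1 / a - 1 / (a + 1)) - 1 / a\<^sup>2 = (a - 1) / (a\<^sup>2 * (a + 1))"
 
      using a(1) by (simp add: divide_simps power2_eq_square)
    moreover have "\<dots> \<ge> 0" using a by simp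
    ultimately show ?thesis unfolding a(2) a_def[symmetric] by linarith
  qed
  note le = this
  have t2: "(\<lambda>k. 2 * (?g k - ?g (Suc k))) sums (2 / real (Suc K))" using sums_mult[OF t, of 2] by simp
  show s: "summable (\<lambda>k. 1 / (real (Suc (k + K)))\<^sup>2)"
    by (rule summable_comparison_test_ev[OF _ sums_summable[OF t2]]) (use le in simp)
  show "(\<Sum>k. 1 / (real (Suc (k + K)))\<^sup>2) \<le> 2 / real (Suc K)"
    using suminf_le[OF le s sums_summable[OF t2]] t2 by (simp add: sums_iff)
qed

text \<open>For small \<open>\<delta>\<close>, the about \<open>\<delta> / x\<close> terms with \<open>k x \<le> \<delta>\<close> have \<open>F (k x)\<close> close to \<open>l\<close>, and their weights \<open>1 / k\<close> add up
  to \<open>ln (1 / x)\<close> up to a bounded error. The decay of \<open>F\<close> keeps the sum of the other terms bounded.\<close>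

lemma harmonic_average_tendsto:
  fixes F :: "real \<Rightarrow> real"
  assumes F0: "\<And>x. 0 < x \<Longrightarrow> 0 \<le> F x" and decay: "\<And>x. 0 < x \<Longrightarrow> F x \<le> C / x"
    and lim: "(F \<longlongrightarrow> l) (at_right 0)"
  shows "((\<lambda>x. (\<Sum>k. F (real (Suc k) * x) / real (Suc k)) / ln (1 / x)) \<longlongrightarrow> l) (at_right 0)"
proof (rule tendstoI)
  fix \<epsilon>0 :: real assume \<epsilon>0: "0 < \<epsilon>0"
  define \<epsilon> where "\<epsilon> = \<epsilon>0 / 3"
  have \<epsilon>: "0 < \<epsilon>" using \<epsilon>0 by (simp add: \<epsilon>_def)
  have C: "0 \<le> C" using F0[of 1] decay[of 1] by simp
  have "\<forall>\<^sub>F x in at_right 0. \<bar>F x - l\<bar> < \<epsilon>" using tendstoD[OF lim \<epsilon>] by (simp add: dist_real_def)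
  then obtain \<delta>0 where \<delta>0: "0 < \<delta>0" "\<And>x. 0 < x \<Longrightarrow> x < \<delta>0 \<Longrightarrow> \<bar>F x - l\<bar> < \<epsilon>"
    unfolding eventually_at_right_field by auto
  define \<delta> where "\<delta> = min (\<delta>0 / 2) (1/2)"
  have \<delta>: "0 < \<delta>" "\<delta> < 1" "\<And>x. 0 < x \<Longrightarrow> x \<le> \<delta> \<Longrightarrow> \<bar>F x - l\<bar> < \<epsilon>"
    using \<delta>0 by (auto simp: \<delta>_def)
  define D where "D = \<epsilon> + 2 * C / \<delta> + \<bar>l\<bar> * (1 + ln (1 / \<delta>))"
  define A where "A x = (\<Sum>k. F (real (Suc k) * x) / real (Suc k))" for x
  have main: "\<bar>A x - l * ln (1 / x)\<bar> \<le> \<epsilon> * ln (1 / x) + D" if x: "0 < x" "x < \<delta>" for x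
  proof -
    \<comment> \<open>the terms before index \<open>K\<close> are those whose argument is at most \<open>\<delta>\<close>\<close>
    define K where "K = nat \<lfloor>\<delta> / x\<rfloor>"
    have Kx: "real K \<le> \<delta> / x" "\<delta> / x < real K + 1"
      using x \<delta>(1) unfolding K_def by (auto simp: le_nat_floor of_nat_floor)
    have "1 \<le> \<delta> / x" using x by simp
    then have K: "0 < K" using Kx(2) by (cases K) auto
    let ?a = "\<lambda>k. F (real (Suc k) * x) / real (Suc k)"
    have a_le: "?a k \<le> C / x * (1 / (real (Suc k))\<^sup>2)" for k
    proof -
      have "?a k \<le> C / (real (Suc k) * x) / real (Suc k)"
        using x by (intro divide_right_mono decay) auto
      then show ?thesis by (simp add: power2_eq_square field_simps)
    qed
    have a0: "0 \<le> ?a k" for k using x by (intro divide_nonneg_pos F0) auto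
    have sa: "summable ?a"
    proof (rule summable_comparison_test'[where N=0])
      show "summable (\<lambda>k. C / x * (1 / (real (Suc k))\<^sup>2))"
        using summable_mult[OF inverse_square_tail(1)[of 0], of "C / x"] by simp
      show "norm (?a k) \<le> C / x * (1 / (real (Suc k))\<^sup>2)" for k
        unfolding real_norm_def abs_of_nonneg[OF a0] by (rule a_le)
    qed
    have split: "A x = (\<Sum>k. ?a (k + K)) + (\<Sum>k<K. ?a k)"
      unfolding A_def by (rule suminf_split_initial_segment[OF sa])
    have "(\<Sum>k. ?a (k + K)) \<le> (\<Sum>k. C / x * (1 / (real (Suc (k + K)))\<^sup>2))"
      by (intro suminf_le a_le summable_ignore_initial_segment[OF sa] summable_mult inverse_square_tail)
    also have "\<dots> = C / x * (\<Sum>k. 1 / (real (Suc (k + K)))\<^sup>2)"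
      by (rule suminf_mult[OF inverse_square_tail(1)])
    also have "\<dots> \<le> C / x * (2 / real (Suc K))"
      using C x by (intro mult_left_mono inverse_square_tail(2)) auto
    also have "\<dots> \<le> C / x * (2 / (\<delta> / x))"
      using C x Kx \<delta>(1) by (intro mult_left_mono divide_left_mono) auto
    also have "\<dots> = 2 * C / \<delta>" using x by simp
    finally have tail: "(\<Sum>k. ?a (k + K)) \<le> 2 * C / \<delta>" .
    have tail0: "0 \<le> (\<Sum>k. ?a (k + K))"
      by (intro suminf_nonneg summable_ignore_initial_segment[OF sa] a0)
    have harm: "harm K = (\<Sum>k<K. 1 / real (Suc k))" by (simp add: harm_altdef inverse_eq_divide)
    have "\<bar>(\<Sum>k<K. ?a k) - l * harm K\<bar> = \<bar>\<Sum>k<K. (F (real (Suc k) * x) - l) / real (Suc k)\<bar>"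
      by (simp add: harm sum_distrib_left sum_subtractf diff_divide_distrib)
    also have "\<dots> \<le> (\<Sum>k<K. \<epsilon> / real (Suc k))"
    proof (rule order_trans[OF sum_abs sum_mono])
      fix k assume "k \<in> {..<K}"
      then have "real (Suc k) * x \<le> real K * x" using x by (intro mult_right_mono) auto
      also have "\<dots> \<le> \<delta>" using Kx(1) x by (simp add: field_simps)
      finally have "\<bar>F (real (Suc k) * x) - l\<bar> < \<epsilon>" using x by (intro \<delta>(3)) auto
      then show "\<bar>(F (real (Suc k) * x) - l) / real (Suc k)\<bar> \<le> \<epsilon> / real (Suc k)"
        by (simp add: abs_divide divide_right_mono)
    qed
    also have "\<dots> = \<epsilon> * harm K" by (simp add: harm sum_distrib_left)
    finally have head: "\<bar>(\<Sum>k<K. ?a k) - l * harm K\<bar> \<le> \<epsilon> * harm K" .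
    have "harm K \<le> 1 + ln (real K)" using K by (rule harm_le_1_ln)
    also have "ln (real K) \<le> ln (1 / x)"
    proof -
      have "real K \<le> 1 / x" using Kx(1) \<delta>(2) x by (meson divide_right_mono less_imp_le order_trans)
      then show ?thesis using K x by (subst ln_le_cancel_iff) auto
    qed
    finally have h1: "harm K \<le> 1 + ln (1 / x)" by simp
    have "ln (1 / x) - ln (1 / \<delta>) = ln (\<delta> / x)" using x \<delta>(1) by (simp add: ln_div)
    also have "\<dots> \<le> ln (real K + 1)" using Kx(2) x \<delta>(1) by (subst ln_le_cancel_iff) auto
    also have "\<dots> \<le> harm K" by (rule ln_le_harm)
    finally have h2: "ln (1 / x) - ln (1 / \<delta>) \<le> harm K" .
    have ld: "0 \<le> ln (1 / \<delta>)" using \<delta> by simp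
    have "\<bar>l * harm K - l * ln (1 / x)\<bar> = \<bar>l\<bar> * \<bar>harm K - ln (1 / x)\<bar>"
      by (simp add: abs_mult[symmetric] right_diff_distrib)
    also have "\<dots> \<le> \<bar>l\<bar> * (1 + ln (1 / \<delta>))"
      using h1 h2 ld by (intro mult_left_mono) (auto simp: abs_le_iff)
    finally have "\<bar>l * harm K - l * ln (1 / x)\<bar> \<le> \<bar>l\<bar> * (1 + ln (1 / \<delta>))" .
    moreover have "\<epsilon> * harm K \<le> \<epsilon> * (1 + ln (1 / x))" using h1 \<epsilon> by (intro mult_left_mono) auto
    then have "\<epsilon> * harm K \<le> \<epsilon> + \<epsilon> * ln (1 / x)" by (simp add: distrib_left)
    ultimately show ?thesis
      using tail tail0 head unfolding split D_def by linarith
  qed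
  have "filterlim (\<lambda>x::real. ln (1 / x)) at_top (at_right 0)"
    using filterlim_compose[OF ln_at_top filterlim_inverse_at_top_right] by (simp add: inverse_eq_divide)
  then have "\<forall>\<^sub>F x in at_right 0. max 1 (D / \<epsilon>) < ln (1 / x)"
    by (simp only: filterlim_at_top_dense)
  moreover have "\<forall>\<^sub>F x in at_right 0. 0 < x \<and> x < \<delta>"
    using \<delta>(1) by (auto simp: eventually_at_right_field intro: exI[of _ \<delta>])
  ultimately show "\<forall>\<^sub>F x in at_right 0. dist ((\<Sum>k. F (real (Suc k) * x) / real (Suc k)) / ln (1 / x)) l < \<epsilon>0"
  proof eventually_elim
    case (elim x)
    define M where "M = ln (1 / x)"
    have M: "1 < M" "D / \<epsilon> < M" using elim by (auto simp: M_def)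
    have "A x / M - l = (A x - l * M) / M" using M by (simp add: diff_divide_distrib)
    then have "\<bar>A x / M - l\<bar> = \<bar>A x - l * M\<bar> / M" using M by (simp add: abs_divide)
    also have "\<dots> \<le> (\<epsilon> * M + D) / M"
    proof (rule divide_right_mono)
      show "\<bar>A x - l * M\<bar> \<le> \<epsilon> * M + D" unfolding M_def using main[of x] elim by blast
      show "0 \<le> M" using M by simp
    qed
    also have "\<dots> < 3 * \<epsilon>"
    proof -
      have "D < \<epsilon> * M" using M(2) \<epsilon> by (simp add: field_simps)
      moreover have "0 < \<epsilon> * M" using \<epsilon> M by simp
      ultimately have "\<epsilon> * M + D < 3 * (\<epsilon> * M)" by linarith
      then have "\<epsilon> * M + D < 3 * \<epsilon> * M" by simp
      then show ?thesis using M(1) by (subst pos_divide_less_eq) auto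
    qed
    finally show ?case by (simp add: A_def M_def dist_real_def \<epsilon>_def)
  qed
qed

lemma sums_swap_nonneg:
  fixes f :: "nat \<Rightarrow> nat \<Rightarrow> real"
  assumes f: "\<And>j k. 0 \<le> f j k" and a: "\<And>j. f j sums a j" and b: "\<And>k. (\<lambda>j. f j k) sums b k"
    and s: "summable b"
  shows "a sums (suminf b)"
proof -
  have a0: "0 \<le> a j" for j using a[of j] f by (metis sums_iff suminf_nonneg)
  have b0: "0 \<le> b k" for k using b[of k] f by (metis sums_iff suminf_nonneg)
  have "(\<Sum>j. ennreal (a j)) = (\<Sum>j. \<Sum>k. ennreal (f j k))"
    using a f by (simp add: suminf_ennreal2 sums_iff)
  also have "\<dots> = (\<Sum>k. \<Sum>j. ennreal (f j k))"
  proof -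
    have "(\<Sum>j. \<Sum>k. ennreal (f j k)) = (\<Sum>j. \<integral>\<^sup>+k. ennreal (f j k) \<partial>count_space UNIV)"
      by (simp add: nn_integral_count_space_nat)
    also have "\<dots> = (\<integral>\<^sup>+k. (\<Sum>j. ennreal (f j k)) \<partial>count_space UNIV)"
      by (rule nn_integral_suminf[symmetric]) auto
    finally show ?thesis by (simp add: nn_integral_count_space_nat)
  qed
  also have "\<dots> = (\<Sum>k. ennreal (b k))"
    using b f by (simp add: suminf_ennreal2 sums_iff)
  also have "\<dots> = ennreal (suminf b)" using b0 s by (rule suminf_ennreal2)
  finally have eq: "(\<Sum>j. ennreal (a j)) = ennreal (suminf b)" .
  have sa: "summable a" by (rule summable_suminf_not_top[OF a0]) (simp add: eq)
  have "ennreal (suminf a) = ennreal (suminf b)" using eq suminf_ennreal2[OF a0 sa] by simp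
  then have "suminf a = suminf b"
    by (rule ennreal_inj[THEN iffD1, rotated 2]) (auto intro!: suminf_nonneg a0 b0 sa s)
  with sa show ?thesis by (simp add: sums_iff)
qed

context level_gaps
begin

text \<open>The Bose-Einstein mean occupation number.\<close>

definition occ :: "real \<Rightarrow> nat \<Rightarrow> real" where
  "occ \<beta> j = 1 / (exp (\<beta> * e j) - 1)"

text \<open>The expansions \<open>m = \<Sum>k\<ge>1. q\<^sup>k\<close> and \<open>m + m\<^sup>2 = \<Sum>k\<ge>1. k q\<^sup>k\<close> for \<open>m = q / (1 - q)\<close> turn the mean and the variance
  of the number of excited particles into these sums with \<open>r = 0\<close> and \<open>r = 1\<close>.\<close>

definition weighted_laplace :: "real \<Rightarrow> real \<Rightarrow> real" where
  "weighted_laplace r x = (\<Sum>k. real (Suc k) powr r * laplace (real (Suc k) * x))"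

lemma occ_pos: "0 < \<beta> \<Longrightarrow> 0 < occ \<beta> j"
  using e_gt_0[of j] by (simp add: occ_def)

lemma summable_weighted_laplace:
  assumes "0 < x" "r \<le> 1"
  shows "summable (\<lambda>k. real (Suc k) powr r * laplace (real (Suc k) * x))"
proof -
  have "\<alpha> + 2 \<ge> \<alpha>" by simp
  from laplace_le[OF this] obtain C where C: "C > 0" "\<And>x. 0 < x \<Longrightarrow> x powr (\<alpha> + 2) * laplace x \<le> C" by blast
  have le: "norm (real (Suc k) powr r * laplace (real (Suc k) * x)) \<le> C / x powr (\<alpha> + 2) * real (Suc k) powr (r - (\<alpha> + 2))" for k
  proof -
    let ?y = "real (Suc k) * x"
    have y: "0 < ?y" using assms by simp
    have "laplace ?y \<le> C / ?y powr (\<alpha> + 2)" using C(2)[OF y] y by (simp add: field_simps)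
    then have "real (Suc k) powr r * laplace ?y \<le> real (Suc k) powr r * (C / ?y powr (\<alpha> + 2))"
      by (intro mult_left_mono) auto
    also have "\<dots> = C / x powr (\<alpha> + 2) * (real (Suc k) powr r / real (Suc k) powr (\<alpha> + 2))"
      using assms by (simp add: powr_mult mult_ac)
    also have "real (Suc k) powr r / real (Suc k) powr (\<alpha> + 2) = real (Suc k) powr (r - (\<alpha> + 2))"
      by (rule powr_diff[symmetric])
    finally show ?thesis using laplace_nonneg[OF y] by simp
  qed
  have "summable (\<lambda>k. real k powr (r - (\<alpha> + 2)))"
    using assms \<alpha>_ge by (simp add: summable_real_powr_iff)
  then have "summable (\<lambda>k. C / x powr (\<alpha> + 2) * real (Suc k) powr (r - (\<alpha> + 2)))"
    by (intro summable_mult summable_Suc_iff[THEN iffD2])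
  then show ?thesis by (rule summable_comparison_test'[where N=0]) (use le in simp)
qed

lemma exp_gap:
  assumes "0 < \<beta>"
  shows "0 < exp (- \<beta> * e j)" "exp (- \<beta> * e j) < 1"
    "occ \<beta> j = exp (- \<beta> * e j) / (1 - exp (- \<beta> * e j))"
    "occ \<beta> j + (occ \<beta> j)\<^sup>2 = exp (- \<beta> * e j) / (1 - exp (- \<beta> * e j))\<^sup>2"
proof -
  define q where "q = exp (- \<beta> * e j)"
  have q: "0 < q" "q < 1" using assms e_gt_0[of j] by (auto simp: q_def)
  have "exp (\<beta> * e j) = 1 / q" by (simp add: q_def exp_minus inverse_eq_divide)
  then have "occ \<beta> j = 1 / (1 / q - 1)" by (simp only: occ_def)
  also have "\<dots> = q / (1 - q)" using q by (simp add: divide_simps)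
  finally have m: "occ \<beta> j = q / (1 - q)" .
  moreover have "q / (1 - q) + (q / (1 - q))\<^sup>2 = q / (1 - q)\<^sup>2"
    using q by (simp add: divide_simps power2_eq_square) (simp add: algebra_simps)
  ultimately show "0 < exp (- \<beta> * e j)" "exp (- \<beta> * e j) < 1"
    "occ \<beta> j = exp (- \<beta> * e j) / (1 - exp (- \<beta> * e j))"
    "occ \<beta> j + (occ \<beta> j)\<^sup>2 = exp (- \<beta> * e j) / (1 - exp (- \<beta> * e j))\<^sup>2"
    unfolding q_def[symmetric] using q by simp_all
qed

lemma laplace_summand_sums:
  assumes "0 < \<beta>"
  shows "(\<lambda>j. exp (- \<beta> * e j) ^ Suc k) sums laplace (real (Suc k) * \<beta>)"
proof -
  have "0 < real (Suc k) * \<beta>" using assms by simp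
  from summable_sums[OF laplace_sums(1)[OF this]]
  have "(\<lambda>j. exp (- (real (Suc k) * \<beta>) * e j)) sums laplace (real (Suc k) * \<beta>)"
    by (simp add: laplace_def)
  moreover have "exp (- (real (Suc k) * \<beta>) * e j) = exp (- \<beta> * e j) ^ Suc k" for j
    by (subst exp_of_nat_mult[symmetric]) (simp add: mult_ac)
  ultimately show ?thesis by simp
qed

lemma occ_sums:
  assumes "0 < \<beta>"
  shows "occ \<beta> sums weighted_laplace 0 \<beta>"
proof -
  have "occ \<beta> sums (\<Sum>k. laplace (real (Suc k) * \<beta>))"
  proof (rule sums_swap_nonneg[where f="\<lambda>j k. exp (- \<beta> * e j) ^ Suc k"])
    show "(\<lambda>k. exp (- \<beta> * e j) ^ Suc k) sums occ \<beta> j" for j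
      using sums_mult[OF geometric_sums[of "exp (- \<beta> * e j)"], of "exp (- \<beta> * e j)"] exp_gap[OF assms, of j]
      by simp
    show "summable (\<lambda>k. laplace (real (Suc k) * \<beta>))"
      using summable_weighted_laplace[OF assms, of 0] by simp
  qed (use laplace_summand_sums[OF assms] in auto)
  then show ?thesis by (simp add: weighted_laplace_def)
qed

lemma occ_variance_sums:
  assumes "0 < \<beta>"
  shows "(\<lambda>j. occ \<beta> j + (occ \<beta> j)\<^sup>2) sums weighted_laplace 1 \<beta>"
proof -
  have "(\<lambda>j. occ \<beta> j + (occ \<beta> j)\<^sup>2) sums (\<Sum>k. real (Suc k) * laplace (real (Suc k) * \<beta>))"
  proof (rule sums_swap_nonneg[where f="\<lambda>j k. real (Suc k) * exp (- \<beta> * e j) ^ Suc k"])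
    show "(\<lambda>k. real (Suc k) * exp (- \<beta> * e j) ^ Suc k) sums (occ \<beta> j + (occ \<beta> j)\<^sup>2)" for j
      using sums_mult[OF geometric_deriv_sums[of "exp (- \<beta> * e j)"], of "exp (- \<beta> * e j)"] exp_gap[OF assms, of j]
      by (simp add: mult_ac)
    show "(\<lambda>j. real (Suc k) * exp (- \<beta> * e j) ^ Suc k) sums (real (Suc k) * laplace (real (Suc k) * \<beta>))" for k
      by (rule sums_mult[OF laplace_summand_sums[OF assms]])
    show "summable (\<lambda>k. real (Suc k) * laplace (real (Suc k) * \<beta>))"
      using summable_weighted_laplace[OF assms, of 1] by simp
  qed auto
  then show ?thesis by (simp add: weighted_laplace_def)
qed

lemma occ_le:
  assumes "0 < \<beta>"
  shows "occ \<beta> j \<le> 1 / (\<beta> * e j)"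
proof -
  have x: "0 < \<beta> * e j" using assms e_gt_0 by simp
  have "\<beta> * e j \<le> exp (\<beta> * e j) - 1" using exp_ge_add_one_self[of "\<beta> * e j"] by linarith
  then show ?thesis unfolding occ_def using x by (intro divide_left_mono) auto
qed

lemma occ_variance_le:
  assumes "0 < \<beta>"
  shows "occ \<beta> j + (occ \<beta> j)\<^sup>2 \<le> 2 / (\<beta> * e j)\<^sup>2"
proof -
  define x where "x = \<beta> * e j"
  have x: "0 < x" using assms e_gt_0 by (simp add: x_def)
  \<comment> \<open>this bound on the mean keeps the variance below \<open>2 / x\<^sup>2\<close> for large \<open>x\<close> as well as for small \<open>x\<close>\<close>
  have "x * (1 + x) / 2 \<le> exp x - 1"
  proof -
    have "x * (1 + x) / 2 = x / 2 + x\<^sup>2 / 2" by (simp add: power2_eq_square distrib_left add_divide_distrib)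
    then show ?thesis using exp_lower_Taylor_quadratic[of x] x by linarith
  qed
  then have "occ \<beta> j \<le> 1 / (x * (1 + x) / 2)"
    unfolding occ_def x_def[symmetric] using x by (intro divide_left_mono) auto
  moreover have "1 + occ \<beta> j \<le> (1 + x) / x"
    using occ_le[OF assms, of j] x by (simp add: x_def[symmetric] field_simps)
  ultimately have "occ \<beta> j * (1 + occ \<beta> j) \<le> 1 / (x * (1 + x) / 2) * ((1 + x) / x)"
    using occ_pos[OF assms, of j] x by (intro mult_mono) auto
  also have "\<dots> = 2 * (1 + x) / (x\<^sup>2 * (1 + x))" by (simp add: power2_eq_square mult_ac)
  also have "\<dots> = 2 / x\<^sup>2" using x by (intro mult_divide_mult_cancel_right) simp
  finally show ?thesis by (simp add: x_def power2_eq_square algebra_simps)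
qed

text \<open>With \<open>F(y) = y\<^sup>\<alpha> laplace y\<close>, a bounded function, the terms times \<open>x\<^sup>\<alpha>\<close> are \<open>k\<^sup>r\<^sup>-\<^sup>\<alpha> F(k x)\<close>. They are dominated by a
  multiple of \<open>k\<^sup>r\<^sup>-\<^sup>\<alpha>\<close>, and the limits of \<open>F(k x)\<close> are given by the Abelian theorem.\<close>

lemma weighted_laplace_powr_tendsto:
  assumes "r < \<alpha> - 1" "r \<le> 1"
  shows "((\<lambda>x. x powr \<alpha> * weighted_laplace r x) \<longlongrightarrow> L * Gamma (\<alpha> + 1) * zeta_real (\<alpha> - r)) (at_right 0)"
proof -
  from laplace_le[OF order_refl] obtain C where C: "C > 0" "\<And>x. 0 < x \<Longrightarrow> x powr \<alpha> * laplace x \<le> C" by blast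
  let ?F = "\<lambda>x. x powr \<alpha> * laplace x"
  let ?a = "\<lambda>k x. 1 / real (Suc k) powr (\<alpha> - r) * ?F (real (Suc k) * x)"
  have "summable (\<lambda>k. real k powr (- (\<alpha> - r)))" using assms by (simp add: summable_real_powr_iff)
  then have sz: "summable (\<lambda>k. 1 / real (Suc k) powr (\<alpha> - r))"
    by (subst (asm) summable_Suc_iff[symmetric]) (simp only: powr_minus_divide)
  have "((\<lambda>x. \<Sum>k. ?a k x) \<longlongrightarrow> (\<Sum>k. 1 / real (Suc k) powr (\<alpha> - r) * (L * Gamma (\<alpha> + 1)))) (at_right 0)"
  proof (rule tannerys_theorem[THEN conjunct2, THEN conjunct2])
    show "((\<lambda>x. ?a k x) \<longlongrightarrow> 1 / real (Suc k) powr (\<alpha> - r) * (L * Gamma (\<alpha> + 1))) (at_right 0)" for k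
    proof (rule tendsto_mult_left)
      have "filterlim (\<lambda>x. real (Suc k) * x) (at_right 0) (at_right 0)"
      proof (rule filterlim_at[THEN iffD2], intro conjI)
        show "((\<lambda>x. real (Suc k) * x) \<longlongrightarrow> 0) (at_right 0)"
          using tendsto_mult_right_zero[OF tendsto_ident_at] by blast
      qed (use eventually_at_right_less[of 0] in \<open>auto elim: eventually_mono\<close>)
      then show "((\<lambda>x. ?F (real (Suc k) * x)) \<longlongrightarrow> L * Gamma (\<alpha> + 1)) (at_right 0)"
        by (rule filterlim_compose[OF laplace_tendsto])
    qed
    have "\<forall>\<^sub>F x in at_right 0. \<forall>k. norm (?a k x) \<le> C / real (Suc k) powr (\<alpha> - r)"
      using eventually_at_right_less[of 0]
    proof eventually_elim
      case (elim x)
      show ?case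
      proof
        fix k
        have y: "0 < real (Suc k) * x" using elim by simp
        then have "norm (?a k x) = ?F (real (Suc k) * x) / real (Suc k) powr (\<alpha> - r)"
          using laplace_nonneg[OF y] by (simp add: abs_mult)
        also have "\<dots> \<le> C / real (Suc k) powr (\<alpha> - r)"
          using C(2)[OF y] by (intro divide_right_mono) auto
        finally show "norm (?a k x) \<le> C / real (Suc k) powr (\<alpha> - r)" .
      qed
    qed
    from eventually_prodI[OF eventually_True this]
    show "\<forall>\<^sub>F (k, x) in at_top \<times>\<^sub>F at_right 0. norm (?a k x) \<le> C / real (Suc k) powr (\<alpha> - r)"
      by (rule eventually_mono) auto
    show "summable (\<lambda>k. C / real (Suc k) powr (\<alpha> - r))"
      using summable_mult[OF sz, of C] by simp
  qed simp
  moreover have "(\<Sum>k. 1 / real (Suc k) powr (\<alpha> - r) * (L * Gamma (\<alpha> + 1))) = L * Gamma (\<alpha> + 1) * zeta_real (\<alpha> - r)"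
    unfolding zeta_real_def by (subst suminf_mult2[OF sz, symmetric]) (simp add: mult.commute)
  ultimately have "((\<lambda>x. \<Sum>k. ?a k x) \<longlongrightarrow> L * Gamma (\<alpha> + 1) * zeta_real (\<alpha> - r)) (at_right 0)" by simp
  then show ?thesis
  proof (rule Lim_transform_eventually)
    show "\<forall>\<^sub>F x in at_right 0. (\<Sum>k. ?a k x) = x powr \<alpha> * weighted_laplace r x"
      using eventually_at_right_less[of 0]
    proof eventually_elim
      case (elim x)
      have "?a k x = x powr \<alpha> * (real (Suc k) powr r * laplace (real (Suc k) * x))" for k
        using elim by (simp add: powr_mult powr_diff)
      then show ?case unfolding weighted_laplace_def
        by (simp only:) (rule suminf_mult, rule summable_weighted_laplace; use elim assms \<alpha>_ge in simp)
    qed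
  qed
qed

text \<open>At the exponent where the series for \<open>\<zeta>(\<alpha> - r)\<close> diverges the weights \<open>k\<^sup>r\<^sup>-\<^sup>\<alpha>\<close> are harmonic, whence a
  logarithm.\<close>

lemma weighted_laplace_log_tendsto:
  assumes "r = \<alpha> - 1" "r \<le> 1"
  shows "((\<lambda>x. x powr \<alpha> * weighted_laplace r x / ln (1 / x)) \<longlongrightarrow> L * Gamma (\<alpha> + 1)) (at_right 0)"
proof -
  let ?F = "\<lambda>x. x powr \<alpha> * laplace x"
  have "\<alpha> + 1 \<ge> \<alpha>" by simp
  from laplace_le[OF this] obtain C where C: "C > 0" "\<And>x. 0 < x \<Longrightarrow> x powr (\<alpha> + 1) * laplace x \<le> C" by blast
  have "((\<lambda>x. (\<Sum>k. ?F (real (Suc k) * x) / real (Suc k)) / ln (1 / x)) \<longlongrightarrow> L * Gamma (\<alpha> + 1)) (at_right 0)"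
  proof (rule harmonic_average_tendsto[OF _ _ laplace_tendsto])
    fix x :: real assume x: "0 < x"
    show "0 \<le> ?F x" using laplace_nonneg[OF x] by simp
    show "?F x \<le> C / x" using C(2)[OF x] x by (simp add: powr_add field_simps)
  qed
  then show ?thesis
  proof (rule Lim_transform_eventually)
    show "\<forall>\<^sub>F x in at_right 0. (\<Sum>k. ?F (real (Suc k) * x) / real (Suc k)) / ln (1 / x) = x powr \<alpha> * weighted_laplace r x / ln (1 / x)"
      using eventually_at_right_less[of 0]
    proof eventually_elim
      case (elim x)
      have "?F (real (Suc k) * x) / real (Suc k) = x powr \<alpha> * (real (Suc k) powr r * laplace (real (Suc k) * x))" for k
        using elim by (simp add: powr_mult powr_diff assms)
      moreover have "(\<Sum>k. x powr \<alpha> * (real (Suc k) powr r * laplace (real (Suc k) * x))) = x powr \<alpha> * weighted_laplace r x"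
        unfolding weighted_laplace_def using summable_weighted_laplace[OF elim assms(2)] by (rule suminf_mult)
      ultimately show ?case by simp
    qed
  qed
qed

end

section \<open>Random series with independent centred terms\<close>

locale independent_centered = prob_space +
  fixes Y :: "nat \<Rightarrow> 'a \<Rightarrow> real"
  assumes indep: "indep_vars (\<lambda>_. borel) Y UNIV"
    and square_integrable: "\<And>j. integrable M (\<lambda>\<omega>. (Y j \<omega>)\<^sup>2)"
    and centered: "\<And>j. expectation (Y j) = 0"
begin

abbreviation S :: "nat \<Rightarrow> 'a \<Rightarrow> real" where "S k \<omega> \<equiv> (\<Sum>j<k. Y j \<omega>)"

lemma measurable_Y [measurable]: "Y j \<in> borel_measurable M"
  using indep by (auto simp: indep_vars_def)

lemma integrable_Y: "integrable M (Y j)"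
  by (rule square_integrable_imp_integrable) (auto intro: square_integrable)

text \<open>The function \<open>g\<close> of the first \<open>k\<close> variables is independent of the later ones, which have mean 0.\<close>

lemma past_future_orthogonal:
  assumes g: "g \<in> borel_measurable (PiM {..<k} (\<lambda>_. borel))"
    and int: "integrable M (\<lambda>\<omega>. g (\<lambda>i\<in>{..<k}. Y i \<omega>))"
  shows "expectation (\<lambda>\<omega>. g (\<lambda>i\<in>{..<k}. Y i \<omega>) * (\<Sum>j\<in>{k..<n}. Y j \<omega>)) = 0"
    and "integrable M (\<lambda>\<omega>. g (\<lambda>i\<in>{..<k}. Y i \<omega>) * (\<Sum>j\<in>{k..<n}. Y j \<omega>))"
proof -
  let ?h = "\<lambda>y. \<Sum>j\<in>{k..<n}. y j :: real"
  have "indep_var (PiM {..<k} (\<lambda>_. borel)) (\<lambda>\<omega>. \<lambda>i\<in>{..<k}. Y i \<omega>) (PiM {k..<n} (\<lambda>_. borel)) (\<lambda>\<omega>. \<lambda>i\<in>{k..<n}. Y i \<omega>)"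
    by (rule indep_var_restrict[OF indep]) auto
  moreover have "?h \<in> borel_measurable (PiM {k..<n} (\<lambda>_. borel))" by measurable
  ultimately have "indep_var borel (g \<circ> (\<lambda>\<omega>. \<lambda>i\<in>{..<k}. Y i \<omega>)) borel (?h \<circ> (\<lambda>\<omega>. \<lambda>i\<in>{k..<n}. Y i \<omega>))"
    using indep_var_compose[OF _ g] by blast
  then have ind: "indep_var borel (\<lambda>\<omega>. g (\<lambda>i\<in>{..<k}. Y i \<omega>)) borel (\<lambda>\<omega>. \<Sum>j\<in>{k..<n}. Y j \<omega>)"
    by (simp add: comp_def)
  have int2: "integrable M (\<lambda>\<omega>. \<Sum>j\<in>{k..<n}. Y j \<omega>)" by (intro Bochner_Integration.integrable_sum integrable_Y)
  show "integrable M (\<lambda>\<omega>. g (\<lambda>i\<in>{..<k}. Y i \<omega>) * (\<Sum>j\<in>{k..<n}. Y j \<omega>))"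
    by (rule indep_var_integrable[OF ind int int2])
  have "expectation (\<lambda>\<omega>. \<Sum>j\<in>{k..<n}. Y j \<omega>) = 0" using centered by (simp add: integrable_Y)
  then show "expectation (\<lambda>\<omega>. g (\<lambda>i\<in>{..<k}. Y i \<omega>) * (\<Sum>j\<in>{k..<n}. Y j \<omega>)) = 0"
    using indep_var_lebesgue_integral[OF ind int int2] by simp
qed

lemma integrable_S: "integrable M (S k)"
  by (intro Bochner_Integration.integrable_sum integrable_Y)

lemma S_square: "integrable M (\<lambda>\<omega>. (S k \<omega>)\<^sup>2)" "expectation (\<lambda>\<omega>. (S k \<omega>)\<^sup>2) = (\<Sum>j<k. expectation (\<lambda>\<omega>. (Y j \<omega>)\<^sup>2))"
proof (induction k)
  case 0
  { case 1 show ?case by simp }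
  { case 2 show ?case by simp }
next
  case (Suc k)
  have g: "(\<lambda>y. \<Sum>j<k. y j) \<in> borel_measurable (PiM {..<k} (\<lambda>_. borel :: real measure))" by measurable
  have "integrable M (\<lambda>\<omega>. \<Sum>j<k. (\<lambda>i\<in>{..<k}. Y i \<omega>) j)" using integrable_S[of k] by simp
  note o = past_future_orthogonal[OF g this, of "Suc k"]
  have eq: "(S (Suc k) \<omega>)\<^sup>2 = (S k \<omega>)\<^sup>2 + 2 * (S k \<omega> * Y k \<omega>) + (Y k \<omega>)\<^sup>2" for \<omega>
    by (simp add: power2_eq_square algebra_simps)
  have o': "integrable M (\<lambda>\<omega>. S k \<omega> * Y k \<omega>)" "expectation (\<lambda>\<omega>. S k \<omega> * Y k \<omega>) = 0"
    using o by simp_all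
  { case 1 show ?case unfolding eq using Suc o' square_integrable by simp }
  { case 2 show ?case unfolding eq using Suc o' square_integrable by simp }
qed

text \<open>Let \<open>A k\<close> be the event that \<open>k\<close> is the first index with \<open>\<epsilon> \<le> \<bar>S k\<bar>\<close>. The increment \<open>S n - S k\<close> is orthogonal
  to \<open>S k\<close> restricted to \<open>A k\<close>, so the integral of \<open>(S n)\<^sup>2\<close> over \<open>A k\<close> is at least that of \<open>(S k)\<^sup>2\<close>, hence
  at least \<open>\<epsilon>\<^sup>2\<close> times the probability of \<open>A k\<close>.\<close>

lemma kolmogorov_maximal:
  assumes \<epsilon>: "0 < \<epsilon>"
  shows "prob {\<omega>\<in>space M. \<exists>k\<le>n. \<epsilon> \<le> \<bar>S k \<omega>\<bar>} \<le> (\<Sum>j<n. expectation (\<lambda>\<omega>. (Y j \<omega>)\<^sup>2)) / \<epsilon>\<^sup>2"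
proof -
  define A where "A k = {\<omega>\<in>space M. \<epsilon> \<le> \<bar>S k \<omega>\<bar> \<and> (\<forall>i\<in>{..<k}. \<bar>S i \<omega>\<bar> < \<epsilon>)}" for k
  have A[measurable]: "A k \<in> sets M" for k unfolding A_def by measurable
  have ex: "{\<omega>\<in>space M. \<exists>k\<le>n. \<epsilon> \<le> \<bar>S k \<omega>\<bar>} = (\<Union>k\<le>n. A k)"
  proof (intro equalityI subsetI)
    fix \<omega> assume \<omega>: "\<omega> \<in> {\<omega>\<in>space M. \<exists>k\<le>n. \<epsilon> \<le> \<bar>S k \<omega>\<bar>}"
    define k where "k = (LEAST k. \<epsilon> \<le> \<bar>S k \<omega>\<bar>)"
    from \<omega> obtain k' where k': "k' \<le> n" "\<epsilon> \<le> \<bar>S k' \<omega>\<bar>" by auto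
    have 1: "\<epsilon> \<le> \<bar>S k \<omega>\<bar>" unfolding k_def using k'(2) by (rule LeastI)
    have 2: "k \<le> k'" unfolding k_def using k'(2) by (rule Least_le)
    have 3: "\<bar>S i \<omega>\<bar> < \<epsilon>" if "i < k" for i using not_less_Least[OF that[unfolded k_def]] by simp
    have "\<omega> \<in> A k" unfolding A_def using \<omega> 1 3 by auto
    moreover have "k \<le> n" using 2 k'(1) by simp
    ultimately show "\<omega> \<in> (\<Union>k\<le>n. A k)" by blast
  qed (auto simp: A_def)
  have disj: "disjoint_family_on A {..n}"
    unfolding disjoint_family_on_def
  proof (intro ballI impI)
    fix k l :: nat assume "k \<noteq> l"
    then show "A k \<inter> A l = {}"
      by (cases "k < l") (auto simp: A_def not_less[symmetric] dest: bspec)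
  qed
  have key: "\<epsilon>\<^sup>2 * prob (A k) \<le> expectation (\<lambda>\<omega>. (S n \<omega>)\<^sup>2 * indicator (A k) \<omega>)" if "k \<le> n" for k
  proof -
    define g where "g y = (\<Sum>j<k. y j) * (if \<epsilon> \<le> \<bar>\<Sum>j<k. y j\<bar> \<and> (\<forall>i\<in>{..<k}. \<bar>\<Sum>j<i. y j\<bar> < \<epsilon>) then 1 else 0 :: real)" for y
    have "(\<lambda>y. \<Sum>j<i. y j) \<in> borel_measurable (PiM {..<k} (\<lambda>_. borel :: real measure))" if "i \<le> k" for i
      using that by (intro borel_measurable_sum measurable_component_singleton) auto
    note [measurable] = this this[OF order_refl]
    have "Measurable.pred (PiM {..<k} (\<lambda>_. borel :: real measure)) (\<lambda>y. \<forall>i\<in>{..<k}. \<bar>\<Sum>j<i. y j\<bar> < \<epsilon>)"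
      by (intro pred_intros_finite(3)) auto
    note [measurable] = this
    have g: "g \<in> borel_measurable (PiM {..<k} (\<lambda>_. borel))" unfolding g_def by measurable
    have rs: "(\<Sum>j<i. (\<lambda>i\<in>{..<k}. Y i \<omega>) j) = S i \<omega>" if "i \<le> k" for i \<omega>
      using that by (intro sum.cong) auto
    have g_eq: "g (\<lambda>i\<in>{..<k}. Y i \<omega>) = S k \<omega> * indicator (A k) \<omega>" if "\<omega> \<in> space M" for \<omega>
      unfolding g_def A_def using that by (auto simp: rs indicator_def)
    have intA: "integrable M (\<lambda>\<omega>. f \<omega> * indicator (A k) \<omega>)" if "integrable M f" for f :: "'a \<Rightarrow> real"
      using that by (rule integrable_real_mult_indicator[OF A])
    have "integrable M (\<lambda>\<omega>. g (\<lambda>i\<in>{..<k}. Y i \<omega>))"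
      using intA[OF integrable_S[of k]] by (subst Bochner_Integration.integrable_cong[OF refl g_eq]) auto
    note o = past_future_orthogonal[OF g this, of n]
    let ?D = "\<lambda>\<omega>. \<Sum>j\<in>{k..<n}. Y j \<omega>"
    have o': "expectation (\<lambda>\<omega>. S k \<omega> * indicator (A k) \<omega> * ?D \<omega>) = 0" "integrable M (\<lambda>\<omega>. S k \<omega> * indicator (A k) \<omega> * ?D \<omega>)"
    proof -
      have "expectation (\<lambda>\<omega>. S k \<omega> * indicator (A k) \<omega> * ?D \<omega>) = expectation (\<lambda>\<omega>. g (\<lambda>i\<in>{..<k}. Y i \<omega>) * ?D \<omega>)"
        by (intro Bochner_Integration.integral_cong refl) (simp only: g_eq)
      then show "expectation (\<lambda>\<omega>. S k \<omega> * indicator (A k) \<omega> * ?D \<omega>) = 0" using o(1) by simp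
      have "integrable M (\<lambda>\<omega>. S k \<omega> * indicator (A k) \<omega> * ?D \<omega>) \<longleftrightarrow> integrable M (\<lambda>\<omega>. g (\<lambda>i\<in>{..<k}. Y i \<omega>) * ?D \<omega>)"
        by (intro Bochner_Integration.integrable_cong refl) (simp only: g_eq)
      then show "integrable M (\<lambda>\<omega>. S k \<omega> * indicator (A k) \<omega> * ?D \<omega>)" using o(2) by simp
    qed
    have SD: "S n \<omega> = S k \<omega> + ?D \<omega>" for \<omega>
    proof -
      have "{..<n} = {..<k} \<union> {k..<n}" using that by auto
      then show ?thesis by (simp add: sum.union_disjoint ivl_disj_int)
    qed
    have "\<epsilon>\<^sup>2 * prob (A k) = expectation (\<lambda>\<omega>. \<epsilon>\<^sup>2 * indicator (A k) \<omega>)" by simp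
    also have "\<dots> \<le> expectation (\<lambda>\<omega>. (S k \<omega>)\<^sup>2 * indicator (A k) \<omega>)"
    proof (rule integral_mono)
      show "integrable M (\<lambda>\<omega>. (S k \<omega>)\<^sup>2 * indicator (A k) \<omega>)" by (intro intA S_square)
      show "integrable M (\<lambda>\<omega>. \<epsilon>\<^sup>2 * indicator (A k) \<omega> :: real)" by (rule intA) simp
      show "\<epsilon>\<^sup>2 * indicator (A k) \<omega> \<le> (S k \<omega>)\<^sup>2 * indicator (A k) \<omega>" if "\<omega> \<in> space M" for \<omega>
        using \<epsilon> by (cases "\<omega> \<in> A k") (auto simp: A_def abs_le_square_iff[symmetric])
    qed
    also have "\<dots> = expectation (\<lambda>\<omega>. (S k \<omega>)\<^sup>2 * indicator (A k) \<omega> + 2 * (S k \<omega> * indicator (A k) \<omega> * ?D \<omega>))"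
      using o' intA[OF S_square(1)[of k]] by simp
    also have "\<dots> \<le> expectation (\<lambda>\<omega>. (S n \<omega>)\<^sup>2 * indicator (A k) \<omega>)"
    proof (rule integral_mono)
      show "integrable M (\<lambda>\<omega>. (S k \<omega>)\<^sup>2 * indicator (A k) \<omega> + 2 * (S k \<omega> * indicator (A k) \<omega> * ?D \<omega>))"
        using o' intA[OF S_square(1)[of k]] by simp
      show "integrable M (\<lambda>\<omega>. (S n \<omega>)\<^sup>2 * indicator (A k) \<omega>)" by (rule intA[OF S_square(1)])
      show "(S k \<omega>)\<^sup>2 * indicator (A k) \<omega> + 2 * (S k \<omega> * indicator (A k) \<omega> * ?D \<omega>) \<le> (S n \<omega>)\<^sup>2 * indicator (A k) \<omega>" for \<omega>
        unfolding SD by (cases "\<omega> \<in> A k") (auto simp: power2_sum)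
    qed
    finally show ?thesis .
  qed
  have "\<epsilon>\<^sup>2 * prob {\<omega>\<in>space M. \<exists>k\<le>n. \<epsilon> \<le> \<bar>S k \<omega>\<bar>} = (\<Sum>k\<le>n. \<epsilon>\<^sup>2 * prob (A k))"
    unfolding ex using disj by (subst finite_measure_finite_Union) (auto simp: sum_distrib_left)
  also have "\<dots> \<le> (\<Sum>k\<le>n. expectation (\<lambda>\<omega>. (S n \<omega>)\<^sup>2 * indicator (A k) \<omega>))"
    by (intro sum_mono key) auto
  also have "\<dots> = expectation (\<lambda>\<omega>. \<Sum>k\<le>n. (S n \<omega>)\<^sup>2 * indicator (A k) \<omega>)"
    by (rule Bochner_Integration.integral_sum[symmetric]) (rule integrable_real_mult_indicator[OF A S_square(1)])
  also have "\<dots> \<le> expectation (\<lambda>\<omega>. (S n \<omega>)\<^sup>2)"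
  proof (intro integral_mono Bochner_Integration.integrable_sum integrable_real_mult_indicator[OF A] S_square)
    fix \<omega>
    have "(\<Sum>k\<le>n. (S n \<omega>)\<^sup>2 * indicator (A k) \<omega>) = (S n \<omega>)\<^sup>2 * indicator (\<Union>k\<le>n. A k) \<omega>"
      using disj by (simp add: sum_distrib_left[symmetric] indicator_UN_disjoint)
    also have "\<dots> \<le> (S n \<omega>)\<^sup>2" by (auto simp: indicator_def)
    finally show "(\<Sum>k\<le>n. (S n \<omega>)\<^sup>2 * indicator (A k) \<omega>) \<le> (S n \<omega>)\<^sup>2" .
  qed
  also have "\<dots> = (\<Sum>j<n. expectation (\<lambda>\<omega>. (Y j \<omega>)\<^sup>2))" by (rule S_square)
  finally show ?thesis using \<epsilon> by (simp add: pos_le_divide_eq mult.commute)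
qed

end

lemma (in independent_centered) independent_centered_shift: "independent_centered M (\<lambda>j. Y (j + m))"
proof
  have "indep_vars (\<lambda>j. PiM {j + m} (\<lambda>_. borel)) (\<lambda>j \<omega>. restrict (\<lambda>i. Y i \<omega>) {j + m}) UNIV"
    by (rule indep_vars_restrict[OF indep]) (auto simp: disjoint_family_on_def)
  from indep_vars_compose2[OF this, of "\<lambda>j y. y (j + m)" "\<lambda>_. borel"]
  show "indep_vars (\<lambda>_. borel) (\<lambda>j. Y (j + m)) UNIV"
    by (simp add: measurable_component_singleton)
qed (auto simp: square_integrable centered)

context independent_centered
begin

context
  assumes summable_variance: "summable (\<lambda>j. expectation (\<lambda>\<omega>. (Y j \<omega>)\<^sup>2))"
begin

definition tail :: "nat \<Rightarrow> real" where "tail m = (\<Sum>j. expectation (\<lambda>\<omega>. (Y (j + m) \<omega>)\<^sup>2))"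

lemma tail_tendsto_0: "tail \<longlonglongrightarrow> 0"
  unfolding tail_def
  using suminf_exist_split2[OF summable_variance] by simp

lemma sum_le_tail: "(\<Sum>j<n. expectation (\<lambda>\<omega>. (Y (j + m) \<omega>)\<^sup>2)) \<le> tail m"
  unfolding tail_def
  by (intro sum_le_suminf summable_ignore_initial_segment[OF summable_variance]) (auto intro: integral_nonneg)

lemma S_diff: "(\<Sum>j<k. Y (j + m) \<omega>) = S (k + m) \<omega> - S m \<omega>"
  by (induction k) auto

lemma prob_oscillation_le:
  assumes "0 < \<epsilon>"
  shows "prob {\<omega>\<in>space M. \<exists>k. \<epsilon> \<le> \<bar>S (k + m) \<omega> - S m \<omega>\<bar>} \<le> tail m / \<epsilon>\<^sup>2"
proof -
  interpret sh: independent_centered M "\<lambda>j. Y (j + m)" by (rule independent_centered_shift)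
  define B where "B n = {\<omega>\<in>space M. \<exists>k\<le>n. \<epsilon> \<le> \<bar>S (k + m) \<omega> - S m \<omega>\<bar>}" for n
  have B[measurable]: "B n \<in> sets M" for n
  proof -
    have "B n = {\<omega>\<in>space M. \<exists>k\<in>{..n}. \<epsilon> \<le> \<bar>S (k + m) \<omega> - S m \<omega>\<bar>}" by (auto simp: B_def)
    then show ?thesis by simp
  qed
  have "(\<lambda>n. prob (B n)) \<longlonglongrightarrow> prob (\<Union>n. B n)"
    by (rule finite_Lim_measure_incseq) (auto simp: B_def incseq_def, meson order_trans)
  moreover have "prob (B n) \<le> tail m / \<epsilon>\<^sup>2" for n
  proof -
    have "prob (B n) \<le> (\<Sum>j<n. expectation (\<lambda>\<omega>. (Y (j + m) \<omega>)\<^sup>2)) / \<epsilon>\<^sup>2"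
      using sh.kolmogorov_maximal[OF assms, of n] by (simp add: B_def S_diff)
    also have "\<dots> \<le> tail m / \<epsilon>\<^sup>2" by (intro divide_right_mono sum_le_tail) auto
    finally show ?thesis .
  qed
  ultimately have "prob (\<Union>n. B n) \<le> tail m / \<epsilon>\<^sup>2" by (intro LIMSEQ_le_const2) auto
  moreover have "(\<Union>n. B n) = {\<omega>\<in>space M. \<exists>k. \<epsilon> \<le> \<bar>S (k + m) \<omega> - S m \<omega>\<bar>}" by (auto simp: B_def)
  ultimately show ?thesis by simp
qed

text \<open>By the maximal inequality the partial sums after index \<open>m\<close> leave an \<open>\<epsilon>\<close>-neighbourhood of \<open>S m\<close> with
  probability at most \<open>tail m / \<epsilon>\<^sup>2\<close>. So almost surely they stay in such a neighbourhood for some \<open>m\<close>.\<close>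

theorem AE_summable: "AE \<omega> in M. summable (\<lambda>j. Y j \<omega>)"
proof -
  have "AE \<omega> in M. \<exists>m. \<forall>k. \<bar>S (k + m) \<omega> - S m \<omega>\<bar> < \<epsilon>" if \<epsilon>: "0 < \<epsilon>" for \<epsilon>
  proof -
    define B where "B m = {\<omega>\<in>space M. \<exists>k. \<epsilon> \<le> \<bar>S (k + m) \<omega> - S m \<omega>\<bar>}" for m
    have B[measurable]: "B m \<in> sets M" for m unfolding B_def by measurable
    have "prob (\<Inter>m. B m) \<le> tail m / \<epsilon>\<^sup>2" for m
      by (rule order_trans[OF finite_measure_mono prob_oscillation_le[OF \<epsilon>, of m]]) (auto simp: B_def[symmetric])
    moreover have "(\<lambda>m. tail m / \<epsilon>\<^sup>2) \<longlonglongrightarrow> 0"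
      using tendsto_divide[OF tail_tendsto_0 tendsto_const, of "\<epsilon>\<^sup>2"] \<epsilon> by simp
    ultimately have "prob (\<Inter>m. B m) \<le> 0" by (intro LIMSEQ_le_const) auto
    then have "prob (\<Inter>m. B m) = 0" by (simp add: measure_le_0_iff)
    then have "AE \<omega> in M. \<omega> \<notin> (\<Inter>m. B m)" by (subst (asm) prob_eq_0) auto
    then show ?thesis
      using AE_space by eventually_elim (auto simp: B_def not_le)
  qed
  then have "AE \<omega> in M. \<forall>i. \<exists>m. \<forall>k. \<bar>S (k + m) \<omega> - S m \<omega>\<bar> < inverse (real (Suc i))"
    unfolding AE_all_countable by simp
  then show ?thesis
  proof eventually_elim
    case (elim \<omega>)
    have "Cauchy (\<lambda>n. S n \<omega>)"
    proof (rule metric_CauchyI)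
      fix e :: real assume "0 < e"
      then obtain i where i: "inverse (real (Suc i)) < e / 2" using reals_Archimedean[of "e / 2"] by auto
      from elim obtain m where m: "\<And>k. \<bar>S (k + m) \<omega> - S m \<omega>\<bar> < inverse (real (Suc i))" by blast
      \<comment> \<open>all later partial sums are close to \<open>S m\<close>, hence to each other\<close>
      have d: "\<bar>S p \<omega> - S m \<omega>\<bar> < e / 2" if "p \<ge> m" for p
        using m[of "p - m"] i that by simp
      have "dist (S p \<omega>) (S q \<omega>) < e" if "p \<ge> m" "q \<ge> m" for p q
        using d[OF that(1)] d[OF that(2)] unfolding dist_real_def by linarith
      then show "\<exists>m. \<forall>p\<ge>m. \<forall>q\<ge>m. dist (S p \<omega>) (S q \<omega>) < e" by blast
    qed
    then show ?case by (simp add: summable_iff_convergent Cauchy_convergent_iff)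
  qed
qed

text \<open>Fatou's lemma carries the bound \<open>tail m\<close> on the mean square of \<open>S n - S m\<close> over to the limit.\<close>

theorem L2_convergence: "series_converges_L2 M Y (\<lambda>\<omega>. \<Sum>j. Y j \<omega>)"
proof -
  define T where "T \<omega> = (\<Sum>j. Y j \<omega>)" for \<omega>
  have T[measurable]: "T \<in> borel_measurable M" unfolding T_def by measurable
  have nn: "(\<integral>\<^sup>+\<omega>. ennreal ((S m \<omega> - T \<omega>)\<^sup>2) \<partial>M) \<le> ennreal (tail m)" for m
  proof -
    interpret sh: independent_centered M "\<lambda>j. Y (j + m)" by (rule independent_centered_shift)
    have "(\<integral>\<^sup>+\<omega>. ennreal ((S m \<omega> - T \<omega>)\<^sup>2) \<partial>M) = (\<integral>\<^sup>+\<omega>. liminf (\<lambda>k. ennreal ((S m \<omega> - S (k + m) \<omega>)\<^sup>2)) \<partial>M)"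
    proof (rule nn_integral_cong_AE)
      show "AE \<omega> in M. ennreal ((S m \<omega> - T \<omega>)\<^sup>2) = liminf (\<lambda>k. ennreal ((S m \<omega> - S (k + m) \<omega>)\<^sup>2))"
        using AE_summable
      proof eventually_elim
        case (elim \<omega>)
        have "(\<lambda>k. S k \<omega>) \<longlonglongrightarrow> T \<omega>" unfolding T_def by (rule summable_LIMSEQ[OF elim])
        then have "(\<lambda>k. S (k + m) \<omega>) \<longlonglongrightarrow> T \<omega>" by (rule LIMSEQ_ignore_initial_segment)
        then have "(\<lambda>k. ennreal ((S m \<omega> - S (k + m) \<omega>)\<^sup>2)) \<longlonglongrightarrow> ennreal ((S m \<omega> - T \<omega>)\<^sup>2)"
          by (intro tendsto_intros)
        then show ?case by (rule lim_imp_Liminf[OF trivial_limit_sequentially, symmetric])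
      qed
    qed
    also have "\<dots> \<le> liminf (\<lambda>k. \<integral>\<^sup>+\<omega>. ennreal ((S m \<omega> - S (k + m) \<omega>)\<^sup>2) \<partial>M)"
      by (rule nn_integral_liminf) auto
    also have "\<dots> \<le> limsup (\<lambda>k. \<integral>\<^sup>+\<omega>. ennreal ((S m \<omega> - S (k + m) \<omega>)\<^sup>2) \<partial>M)"
      by (rule Liminf_le_Limsup) simp
    also have "\<dots> \<le> ennreal (tail m)"
    proof (rule Limsup_bounded[OF always_eventually[OF allI]])
      fix k
      have "(\<integral>\<^sup>+\<omega>. ennreal ((S m \<omega> - S (k + m) \<omega>)\<^sup>2) \<partial>M) = (\<integral>\<^sup>+\<omega>. ennreal ((\<Sum>j<k. Y (j + m) \<omega>)\<^sup>2) \<partial>M)"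
        by (simp add: S_diff power2_commute)
      also have "\<dots> = ennreal (expectation (\<lambda>\<omega>. (\<Sum>j<k. Y (j + m) \<omega>)\<^sup>2))"
        by (rule nn_integral_eq_integral) (auto intro: sh.S_square)
      also have "\<dots> \<le> ennreal (tail m)"
        unfolding sh.S_square by (intro ennreal_leI sum_le_tail)
      finally show "(\<integral>\<^sup>+\<omega>. ennreal ((S m \<omega> - S (k + m) \<omega>)\<^sup>2) \<partial>M) \<le> ennreal (tail m)" .
    qed
    finally show ?thesis .
  qed
  have tail0: "0 \<le> tail m" for m using sum_le_tail[where n=0 and m=m] by simp
  have int: "integrable M (\<lambda>\<omega>. (S m \<omega> - T \<omega>)\<^sup>2)" for m
    by (rule integrableI_bounded) (use nn[of m] in \<open>auto simp: less_top[symmetric] top_unique\<close>)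
  have le: "expectation (\<lambda>\<omega>. (S m \<omega> - T \<omega>)\<^sup>2) \<le> tail m" for m
  proof -
    have "ennreal (expectation (\<lambda>\<omega>. (S m \<omega> - T \<omega>)\<^sup>2)) = (\<integral>\<^sup>+\<omega>. ennreal ((S m \<omega> - T \<omega>)\<^sup>2) \<partial>M)"
      by (rule nn_integral_eq_integral[symmetric, OF int]) auto
    also have "\<dots> \<le> ennreal (tail m)" by (rule nn)
    finally show ?thesis using ennreal_le_iff[OF tail0[of m]] by blast
  qed
  have "(\<lambda>m. expectation (\<lambda>\<omega>. (S m \<omega> - T \<omega>)\<^sup>2)) \<longlonglongrightarrow> 0"
    by (rule tendsto_sandwich[OF _ _ tendsto_const tail_tendsto_0]) (auto intro!: always_eventually le integral_nonneg)
  moreover have "integrable M (\<lambda>\<omega>. (T \<omega>)\<^sup>2)" using int[of 0] by simp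
  ultimately show ?thesis
    unfolding series_converges_L2_def T_def[symmetric] using square_integrable by auto
qed

lemma char_series_tendsto:
  "(\<lambda>n. \<Prod>j<n. char (distr M borel (Y j)) s) \<longlonglongrightarrow> char (distr M borel (\<lambda>\<omega>. \<Sum>j. Y j \<omega>)) s"
proof -
  have "(\<lambda>n. CLINT \<omega>|M. iexp (s * S n \<omega>)) \<longlonglongrightarrow> (CLINT \<omega>|M. iexp (s * (\<Sum>j. Y j \<omega>)))"
  proof (rule integral_dominated_convergence[where w="\<lambda>_. 1"])
    show "AE \<omega> in M. (\<lambda>n. iexp (s * S n \<omega>)) \<longlonglongrightarrow> iexp (s * (\<Sum>j. Y j \<omega>))"
      using AE_summable
    proof eventually_elim
      case (elim \<omega>)
      then show ?case by (intro tendsto_exp tendsto_mult tendsto_const tendsto_of_real summable_LIMSEQ)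
    qed
  qed auto
  moreover have "(CLINT \<omega>|M. iexp (s * S n \<omega>)) = (\<Prod>j<n. char (distr M borel (Y j)) s)" for n
    using char_distr_sum[OF indep_vars_subset[OF indep], of "{..<n}" s]
    by (simp add: char_def integral_distr)
  ultimately show ?thesis by (simp add: char_def integral_distr)
qed

end

end

text \<open>An antiderivative of \<open>exp (- (1 - i u) x)\<close> is \<open>- exp (- (1 - i u) x) / (1 - i u)\<close>.\<close>

lemma exponential_char_integral:
  "(CLINT x|lborel. exponential_density 1 x *\<^sub>R iexp (u * x)) = 1 / (1 - \<i> * of_real u)"
proof -
  let ?c = "1 - \<i> * complex_of_real u"
  let ?f = "\<lambda>x::real. exp (- (?c * of_real x))"
  have c: "?c \<noteq> 0" by (simp add: complex_eq_iff)
  have norm_f: "norm (?f x) = exp (- x)" for x by simp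
  have int: "set_integrable lborel {0<..} ?f"
  proof -
    have "set_integrable lborel {0<..} (\<lambda>x::real. exp (- x))"
      using integrable_I0i_exp_mscale[of 1] by simp
    then show ?thesis
      by (rule set_integrable_bound) (auto simp: set_borel_measurable_def)
  qed
  have "(LBINT x=0..\<infinity>. ?f x) = 0 - (- 1 / ?c)"
  proof (rule interval_integral_FTC_integrable[where F="\<lambda>x. - ?f x / ?c"])
    show "((\<lambda>x. - ?f x / ?c) has_vector_derivative ?f x) (at x)" for x
    proof -
      have "((\<lambda>z. - exp (- (?c * z)) / ?c) has_field_derivative - (exp (- (?c * of_real x)) * - ?c) / ?c) (at (of_real x))"
        by (auto intro!: derivative_eq_intros DERIV_cdivide DERIV_minus)
      moreover have "- (exp (- (?c * of_real x)) * - ?c) / ?c = ?f x"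
        by (simp only: mult_minus_right minus_minus nonzero_mult_div_cancel_right[OF c])
      ultimately have "((\<lambda>z. - exp (- (?c * z)) / ?c) has_field_derivative ?f x) (at (of_real x))" by simp
      then show ?thesis by (rule has_vector_derivative_real_field)
    qed
    show "set_integrable lborel (einterval 0 \<infinity>) ?f" using int by (simp add: zero_ereal_def)
    show "(((\<lambda>x. - ?f x / ?c) \<circ> real_of_ereal) \<longlongrightarrow> - 1 / ?c) (at_right 0)"
    proof -
      have "((\<lambda>x::real. - ?f x / ?c) \<longlongrightarrow> - exp (- (?c * of_real 0)) / ?c) (at_right 0)"
        using c by (intro tendsto_intros) auto
      then show ?thesis unfolding zero_ereal_def ereal_tendsto_simps by simp
    qed
    show "(((\<lambda>x. - ?f x / ?c) \<circ> real_of_ereal) \<longlongrightarrow> 0) (at_left \<infinity>)"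
      unfolding ereal_tendsto_simps
    proof (rule tendsto_norm_zero_cancel)
      have "((\<lambda>x::real. exp (- x) / norm ?c) \<longlongrightarrow> 0 / norm ?c) at_top"
        using c by (intro tendsto_divide tendsto_const filterlim_compose[OF exp_at_bot filterlim_uminus_at_bot_at_top]) auto
      then show "((\<lambda>x. norm (- ?f x / ?c)) \<longlongrightarrow> 0) at_top"
        by (simp only: norm_divide norm_minus_cancel norm_f div_0)
    qed
  qed (auto intro!: continuous_intros)
  then have "(LBINT x:{0<..}. ?f x) = 1 / ?c" by (simp add: interval_lebesgue_integral_0_infty)
  moreover have f_eq: "?f x = of_real (exp (- x)) * iexp (u * x)" for x
  proof -
    have "- (?c * of_real x) = of_real (- x) + \<i> * of_real (u * x)" by (simp add: algebra_simps)
    then show ?thesis by (simp only: exp_add exp_of_real)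
  qed
  moreover have "(LBINT x:{0<..}. ?f x) = (CLINT x|lborel. exponential_density 1 x *\<^sub>R iexp (u * x))"
    unfolding set_lebesgue_integral_def
  proof (rule integral_cong_AE)
    show "AE x in lborel. indicat_real {0<..} x *\<^sub>R ?f x = exponential_density 1 x *\<^sub>R iexp (u * x)"
      using AE_lborel_singleton[of 0]
    proof eventually_elim
      case (elim x)
      then show ?case unfolding f_eq by (simp add: exponential_density_def indicator_def scaleR_conv_of_real)
    qed
  qed auto
  ultimately show ?thesis by simp
qed

lemma (in prob_space) exponential_affine_char:
  assumes X: "distributed M lborel X (exponential_density 1)"
  shows "char (distr M borel (\<lambda>\<omega>. (1 - X \<omega>) * c)) s = exp (\<i> * of_real (s * c)) / (1 + \<i> * of_real (s * c))"
proof -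
  have [measurable]: "X \<in> borel_measurable M" using distributed_measurable[OF X] by simp
  have eq: "distr M lborel X = density lborel (exponential_density 1)" by (rule distributed_distr_eq_density[OF X])
  have "char (distr M borel (\<lambda>\<omega>. (1 - X \<omega>) * c)) s = (CLINT \<omega>|M. iexp (s * ((1 - X \<omega>) * c)))"
    by (simp add: char_def integral_distr)
  also have "\<dots> = (CLINT x|distr M lborel X. iexp (s * ((1 - x) * c)))"
    by (subst integral_distr) auto
  also have "\<dots> = (CLINT x|lborel. exponential_density 1 x *\<^sub>R iexp (s * ((1 - x) * c)))"
    unfolding eq by (subst integral_density) (auto simp: exponential_density_nonneg)
  also have "\<dots> = (CLINT x|lborel. iexp (s * c) * (exponential_density 1 x *\<^sub>R iexp (- (s * c) * x)))"
    by (intro Bochner_Integration.integral_cong refl) (simp add: algebra_simps exp_add[symmetric] scaleR_conv_of_real)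
  also have "\<dots> = iexp (s * c) * (CLINT x|lborel. exponential_density 1 x *\<^sub>R iexp (- (s * c) * x))"
    by (rule integral_mult_right_zero)
  also have "(CLINT x|lborel. exponential_density 1 x *\<^sub>R iexp (- (s * c) * x)) = 1 / (1 - \<i> * of_real (- (s * c)))"
    by (rule exponential_char_integral)
  finally show ?thesis by simp
qed

section \<open>Fluctuations of the condensate\<close>

text \<open>Shifting the argument by \<open>E 0\<close> and removing one level do not affect the leading order.\<close>

lemma level_gap_count_tendsto:
  fixes E :: "nat \<Rightarrow> real"
  assumes L: "0 < L" and count: "((\<lambda>x::real. real (card {j. E j \<le> x}) / (L * x powr \<alpha>)) \<longlongrightarrow> 1) at_top"
    and \<alpha>: "0 < \<alpha>"
  shows "((\<lambda>x. real (card {j. E (Suc j) - E 0 \<le> x}) / x powr \<alpha>) \<longlongrightarrow> L) at_top"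
proof -
  have sh: "filterlim (\<lambda>x. E 0 + x) at_top at_top"
    by (rule filterlim_tendsto_add_at_top[OF tendsto_const filterlim_ident])
  define R where "R x = real (card {j. E j \<le> E 0 + x}) / (L * (E 0 + x) powr \<alpha>)" for x
  have R: "(R \<longlongrightarrow> 1) at_top" unfolding R_def by (rule filterlim_compose[OF count sh])
  have inv: "((\<lambda>x::real. 1 / x) \<longlongrightarrow> 0) at_top"
    by (rule tendsto_divide_0[OF tendsto_const filterlim_at_top_imp_at_infinity[OF filterlim_ident]])
  have "((\<lambda>x. R x * L * (E 0 * (1 / x) + 1) powr \<alpha> - x powr (- \<alpha>)) \<longlongrightarrow> 1 * L * (E 0 * 0 + 1) powr \<alpha> - 0) at_top"
    using \<alpha> by (intro tendsto_diff tendsto_mult tendsto_powr tendsto_add tendsto_const R inv tendsto_neg_powr filterlim_ident) auto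
  then have lim: "((\<lambda>x. R x * L * (E 0 * (1 / x) + 1) powr \<alpha> - x powr (- \<alpha>)) \<longlongrightarrow> L) at_top" by simp
  have "\<forall>\<^sub>F x in at_top. R x > 0" using R by (rule order_tendstoD) simp
  moreover have "\<forall>\<^sub>F x in at_top. 0 < E 0 + x" using sh by (rule filterlim_at_top_dense[THEN iffD1, rule_format])
  ultimately have "\<forall>\<^sub>F x in at_top. R x * L * (E 0 * (1 / x) + 1) powr \<alpha> - x powr (- \<alpha>) = real (card {j. E (Suc j) - E 0 \<le> x}) / x powr \<alpha>"
    using eventually_gt_at_top[of 0]
  proof eventually_elim
    case (elim x)
    have "card {j. E j \<le> E 0 + x} \<noteq> 0" using elim(1) unfolding R_def by (intro notI) simp
    then have fin: "finite {j. E j \<le> E 0 + x}" by (rule contrapos_np) simp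
    have eq: "{j. E j \<le> E 0 + x} = insert 0 (Suc ` {j. E (Suc j) - E 0 \<le> x})"
    proof (intro set_eqI iffI)
      fix j assume "j \<in> {j. E j \<le> E 0 + x}"
      then show "j \<in> insert 0 (Suc ` {j. E (Suc j) - E 0 \<le> x})" by (cases j) auto
    qed (use elim in auto)
    have "finite (Suc ` {j. E (Suc j) - E 0 \<le> x})" using fin unfolding eq by simp
    then have "card {j. E j \<le> E 0 + x} = Suc (card {j. E (Suc j) - E 0 \<le> x})"
      unfolding eq by (subst card_insert_disjoint) (auto simp: card_image)
    moreover have "(E 0 * (1 / x) + 1) powr \<alpha> = (E 0 + x) powr \<alpha> / x powr \<alpha>"
    proof -
      have "E 0 * (1 / x) + 1 = (E 0 + x) / x" using elim by (simp add: field_simps)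
      then show ?thesis using elim by (simp add: powr_divide)
    qed
    moreover have "R x * L = real (card {j. E j \<le> E 0 + x}) / (E 0 + x) powr \<alpha>"
      unfolding R_def using L by simp
    ultimately have "R x * L * (E 0 * (1 / x) + 1) powr \<alpha> = (1 + real (card {j. E (Suc j) - E 0 \<le> x})) / x powr \<alpha>"
      using elim by simp
    then show ?case by (simp add: powr_minus_divide add_divide_distrib)
  qed
  then show ?thesis by (rule Lim_transform_eventually[OF lim])
qed

lemma weak_conv_m_offset:
  assumes "weak_conv_m (\<lambda>n. M (n + k)) M'"
  shows "weak_conv_m M M'"
  using assms unfolding weak_conv_m_def weak_conv_def by (auto intro: LIMSEQ_offset[where k=k])

lemma normal_dist_scale:
  assumes "0 < v"
  shows "normal_dist 0 v = distr std_normal_distribution borel (\<lambda>x. sqrt v * x)"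
proof -
  interpret prob_space std_normal_distribution by (rule prob_space_normal_density) simp
  have "distributed std_normal_distribution lborel (\<lambda>x. x) std_normal_density"
    by (simp add: distributed_def distr_id2 normal_density_nonneg)
  from normal_density_affine[OF this, of "sqrt v" 0] assms
  have "distributed std_normal_distribution lborel (\<lambda>x. sqrt v * x) (normal_density 0 (sqrt v))" by simp
  then have "distr std_normal_distribution lborel (\<lambda>x. sqrt v * x) = normal_dist 0 v"
    by (simp add: distributed_def normal_dist_def)
  moreover have "distr std_normal_distribution lborel (\<lambda>x. sqrt v * x) = distr std_normal_distribution borel (\<lambda>x. sqrt v * x)"
    by (rule distr_cong) auto
  ultimately show ?thesis by simp
qed

lemma real_distribution_normal_dist:
  assumes "0 < v"
  shows "real_distribution (normal_dist 0 v)"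
proof -
  interpret prob_space std_normal_distribution by (rule prob_space_normal_density) simp
  show ?thesis unfolding normal_dist_scale[OF assms] by (rule real_distribution_distr) simp
qed

lemma char_normal_dist:
  assumes "0 < v"
  shows "char (normal_dist 0 v) s = of_real (exp (- (s\<^sup>2 * v / 2)))"
proof -
  have "char (normal_dist 0 v) s = (CLINT x|std_normal_distribution. iexp (s * (sqrt v * x)))"
    unfolding normal_dist_scale[OF assms] char_def by (subst integral_distr) auto
  also have "\<dots> = char std_normal_distribution (s * sqrt v)" by (simp add: char_def mult_ac)
  finally show ?thesis using assms by (simp add: char_std_normal_distribution power_mult_distrib)
qed

lemma zeta_real_2: "zeta_real 2 = pi\<^sup>2 / 6"
proof -
  have "(\<lambda>k. 1 / real (Suc k) powr 2) = (\<lambda>k. 1 / (real k + 1)\<^sup>2)"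
    by (rule ext) (simp add: powr_numeral add.commute)
  then show ?thesis unfolding zeta_real_def using inverse_squares_sums by (simp add: sums_iff)
qed

lemma zeta_real_pos:
  assumes "1 < s"
  shows "0 < zeta_real s"
proof -
  have "summable (\<lambda>k. real k powr (- s))" using assms by (simp add: summable_real_powr_iff)
  then have "summable (\<lambda>k. 1 / real (Suc k) powr s)"
    by (subst (asm) summable_Suc_iff[symmetric]) (simp only: powr_minus_divide)
  then show ?thesis unfolding zeta_real_def by (rule suminf_pos) simp
qed

locale trapped_bosons =
  fixes E :: "nat \<Rightarrow> real" and L \<alpha> kB t :: real
  assumes E_gap: "E 0 < E 1"
    and E_mono: "\<And>j. 1 \<le> j \<Longrightarrow> E j \<le> E (Suc j)"
    and L_pos': "L > 0" and \<alpha>_ge': "\<alpha> \<ge> 1"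
    and E_count: "((\<lambda>x::real. real (card {j. E j \<le> x}) / (L * x powr \<alpha>)) \<longlongrightarrow> 1) at_top"
    and kB_pos: "kB > 0" and t_pos: "0 < t" and t_less: "t < crit_temp kB L \<alpha>"
begin

definition e :: "nat \<Rightarrow> real" where "e j = E (Suc j) - E 0"

sublocale level_gaps e L \<alpha>
proof
  show "0 < e 0" using E_gap by (simp add: e_def)
  show "mono e" unfolding e_def by (rule incseq_SucI) (simp add: E_mono)
  show "0 < L" "1 \<le> \<alpha>" by (fact L_pos' \<alpha>_ge')+
  show "((\<lambda>x. real (card {j. e j \<le> x}) / x powr \<alpha>) \<longlongrightarrow> L) at_top"
    unfolding e_def by (rule level_gap_count_tendsto[OF L_pos' E_count]) (use \<alpha>_ge' in simp)
qed

definition c :: real where "c = kB * t"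

text \<open>The number of particles, from 2 on. For one particle and \<open>\<alpha> = 1\<close> the temperature is \<open>0\<close> by the convention
  \<open>x / 0 = 0\<close>, and \<open>gibbs\<close> is not a probability measure. Weak limits ignore the first two indices.\<close>

definition N :: "nat \<Rightarrow> real" where "N n = real (n + 2)"

definition \<beta> :: "nat \<Rightarrow> real" where "\<beta> n = 1 / (kB * temp \<alpha> t (n + 2))"

definition q :: "nat \<Rightarrow> nat \<Rightarrow> real" where "q n j = exp (- \<beta> n * e j)"

lemma c_pos: "0 < c" using kB_pos t_pos by (simp add: c_def)

lemma N_ge: "2 \<le> N n" by (simp add: N_def)

lemma ln_N_pos: "0 < ln (N n)" using N_ge[of n] by simp

lemma N_at_top: "filterlim N at_top sequentially"
  unfolding N_def by (rule filterlim_compose[OF filterlim_real_sequentially filterlim_add_const_nat_at_top])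

lemma ln_N_at_top: "filterlim (\<lambda>n. ln (N n)) at_top sequentially"
  by (rule filterlim_compose[OF ln_at_top N_at_top])

lemma \<beta>_eq_1:
  assumes "\<alpha> = 1"
  shows "\<beta> n = ln (N n) / (c * N n)"
proof -
  have "temp \<alpha> t (n + 2) = t * N n / ln (N n)" unfolding temp_def N_def using assms by simp
  then show ?thesis unfolding \<beta>_def c_def by simp
qed

lemma \<beta>_eq: "1 < \<alpha> \<Longrightarrow> \<beta> n = 1 / (c * N n powr (1 / \<alpha>))"
  by (simp add: \<beta>_def temp_def c_def N_def)

lemma \<beta>_pos: "0 < \<beta> n"
proof (cases "\<alpha> = 1")
  case True
  show ?thesis unfolding \<beta>_eq_1[OF True] using c_pos ln_N_pos[of n] N_ge[of n] by simp
next
  case False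
  then show ?thesis using c_pos N_ge[of n] \<alpha>_ge by (simp add: \<beta>_eq)
qed

lemma \<beta>_at_right_0: "filterlim \<beta> (at_right 0) sequentially"
proof -
  have "\<beta> \<longlonglongrightarrow> 0"
  proof (cases "\<alpha> = 1")
    case True
    have "(\<lambda>n. 1 / c * (ln (N n) / N n)) \<longlonglongrightarrow> 1 / c * 0"
      by (intro tendsto_mult tendsto_const filterlim_compose[OF ln_x_over_x_tendsto_0 N_at_top])
    then show ?thesis unfolding \<beta>_eq_1[OF True, abs_def] by simp
  next
    case False
    then have \<alpha>: "1 < \<alpha>" using \<alpha>_ge by simp
    have "(\<lambda>n. 1 / c * N n powr (- (1 / \<alpha>))) \<longlonglongrightarrow> 1 / c * 0"
      using \<alpha> by (intro tendsto_mult tendsto_const tendsto_neg_powr N_at_top) auto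
    then show ?thesis unfolding \<beta>_eq[OF \<alpha>, abs_def] by (simp add: powr_minus_divide)
  qed
  then show ?thesis unfolding filterlim_at using \<beta>_pos by (auto simp: less_imp_neq[symmetric])
qed

lemma q_boltzmann: "boltzmann_factors (q n)"
proof
  show "0 < q n j" for j by (simp add: q_def)
  show "q n j \<le> q n 0" for j using monoD[OF e_mono, of 0 j] \<beta>_pos[of n] by (simp add: q_def)
  show "q n 0 < 1" unfolding q_def by (rule exp_gap(2)[OF \<beta>_pos])
  show "summable (q n)" unfolding q_def by (rule laplace_sums(1)[OF \<beta>_pos])
qed

lemma mean_occ_eq: "boltzmann_factors.mean_occ (q n) j = occ (\<beta> n) j"
  by (simp add: boltzmann_factors.mean_occ_def[OF q_boltzmann] q_def exp_gap(3)[OF \<beta>_pos])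

lemma mu_eq: "boltzmann_factors.mu (q n) = weighted_laplace 0 (\<beta> n)"
  using occ_sums[OF \<beta>_pos, of n]
  by (simp add: boltzmann_factors.mu_def[OF q_boltzmann] mean_occ_eq sums_iff)

lemma V_eq: "boltzmann_factors.V (q n) = weighted_laplace 1 (\<beta> n)"
  using occ_variance_sums[OF \<beta>_pos, of n]
  by (simp add: boltzmann_factors.V_def[OF q_boltzmann] mean_occ_eq sums_iff)

definition centred_char :: "real \<Rightarrow> (nat \<Rightarrow> real) \<Rightarrow> nat \<Rightarrow> complex" where
  "centred_char u a n = (CLINT k|boltzmann_factors.excited (q n). iexp (u / a n * (real k - boltzmann_factors.mu (q n))))"

lemma centred_char_prod:
  "(\<lambda>J. \<Prod>j<J. geo_char (occ (\<beta> n) j) (u / a n)) \<longlonglongrightarrow> centred_char u a n"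
  using boltzmann_factors.centred_char_excited[OF q_boltzmann, of n "u / a n"]
  by (simp add: centred_char_def mean_occ_eq)

text \<open>Levy's continuity theorem reduces the claim to the grand canonical characteristic functions. The
  sign of the argument changes because an increase of the number of excited particles is a decrease
  of \<open>N\<^sub>0\<close>. The limit \<open>\<rho>\<close> of the fraction of excited particles lies below 1, so that \<open>N n\<close> exceeds their mean
  number by a positive fraction of \<open>N n\<close>, which is large compared with \<open>a n\<close>.\<close>

lemma N0_weak_conv:
  fixes b :: "nat \<Rightarrow> real"
  defines "a \<equiv> \<lambda>n. b (n + 2)"
  assumes a: "filterlim a at_top sequentially"
    and var: "\<forall>\<^sub>F n in sequentially. weighted_laplace 1 (\<beta> n) / (a n)\<^sup>2 \<le> C"
    and small: "\<forall>\<^sub>F n in sequentially. occ (\<beta> n) 0 / a n \<le> C"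
    and ratio: "(\<lambda>n. weighted_laplace 0 (\<beta> n) / N n) \<longlonglongrightarrow> \<rho>" "\<rho> < 1"
    and room: "filterlim (\<lambda>n. N n / a n) at_top sequentially"
    and M': "real_distribution M'"
    and char: "\<And>s. centred_char (- s) a \<longlonglongrightarrow> char M' s"
  shows "weak_conv_m (N0_law kB E \<alpha> t b) M'"
proof (rule weak_conv_m_offset[where k=2])
  define p where "p n = cond_pmf (boltzmann_factors.excited (q n)) {..n + 2}" for n
  have law: "N0_law kB E \<alpha> t b (n + 2) = distr (p n) borel (\<lambda>k. - ((real k - (\<integral>k. real k \<partial>p n)) / a n))" for n
    unfolding p_def a_def
    by (rule boltzmann_factors.N0_law_excited[OF q_boltzmann]) (simp add: q_def \<beta>_def e_def)
  show "weak_conv_m (\<lambda>n. N0_law kB E \<alpha> t b (n + 2)) M'"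
  proof (rule levy_continuity[OF _ M'])
    show "real_distribution (N0_law kB E \<alpha> t b (n + 2))" for n
      unfolding law by (rule prob_space.real_distribution_distr[OF prob_space_measure_pmf]) simp
    fix s
    have "filterlim (\<lambda>n. (1 - weighted_laplace 0 (\<beta> n) / N n) * (N n / a n)) at_top sequentially"
      by (rule filterlim_tendsto_pos_mult_at_top[OF _ _ room]) (use ratio in \<open>auto intro!: tendsto_intros\<close>)
    then have room': "filterlim (\<lambda>n. (real (n + 2) - boltzmann_factors.mu (q n)) / a n) at_top sequentially"
    proof (rule filterlim_cong[THEN iffD1, rotated -1])
      show "\<forall>\<^sub>F n in sequentially. (1 - weighted_laplace 0 (\<beta> n) / N n) * (N n / a n) = (real (n + 2) - boltzmann_factors.mu (q n)) / a n"
      proof (rule always_eventually, rule allI)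
        fix n
        have "(1 - weighted_laplace 0 (\<beta> n) / N n) * N n = N n - weighted_laplace 0 (\<beta> n)"
          using N_ge[of n] by (simp add: field_simps)
        then show "(1 - weighted_laplace 0 (\<beta> n) / N n) * (N n / a n) = (real (n + 2) - boltzmann_factors.mu (q n)) / a n"
          by (simp add: mu_eq N_def)
      qed
    qed auto
    have "(\<lambda>n. CLINT k|p n. iexp (- s * ((real k - (\<integral>k. real k \<partial>p n)) / a n))) \<longlonglongrightarrow> char M' s"
      unfolding p_def
      by (rule canonical_fluctuations[where q=q and a=a and \<nu>="\<lambda>n. n + 2" and C=C])
         (use q_boltzmann a var small room' char[of s] in \<open>auto simp: V_eq mean_occ_eq centred_char_def[abs_def]\<close>)
    then show "(\<lambda>n. char (N0_law kB E \<alpha> t b (n + 2)) s) \<longlonglongrightarrow> char M' s"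
      unfolding law char_def by (subst integral_distr) auto
  qed
qed

text \<open>The limit of \<open>\<beta>\<^sup>\<alpha>\<close> times the mean number of excited particles for \<open>\<alpha> > 1\<close>.\<close>

definition bose_const :: real where "bose_const = (L * \<alpha> * Gamma \<alpha> * zeta_real \<alpha>)"

lemma Gamma_\<alpha>: "Gamma (\<alpha> + 1) = \<alpha> * Gamma \<alpha>"
  using \<alpha>_ge by (intro Gamma_plus1) (auto simp: nonpos_Ints_def)

lemma t_over_crit_temp: "1 < \<alpha> \<Longrightarrow> t / crit_temp kB L \<alpha> = c * bose_const powr (1 / \<alpha>)"
  and t_over_tc_1: "\<alpha> = 1 \<Longrightarrow> t / crit_temp kB L \<alpha> = c * L"
  using L_pos kB_pos by (simp_all add: crit_temp_def c_def bose_const_def mult_ac)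

lemma bose_const_pos: "1 < \<alpha> \<Longrightarrow> 0 < bose_const"
  unfolding bose_const_def using L_pos by (intro mult_pos_pos zeta_real_pos Gamma_real_pos) auto

lemma t_ratio: "0 < t / crit_temp kB L \<alpha>" "t / crit_temp kB L \<alpha> < 1"
  using t_pos t_less by auto

lemma t_ratio_powr: "1 < \<alpha> \<Longrightarrow> (t / crit_temp kB L \<alpha>) powr \<alpha> = c powr \<alpha> * bose_const"
  using c_pos bose_const_pos \<alpha>_ge by (simp add: t_over_crit_temp powr_mult powr_powr)

lemma \<beta>_powr: "1 < \<alpha> \<Longrightarrow> \<beta> n powr \<alpha> = 1 / (c powr \<alpha> * N n)"
  using c_pos N_ge[of n] by (simp add: \<beta>_eq powr_divide powr_mult powr_powr)

text \<open>The limit is \<open>(t / t\<^sub>c)\<^sup>\<alpha>\<close>. It is below 1 exactly below the critical temperature.\<close>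

lemma excited_fraction: "\<exists>\<rho><1. (\<lambda>n. weighted_laplace 0 (\<beta> n) / N n) \<longlonglongrightarrow> \<rho>"
proof (cases "\<alpha> = 1")
  case True
  have powr_\<alpha>: "x powr \<alpha> = x" if "0 < x" for x :: real using that True by simp
  have l: "(\<lambda>n. \<beta> n powr \<alpha> * weighted_laplace 0 (\<beta> n) / ln (1 / \<beta> n)) \<longlonglongrightarrow> L * Gamma (\<alpha> + 1)"
    by (rule filterlim_compose[OF weighted_laplace_log_tendsto \<beta>_at_right_0]) (use True in auto)
  have lr: "(\<lambda>n. ln (1 / \<beta> n) / ln (N n)) \<longlonglongrightarrow> 1"
  proof -
    have "(\<lambda>n. ln c / ln (N n) + 1 - ln (ln (N n)) / ln (N n)) \<longlonglongrightarrow> 0 + 1 - 0"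
      by (intro tendsto_add tendsto_diff tendsto_const
          tendsto_divide_0[OF tendsto_const filterlim_at_top_imp_at_infinity[OF ln_N_at_top]]
          filterlim_compose[OF ln_x_over_x_tendsto_0 ln_N_at_top])
    moreover have "ln c / ln (N n) + 1 - ln (ln (N n)) / ln (N n) = ln (1 / \<beta> n) / ln (N n)" for n
    proof -
      have "ln (1 / \<beta> n) = ln c + ln (N n) - ln (ln (N n))"
        unfolding \<beta>_eq_1[OF True] using c_pos ln_N_pos[of n] N_ge[of n] by (simp add: ln_div ln_mult)
      then show ?thesis using ln_N_pos[of n] by (simp add: add_divide_distrib diff_divide_distrib)
    qed
    ultimately show ?thesis by simp
  qed
  have "Gamma (\<alpha> + 1) = 1" unfolding Gamma_\<alpha> using True by simp
  with tendsto_mult[OF tendsto_mult[OF l lr] tendsto_const[of c]]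
  have "(\<lambda>n. \<beta> n powr \<alpha> * weighted_laplace 0 (\<beta> n) / ln (1 / \<beta> n) * (ln (1 / \<beta> n) / ln (N n)) * c) \<longlonglongrightarrow> L * c"
    by simp
  moreover have "\<forall>\<^sub>F n in sequentially. \<beta> n powr \<alpha> * weighted_laplace 0 (\<beta> n) / ln (1 / \<beta> n) * (ln (1 / \<beta> n) / ln (N n)) * c = weighted_laplace 0 (\<beta> n) / N n"
  proof -
    have "\<forall>\<^sub>F n in sequentially. 0 < ln (1 / \<beta> n) / ln (N n)" using lr by (rule order_tendstoD) simp
    then show ?thesis
    proof eventually_elim
      case (elim n)
      then have nz: "ln (1 / \<beta> n) \<noteq> 0" by auto
      have b: "\<beta> n powr \<alpha> = ln (N n) / (c * N n)"
        unfolding \<beta>_eq_1[OF True, symmetric] by (rule powr_\<alpha>[OF \<beta>_pos])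
      show ?case unfolding b using nz c_pos ln_N_pos[of n] by (simp add: field_simps)
    qed
  qed
  ultimately have "(\<lambda>n. weighted_laplace 0 (\<beta> n) / N n) \<longlonglongrightarrow> L * c" by (rule Lim_transform_eventually)
  moreover have "L * c < 1" using t_ratio(2) unfolding t_over_tc_1[OF True] by (simp add: mult.commute)
  ultimately show ?thesis by blast
next
  case False
  then have \<alpha>: "1 < \<alpha>" using \<alpha>_ge by simp
  have "(\<lambda>n. \<beta> n powr \<alpha> * weighted_laplace 0 (\<beta> n)) \<longlonglongrightarrow> L * Gamma (\<alpha> + 1) * zeta_real (\<alpha> - 0)"
    by (rule filterlim_compose[OF weighted_laplace_powr_tendsto \<beta>_at_right_0]) (use \<alpha> in auto)
  then have "(\<lambda>n. \<beta> n powr \<alpha> * weighted_laplace 0 (\<beta> n)) \<longlonglongrightarrow> bose_const"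
    by (simp add: Gamma_\<alpha> bose_const_def mult_ac)
  from tendsto_mult_left[OF this, of "c powr \<alpha>"]
  have "(\<lambda>n. weighted_laplace 0 (\<beta> n) / N n) \<longlonglongrightarrow> c powr \<alpha> * bose_const"
    using \<alpha> c_pos by (simp add: \<beta>_powr)
  moreover have "c powr \<alpha> * bose_const < 1"
    unfolding t_ratio_powr[OF \<alpha>, symmetric]
    using t_ratio powr_less_mono2[of \<alpha> "t / crit_temp kB L \<alpha>" 1] \<alpha> by simp
  ultimately show ?thesis by blast
qed

end

context trapped_bosons
begin

text \<open>The hypothesis \<open>scale\<close> says that the fluctuations \<open>1 / (\<beta> e\<^sub>j)\<close> of a single level are negligible on the
  scale \<open>a\<close>.\<close>

lemma normal_fluctuations:
  fixes b :: "nat \<Rightarrow> real"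
  defines "a \<equiv> \<lambda>n. b (n + 2)"
  assumes a: "filterlim a at_top sequentially"
    and var: "(\<lambda>n. weighted_laplace 1 (\<beta> n) / (a n)\<^sup>2) \<longlonglongrightarrow> v" "0 < v"
    and scale: "(\<lambda>n. 1 / (\<beta> n * a n)) \<longlonglongrightarrow> 0"
    and room: "filterlim (\<lambda>n. N n / a n) at_top sequentially"
  shows "weak_conv_m (N0_law kB E \<alpha> t b) (normal_dist 0 v)"
proof -
  obtain \<rho> where \<rho>: "\<rho> < 1" "(\<lambda>n. weighted_laplace 0 (\<beta> n) / N n) \<longlonglongrightarrow> \<rho>" using excited_fraction by blast
  have apos: "\<forall>\<^sub>F n in sequentially. 0 < a n" using a by (rule filterlim_at_top_dense[THEN iffD1, rule_format])
  have small: "(\<lambda>n. occ (\<beta> n) 0 / a n) \<longlonglongrightarrow> 0"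
  proof (rule tendsto_sandwich)
    show "\<forall>\<^sub>F n in sequentially. 0 \<le> occ (\<beta> n) 0 / a n"
      using apos by eventually_elim (simp add: occ_pos[OF \<beta>_pos] less_imp_le)
    show "\<forall>\<^sub>F n in sequentially. occ (\<beta> n) 0 / a n \<le> 1 / e 0 * (1 / (\<beta> n * a n))"
      using apos
    proof eventually_elim
      case (elim n)
      have "occ (\<beta> n) 0 / a n \<le> 1 / (\<beta> n * e 0) / a n"
        using elim by (intro divide_right_mono occ_le \<beta>_pos) auto
      then show ?case by (simp add: mult_ac)
    qed
    show "(\<lambda>n. 1 / e 0 * (1 / (\<beta> n * a n))) \<longlonglongrightarrow> 0"
      using tendsto_mult_left[OF scale, of "1 / e 0"] by simp
  qed simp
  define C where "C = v + 1"
  have var': "\<forall>\<^sub>F n in sequentially. weighted_laplace 1 (\<beta> n) / (a n)\<^sup>2 \<le> C"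
    using order_tendstoD(2)[OF var(1), of C] by (auto simp: C_def elim: eventually_mono)
  have small': "\<forall>\<^sub>F n in sequentially. occ (\<beta> n) 0 / a n \<le> C"
    using order_tendstoD(2)[OF small, of C] var(2) by (auto simp: C_def elim: eventually_mono)
  have vsum: "(\<Sum>j. occ (\<beta> n) j + (occ (\<beta> n) j)\<^sup>2) = weighted_laplace 1 (\<beta> n)" for n
    using occ_variance_sums[OF \<beta>_pos[of n]] by (simp add: sums_iff)
  show ?thesis
  proof (rule N0_weak_conv[OF a[unfolded a_def] var'[unfolded a_def] small'[unfolded a_def] \<rho>(2,1) room[unfolded a_def] real_distribution_normal_dist[OF var(2)]])
    fix s
    have "centred_char (- s) a \<longlonglongrightarrow> of_real (exp (- ((- s)\<^sup>2 * v / 2)))"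
    proof (rule geo_char_prod_tendsto_gaussian[where m="\<lambda>n. occ (\<beta> n)" and a=a])
      show "0 \<le> occ (\<beta> n) j" for n j using occ_pos[OF \<beta>_pos] by (rule less_imp_le)
      show "occ (\<beta> n) j \<le> occ (\<beta> n) 0" for n j
        using boltzmann_factors.mean_occ_le[OF q_boltzmann, of n j] by (simp add: mean_occ_eq)
      show "summable (\<lambda>j. occ (\<beta> n) j + (occ (\<beta> n) j)\<^sup>2)" for n
        by (rule sums_summable[OF occ_variance_sums[OF \<beta>_pos]])
      show "(\<lambda>n. (\<Sum>j. occ (\<beta> n) j + (occ (\<beta> n) j)\<^sup>2) / (a n)\<^sup>2) \<longlonglongrightarrow> v" unfolding vsum by (rule var)
    qed (rule a small centred_char_prod)+
    then show "centred_char (- s) (\<lambda>n. b (n + 2)) \<longlonglongrightarrow> char (normal_dist 0 v) s"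
      using char_normal_dist[OF var(2), of s] by (simp add: a_def)
  qed
qed

lemma N_powr_at_top:
  assumes "0 < r"
  shows "filterlim (\<lambda>n. N n powr r) at_top sequentially"
proof -
  have "filterlim (\<lambda>n. exp (r * ln (N n))) at_top sequentially"
    by (rule filterlim_compose[OF exp_at_top filterlim_tendsto_pos_mult_at_top[OF tendsto_const assms ln_N_at_top]])
  moreover have "exp (r * ln (N n)) = N n powr r" for n using N_ge[of n] by (simp add: powr_def)
  ultimately show ?thesis by simp
qed

lemma N_over_ln_N_at_top: "filterlim (\<lambda>n. N n / ln (N n)) at_top sequentially"
  proof -
    have "filterlim (\<lambda>x::real. x / ln x) at_top at_top"
    proof -
      have "filterlim (\<lambda>x::real. inverse (ln x / x)) at_top at_top"
      proof (rule filterlim_compose[OF filterlim_inverse_at_top_right])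
        show "filterlim (\<lambda>x::real. ln x / x) (at_right 0) at_top"
        proof (rule filterlim_at[THEN iffD2], intro conjI)
          show "\<forall>\<^sub>F x::real in at_top. ln x / x \<in> {0<..} \<and> ln x / x \<noteq> 0"
            using eventually_gt_at_top[of 1] by eventually_elim simp
        qed (rule ln_x_over_x_tendsto_0)
      qed
      then show ?thesis by simp
    qed
    then show ?thesis by (rule filterlim_compose[OF _ N_at_top])
  qed

lemma N0_fluctuations_gt_2:
  assumes \<alpha>: "2 < \<alpha>"
  shows "weak_conv_m (N0_law kB E \<alpha> t (\<lambda>n. sqrt (real n))) (normal_dist 0 ((t / crit_temp kB L \<alpha>) powr \<alpha> * zeta_real (\<alpha> - 1) / zeta_real \<alpha>))"
proof (rule normal_fluctuations, fold N_def)
  have \<alpha>1: "1 < \<alpha>" using \<alpha> by simp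
  show "filterlim (\<lambda>n. sqrt (N n)) at_top sequentially" by (rule filterlim_compose[OF sqrt_at_top N_at_top])
  have "N n / sqrt (N n) = sqrt (N n)" for n using N_ge[of n] by (simp add: real_div_sqrt)
  then show "filterlim (\<lambda>n. N n / sqrt (N n)) at_top sequentially"
    using filterlim_compose[OF sqrt_at_top N_at_top] by simp
  have zp: "0 < zeta_real \<alpha>" "0 < zeta_real (\<alpha> - 1)" using \<alpha> by (auto intro: zeta_real_pos)
  then show "0 < (t / crit_temp kB L \<alpha>) powr \<alpha> * zeta_real (\<alpha> - 1) / zeta_real \<alpha>"
    using t_pos t_less by simp
  have "(\<lambda>n. \<beta> n powr \<alpha> * weighted_laplace 1 (\<beta> n)) \<longlonglongrightarrow> L * Gamma (\<alpha> + 1) * zeta_real (\<alpha> - 1)"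
    by (rule filterlim_compose[OF weighted_laplace_powr_tendsto \<beta>_at_right_0]) (use \<alpha> in auto)
  from tendsto_mult_left[OF this, of "c powr \<alpha>"]
  have "(\<lambda>n. weighted_laplace 1 (\<beta> n) / N n) \<longlonglongrightarrow> c powr \<alpha> * (L * Gamma (\<alpha> + 1) * zeta_real (\<alpha> - 1))"
    using c_pos by (simp add: \<beta>_powr[OF \<alpha>1])
  moreover have "c powr \<alpha> * (L * Gamma (\<alpha> + 1) * zeta_real (\<alpha> - 1)) = (t / crit_temp kB L \<alpha>) powr \<alpha> * zeta_real (\<alpha> - 1) / zeta_real \<alpha>"
    unfolding t_ratio_powr[OF \<alpha>1] using zp by (simp add: bose_const_def Gamma_\<alpha>)
  ultimately show "(\<lambda>n. weighted_laplace 1 (\<beta> n) / (sqrt (N n))\<^sup>2) \<longlonglongrightarrow> (t / crit_temp kB L \<alpha>) powr \<alpha> * zeta_real (\<alpha> - 1) / zeta_real \<alpha>"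
    using N_ge by (simp add: N_def)
  have "(\<lambda>n. c * N n powr (- (1/2 - 1 / \<alpha>))) \<longlonglongrightarrow> c * 0"
    using \<alpha> by (intro tendsto_mult tendsto_const tendsto_neg_powr N_at_top) (auto simp: field_simps)
  moreover have "c * N n powr (- (1/2 - 1 / \<alpha>)) = 1 / (\<beta> n * sqrt (N n))" for n
  proof -
    have "sqrt (N n) = N n powr (1/2)" using N_ge[of n] by (simp add: powr_half_sqrt)
    then show ?thesis unfolding \<beta>_eq[OF \<alpha>1] using c_pos by (simp add: powr_diff)
  qed
  ultimately show "(\<lambda>n. 1 / (\<beta> n * sqrt (N n))) \<longlonglongrightarrow> 0" by simp
qed

text \<open>Here \<open>\<beta> = 1 / (c \<surd>n)\<close>, so \<open>ln (1 / \<beta>)\<close> is asymptotic to \<open>ln n / 2\<close>, and the variance of the number of excited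
  particles to \<open>2 L \<beta>\<^sup>-\<^sup>2 ln (1 / \<beta>)\<close>, that is, to \<open>c\<^sup>2 L n ln n\<close>. With \<open>\<zeta>(2) = \<pi>\<^sup>2 / 6\<close> this becomes the stated form.\<close>

lemma N0_fluctuations_2:
  assumes \<alpha>: "\<alpha> = 2"
  shows "weak_conv_m (N0_law kB E \<alpha> t (\<lambda>n. sqrt (real n * ln (real n)))) (normal_dist 0 (3 * (t / crit_temp kB L \<alpha>)\<^sup>2 / pi\<^sup>2))"
proof (rule normal_fluctuations, fold N_def)
  have \<alpha>1: "1 < \<alpha>" using \<alpha> by simp
  have NlnN: "filterlim (\<lambda>n. N n * ln (N n)) at_top sequentially"
    by (rule filterlim_at_top_mult_at_top[OF N_at_top ln_N_at_top])
  then show "filterlim (\<lambda>n. sqrt (N n * ln (N n))) at_top sequentially" by (rule filterlim_compose[OF sqrt_at_top])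
  show "0 < 3 * (t / crit_temp kB L \<alpha>)\<^sup>2 / pi\<^sup>2"
    by (intro divide_pos_pos mult_pos_pos zero_less_power t_ratio(1)) auto
  have \<beta>2: "\<beta> n = 1 / (c * sqrt (N n))" for n
    unfolding \<beta>_eq[OF \<alpha>1] using \<alpha> N_ge[of n] by (simp add: powr_half_sqrt)
  have "filterlim (\<lambda>n. N n / ln (N n)) at_top sequentially" by (rule N_over_ln_N_at_top)
  then have "filterlim (\<lambda>n. sqrt (N n / ln (N n))) at_top sequentially" by (rule filterlim_compose[OF sqrt_at_top])
  moreover have "sqrt (N n / ln (N n)) = N n / sqrt (N n * ln (N n))" for n
    using N_ge[of n] by (simp add: real_sqrt_divide real_sqrt_mult real_div_sqrt divide_divide_eq_left[symmetric])
  ultimately show "filterlim (\<lambda>n. N n / sqrt (N n * ln (N n))) at_top sequentially" by simp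
  have "(\<lambda>n. c * (1 / sqrt (ln (N n)))) \<longlonglongrightarrow> c * 0"
    by (intro tendsto_mult tendsto_const tendsto_divide_0[OF tendsto_const filterlim_at_top_imp_at_infinity[OF filterlim_compose[OF sqrt_at_top ln_N_at_top]]])
  moreover have "c * (1 / sqrt (ln (N n))) = 1 / (\<beta> n * sqrt (N n * ln (N n)))" for n
    unfolding \<beta>2 using c_pos N_ge[of n] by (simp add: real_sqrt_mult)
  ultimately show "(\<lambda>n. 1 / (\<beta> n * sqrt (N n * ln (N n)))) \<longlonglongrightarrow> 0" by simp
  have l: "(\<lambda>n. \<beta> n powr \<alpha> * weighted_laplace 1 (\<beta> n) / ln (1 / \<beta> n)) \<longlonglongrightarrow> L * Gamma (\<alpha> + 1)"
    by (rule filterlim_compose[OF weighted_laplace_log_tendsto \<beta>_at_right_0]) (use \<alpha> in auto)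
  have lr: "(\<lambda>n. ln (1 / \<beta> n) / ln (N n)) \<longlonglongrightarrow> 1/2"
  proof -
    have "(\<lambda>n. ln c / ln (N n) + 1/2) \<longlonglongrightarrow> 0 + 1/2"
      by (intro tendsto_add tendsto_const
          tendsto_divide_0[OF tendsto_const filterlim_at_top_imp_at_infinity[OF ln_N_at_top]])
    moreover have "ln c / ln (N n) + 1/2 = ln (1 / \<beta> n) / ln (N n)" for n
    proof -
      have "ln (1 / \<beta> n) = ln c + ln (N n) / 2"
        unfolding \<beta>2 using c_pos N_ge[of n] by (simp add: ln_mult ln_sqrt)
      then show ?thesis using ln_N_pos[of n] by (simp add: add_divide_distrib)
    qed
    ultimately show ?thesis by simp
  qed
  \<comment> \<open>\<open>\<beta>\<^sup>\<alpha> = 1 / (c\<^sup>\<alpha> n)\<close> turns the left-hand side into the variance over \<open>n ln n\<close>\<close>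
  from tendsto_mult[OF tendsto_mult[OF l lr] tendsto_const[of "c powr \<alpha>"]]
  have "(\<lambda>n. \<beta> n powr \<alpha> * weighted_laplace 1 (\<beta> n) / ln (1 / \<beta> n) * (ln (1 / \<beta> n) / ln (N n)) * c powr \<alpha>) \<longlonglongrightarrow> L * Gamma (\<alpha> + 1) * (1/2) * c powr \<alpha>" .
  moreover have "\<forall>\<^sub>F n in sequentially. \<beta> n powr \<alpha> * weighted_laplace 1 (\<beta> n) / ln (1 / \<beta> n) * (ln (1 / \<beta> n) / ln (N n)) * c powr \<alpha> = weighted_laplace 1 (\<beta> n) / (sqrt (N n * ln (N n)))\<^sup>2"
  proof -
    have "\<forall>\<^sub>F n in sequentially. 0 < ln (1 / \<beta> n) / ln (N n)" using lr by (rule order_tendstoD) simp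
    then show ?thesis
    proof eventually_elim
      case (elim n)
      then have nz: "ln (1 / \<beta> n) \<noteq> 0" by auto
      have sq: "(sqrt (N n * ln (N n)))\<^sup>2 = N n * ln (N n)" using N_ge[of n] ln_N_pos[of n] by simp
      show ?case unfolding \<beta>_powr[OF \<alpha>1] sq using nz c_pos ln_N_pos[of n] N_ge[of n] by (simp add: field_simps)
    qed
  qed
  ultimately have lim: "(\<lambda>n. weighted_laplace 1 (\<beta> n) / (sqrt (N n * ln (N n)))\<^sup>2) \<longlonglongrightarrow> L * Gamma (\<alpha> + 1) * (1/2) * c powr \<alpha>"
    by (rule Lim_transform_eventually)
  have "L * Gamma (\<alpha> + 1) * (1/2) * c powr \<alpha> = 3 * (t / crit_temp kB L \<alpha>)\<^sup>2 / pi\<^sup>2"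
  proof -
    have z: "zeta_real \<alpha> = pi\<^sup>2 / 6" using \<alpha> zeta_real_2 by simp
    have "(t / crit_temp kB L \<alpha>)\<^sup>2 = (t / crit_temp kB L \<alpha>) powr \<alpha>" using t_ratio \<alpha> by (simp add: powr_numeral)
    also have "\<dots> = c powr \<alpha> * (L * Gamma (\<alpha> + 1) * (pi\<^sup>2 / 6))"
      unfolding t_ratio_powr[OF \<alpha>1] bose_const_def Gamma_\<alpha> z by (simp only: mult_ac)
    finally have f: "(t / crit_temp kB L \<alpha>)\<^sup>2 = c powr \<alpha> * (L * Gamma (\<alpha> + 1) * (pi\<^sup>2 / 6))" .
    show ?thesis unfolding f by (simp add: field_simps)
  qed
  with lim show "(\<lambda>n. weighted_laplace 1 (\<beta> n) / (sqrt (N n * ln (N n)))\<^sup>2) \<longlonglongrightarrow> 3 * (t / crit_temp kB L \<alpha>)\<^sup>2 / pi\<^sup>2"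
    by simp
qed

context
  fixes P :: "'a measure" and X :: "nat \<Rightarrow> 'a \<Rightarrow> real"
  assumes P: "prob_space P"
    and X_indep: "prob_space.indep_vars P (\<lambda>_. borel) X {1..}"
    and X_exp: "\<And>j. 1 \<le> j \<Longrightarrow> distributed P lborel (X j) (\<lambda>x. ennreal (exponential_density 1 x))"
    and \<alpha>_lt_2: "\<alpha> < 2"
begin

interpretation P: prob_space P by (rule P)

lemma W_term_eq: "W_term E X (Suc j) = (\<lambda>\<omega>. (1 - X (Suc j) \<omega>) * (1 / e j))"
  by (simp add: W_term_def e_def fun_eq_iff)

lemma X_moments:
  "integrable P (X (Suc j))" "P.expectation (X (Suc j)) = 1"
  "integrable P (\<lambda>\<omega>. (X (Suc j) \<omega>)\<^sup>2)" "P.expectation (\<lambda>\<omega>. (X (Suc j) \<omega>)\<^sup>2) = 2"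
proof -
  have D: "distributed P lborel (X (Suc j)) (exponential_density 1)" using X_exp[of "Suc j"] by simp
  show "integrable P (X (Suc j))" "P.expectation (X (Suc j)) = 1"
    using P.erlang_ith_moment_integrable[OF _ D, of 1] P.erlang_ith_moment[OF _ D, of 1] by simp_all
  show "integrable P (\<lambda>\<omega>. (X (Suc j) \<omega>)\<^sup>2)" "P.expectation (\<lambda>\<omega>. (X (Suc j) \<omega>)\<^sup>2) = 2"
    using P.erlang_ith_moment_integrable[OF _ D, of 2] P.erlang_ith_moment[OF _ D, of 2] by (simp_all add: fact_numeral)
qed

lemma W_term_square:
  "integrable P (\<lambda>\<omega>. (W_term E X (Suc j) \<omega>)\<^sup>2)" "P.expectation (\<lambda>\<omega>. (W_term E X (Suc j) \<omega>)\<^sup>2) = 1 / (e j)\<^sup>2"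
proof -
  have eq: "(W_term E X (Suc j) \<omega>)\<^sup>2 = 1 / (e j)\<^sup>2 * (1 - 2 * X (Suc j) \<omega> + (X (Suc j) \<omega>)\<^sup>2)" for \<omega>
    unfolding W_term_eq by (simp add: power2_eq_square field_simps)
  show "integrable P (\<lambda>\<omega>. (W_term E X (Suc j) \<omega>)\<^sup>2)" unfolding eq using X_moments[of j] by simp
  show "P.expectation (\<lambda>\<omega>. (W_term E X (Suc j) \<omega>)\<^sup>2) = 1 / (e j)\<^sup>2"
    unfolding eq using X_moments[of j] by (simp add: P.prob_space)
qed

lemma W_term_independent_centered: "independent_centered P (\<lambda>j. W_term E X (Suc j))"
proof
  have "P.indep_vars (\<lambda>j. PiM {Suc j} (\<lambda>_. borel)) (\<lambda>j \<omega>. restrict (\<lambda>i. X i \<omega>) {Suc j}) UNIV"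
    by (rule P.indep_vars_restrict[OF X_indep]) (auto simp: disjoint_family_on_def)
  from P.indep_vars_compose2[OF this, of "\<lambda>j y. (1 - y (Suc j)) * (1 / e j)" "\<lambda>_. borel"]
  show "P.indep_vars (\<lambda>_. borel) (\<lambda>j. W_term E X (Suc j)) UNIV"
    unfolding W_term_eq by simp
  show "integrable P (\<lambda>\<omega>. (W_term E X (Suc j) \<omega>)\<^sup>2)" for j by (rule W_term_square)
  show "P.expectation (W_term E X (Suc j)) = 0" for j
    unfolding W_term_eq using X_moments[of j] by (simp add: P.prob_space)
qed

interpretation W: independent_centered P "\<lambda>j. W_term E X (Suc j)" by (rule W_term_independent_centered)

lemma W_summable_variance: "summable (\<lambda>j. P.expectation (\<lambda>\<omega>. (W_term E X (Suc j) \<omega>)\<^sup>2))"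
  unfolding W_term_square by (rule summable_inverse_square_gaps[OF \<alpha>_lt_2])

lemmas W_AE_summable = W.AE_summable[OF W_summable_variance]
  and W_L2 = W.L2_convergence[OF W_summable_variance]

definition T :: "'a \<Rightarrow> real" where "T \<omega> = (\<Sum>j. W_term E X (Suc j) \<omega>)"

lemma T_measurable: "T \<in> borel_measurable P"
  unfolding T_def using W.measurable_Y by measurable

lemma T_char:
  "(\<lambda>J. \<Prod>j<J. exp (\<i> * of_real (s / e j)) / (1 + \<i> * of_real (s / e j))) \<longlonglongrightarrow> char (distr P borel T) s"
proof -
  have "char (distr P borel (W_term E X (Suc j))) s = exp (\<i> * of_real (s / e j)) / (1 + \<i> * of_real (s / e j))" for j
    using P.exponential_affine_char[of "X (Suc j)" "1 / e j" s] X_exp[of "Suc j"] by (simp add: W_term_eq)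
  then show ?thesis using W.char_series_tendsto[OF W_summable_variance, of s] by (simp add: T_def[abs_def])
qed

text \<open>On the scale \<open>1 / \<beta>\<close> the occupation number of level \<open>j\<close> converges to an exponential variable with mean
  \<open>1 / e\<^sub>j\<close>, and the variances are dominated by \<open>2 / e\<^sub>j\<^sup>2\<close>, which is summable for \<open>\<alpha> < 2\<close>.\<close>

lemma exponential_fluctuations:
  fixes b :: "nat \<Rightarrow> real"
  defines "a \<equiv> \<lambda>n. b (n + 2)"
  assumes a: "filterlim a at_top sequentially"
    and scale: "\<And>n. \<beta> n * a n = 1 / c"
    and room: "filterlim (\<lambda>n. N n / a n) at_top sequentially"
  shows "weak_conv_m (N0_law kB E \<alpha> t b) (distr P borel (\<lambda>\<omega>. c * T \<omega>))"
proof -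
  obtain \<rho> where \<rho>: "\<rho> < 1" "(\<lambda>n. weighted_laplace 0 (\<beta> n) / N n) \<longlonglongrightarrow> \<rho>" using excited_fraction by blast
  have apos: "0 < a n" for n using scale[of n] \<beta>_pos[of n] c_pos by (metis zero_less_divide_1_iff zero_less_mult_pos)
  have a_eq: "a n = 1 / (c * \<beta> n)" for n using scale[of n] \<beta>_pos[of n] c_pos by (simp add: field_simps)
  have vle: "(occ (\<beta> n) j + (occ (\<beta> n) j)\<^sup>2) / (a n)\<^sup>2 \<le> 2 * c\<^sup>2 * (1 / (e j)\<^sup>2)" for n j
  proof -
    have "(occ (\<beta> n) j + (occ (\<beta> n) j)\<^sup>2) / (a n)\<^sup>2 \<le> 2 / (\<beta> n * e j)\<^sup>2 / (a n)\<^sup>2"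
      by (intro divide_right_mono occ_variance_le \<beta>_pos) auto
    also have "\<dots> = 2 * c\<^sup>2 * (1 / (e j)\<^sup>2)"
      unfolding a_eq using \<beta>_pos[of n] e_gt_0[of j] c_pos by (simp add: power_mult_distrib power_divide)
    finally show ?thesis .
  qed
  have B: "summable (\<lambda>j. 2 * c\<^sup>2 * (1 / (e j)\<^sup>2))" by (rule summable_mult[OF summable_inverse_square_gaps[OF \<alpha>_lt_2]])
  define C where "C = max (\<Sum>j. 2 * c\<^sup>2 * (1 / (e j)\<^sup>2)) (c / e 0)"
  have var: "weighted_laplace 1 (\<beta> n) / (a n)\<^sup>2 \<le> C" for n
  proof -
    have "weighted_laplace 1 (\<beta> n) / (a n)\<^sup>2 = (\<Sum>j. (occ (\<beta> n) j + (occ (\<beta> n) j)\<^sup>2) / (a n)\<^sup>2)"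
      using sums_divide[OF occ_variance_sums[OF \<beta>_pos[of n]], of "(a n)\<^sup>2"] by (rule sums_unique)
    also have "\<dots> \<le> (\<Sum>j. 2 * c\<^sup>2 * (1 / (e j)\<^sup>2))"
      using sums_divide[OF occ_variance_sums[OF \<beta>_pos[of n]], of "(a n)\<^sup>2"]
      by (intro suminf_le vle B) (rule sums_summable)
    finally show ?thesis by (simp add: C_def)
  qed
  have small: "occ (\<beta> n) 0 / a n \<le> C" for n
  proof -
    have "occ (\<beta> n) 0 / a n \<le> 1 / (\<beta> n * e 0) / a n"
      using apos[of n] by (intro divide_right_mono occ_le \<beta>_pos) auto
    also have "\<dots> = c / e 0" unfolding a_eq using \<beta>_pos[of n] c_pos by simp
    finally show ?thesis by (simp add: C_def)
  qed
  have lim: "(\<lambda>n. occ (\<beta> n) j / a n) \<longlonglongrightarrow> c / e j" for j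
  proof -
    have "((\<lambda>x. exp (x * e j)) has_real_derivative e j) (at 0)" by (auto intro!: derivative_eq_intros)
    then have "((\<lambda>x. (exp (x * e j) - 1) / x) \<longlongrightarrow> e j) (at 0)" by (simp add: has_field_derivative_iff)
    then have "((\<lambda>x. (exp (x * e j) - 1) / x) \<longlongrightarrow> e j) (at_right 0)" by (rule tendsto_mono[OF at_le, rotated]) simp
    from filterlim_compose[OF this \<beta>_at_right_0]
    have "(\<lambda>n. c / ((exp (\<beta> n * e j) - 1) / \<beta> n)) \<longlonglongrightarrow> c / e j"
      using e_gt_0[of j] by (intro tendsto_divide tendsto_const) auto
    then show ?thesis by (simp add: occ_def a_eq mult_ac)
  qed
  have T: "T \<in> borel_measurable P" by (rule T_measurable)
  have M': "real_distribution (distr P borel (\<lambda>\<omega>. c * T \<omega>))"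
    by (rule P.real_distribution_distr) (use T in measurable)
  show ?thesis
  proof (rule N0_weak_conv[OF a[unfolded a_def] always_eventually[OF allI[OF var[unfolded a_def]]] always_eventually[OF allI[OF small[unfolded a_def]]] \<rho>(2,1) room[unfolded a_def] M'])
    fix s
    have "centred_char (- s) a \<longlonglongrightarrow> char (distr P borel T) (s * c)"
    proof (rule geo_char_prod_tendsto_exponential[where m="\<lambda>n. occ (\<beta> n)" and a=a and B="\<lambda>j. 2 * c\<^sup>2 * (1 / (e j)\<^sup>2)" and c="\<lambda>j. c / e j"])
      show "0 \<le> occ (\<beta> n) j" for n j using occ_pos[OF \<beta>_pos] by (rule less_imp_le)
      show "\<forall>\<^sub>F n in sequentially. \<forall>j. (occ (\<beta> n) j + (occ (\<beta> n) j)\<^sup>2) / (a n)\<^sup>2 \<le> 2 * c\<^sup>2 * (1 / (e j)\<^sup>2)"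
        using vle by simp
      have "- s * (c / e j) = - (s * c / e j)" for j by simp
      then show "(\<lambda>J. \<Prod>j<J. exp (- (\<i> * of_real (- s * (c / e j)))) / (1 - \<i> * of_real (- s * (c / e j)))) \<longlonglongrightarrow> char (distr P borel T) (s * c)"
        using T_char[of "s * c"] by simp
    qed (rule a B lim centred_char_prod)+
    moreover have "char (distr P borel T) (s * c) = char (distr P borel (\<lambda>\<omega>. c * T \<omega>)) s"
      unfolding char_def using T by (simp add: integral_distr mult_ac)
    ultimately show "centred_char (- s) (\<lambda>n. b (n + 2)) \<longlonglongrightarrow> char (distr P borel (\<lambda>\<omega>. c * T \<omega>)) s"
      by (simp add: a_def)
  qed
qed

lemma N0_fluctuations_between_1_2:
  assumes \<alpha>: "1 < \<alpha>"
  shows "weak_conv_m (N0_law kB E \<alpha> t (\<lambda>n. real n powr (1 / \<alpha>))) (distr P borel (\<lambda>\<omega>. (t / crit_temp kB L \<alpha>) * W_rv E L \<alpha> X \<omega>))"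
proof -
  have "(t / crit_temp kB L \<alpha>) * W_rv E L \<alpha> X \<omega> = c * T \<omega>" for \<omega>
    unfolding t_over_crit_temp[OF \<alpha>] using \<alpha> bose_const_pos[OF \<alpha>] by (simp add: W_rv_def bose_const_def[symmetric] T_def)
  moreover have "weak_conv_m (N0_law kB E \<alpha> t (\<lambda>n. real n powr (1 / \<alpha>))) (distr P borel (\<lambda>\<omega>. c * T \<omega>))"
  proof (rule exponential_fluctuations, fold N_def)
    show "filterlim (\<lambda>n. N n powr (1 / \<alpha>)) at_top sequentially"
      using \<alpha> by (intro N_powr_at_top) auto
    show "\<beta> n * N n powr (1 / \<alpha>) = 1 / c" for n
      unfolding \<beta>_eq[OF \<alpha>] using c_pos N_ge[of n] by simp
    have "filterlim (\<lambda>n. N n powr (1 - 1 / \<alpha>)) at_top sequentially"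
      using \<alpha> by (intro N_powr_at_top) auto
    moreover have "N n powr (1 - 1 / \<alpha>) = N n / N n powr (1 / \<alpha>)" for n using N_ge[of n] by (simp add: powr_diff)
    ultimately show "filterlim (\<lambda>n. N n / N n powr (1 / \<alpha>)) at_top sequentially" by simp
  qed
  ultimately show ?thesis by simp
qed

lemma N0_fluctuations_1:
  assumes \<alpha>: "\<alpha> = 1"
  shows "weak_conv_m (N0_law kB E \<alpha> t (\<lambda>n. real n / ln (real n))) (distr P borel (\<lambda>\<omega>. (t / crit_temp kB L \<alpha>) * W_rv E L \<alpha> X \<omega>))"
proof -
  have "(t / crit_temp kB L \<alpha>) * W_rv E L \<alpha> X \<omega> = c * T \<omega>" for \<omega>
  proof -
    have "W_rv E L \<alpha> X \<omega> = 1 / L * T \<omega>" unfolding W_rv_def T_def using \<alpha> by simp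
    then show ?thesis unfolding t_over_tc_1[OF \<alpha>] using L_pos by simp
  qed
  moreover have "weak_conv_m (N0_law kB E \<alpha> t (\<lambda>n. real n / ln (real n))) (distr P borel (\<lambda>\<omega>. c * T \<omega>))"
  proof (rule exponential_fluctuations, fold N_def)
    show "filterlim (\<lambda>n. N n / ln (N n)) at_top sequentially" by (rule N_over_ln_N_at_top)
    show "\<beta> n * (N n / ln (N n)) = 1 / c" for n
      unfolding \<beta>_eq_1[OF \<alpha>] using c_pos N_ge[of n] ln_N_pos[of n] by simp
    have "N n / (N n / ln (N n)) = ln (N n)" for n using N_ge[of n] ln_N_pos[of n] by simp
    then show "filterlim (\<lambda>n. N n / (N n / ln (N n))) at_top sequentially" using ln_N_at_top by simp
  qed
  ultimately show ?thesis by simp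
qed

end

end

theorem theorem2p2:
  fixes E :: "nat \<Rightarrow> real" and L \<alpha> kB t :: real
    and P :: "'a measure" and X :: "nat \<Rightarrow> 'a \<Rightarrow> real"
  assumes E_gap: "E 0 < E 1"
    and E_mono: "\<And>j. 1 \<le> j \<Longrightarrow> E j \<le> E (Suc j)"
    and L_pos: "L > 0" and \<alpha>_ge: "\<alpha> \<ge> 1"
    and E_count:
      "((\<lambda>x::real. real (card {j. E j \<le> x}) / (L * x powr \<alpha>)) \<longlongrightarrow> 1) at_top"
    and kB_pos: "kB > 0"
    and P: "prob_space P"
    and X_indep: "prob_space.indep_vars P (\<lambda>_. borel) X {1..}"
    and X_exp: "\<And>j. 1 \<le> j \<Longrightarrow> distributed P lborel (X j) (\<lambda>x. ennreal (exponential_density 1 x))"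
    and t_pos: "0 < t" and t_less: "t < crit_temp kB L \<alpha>"
  shows "
    (\<alpha> = 1 \<longrightarrow>
       (AE \<omega> in P. summable (\<lambda>j. W_term E X (Suc j) \<omega>)) \<and>
       series_converges_L2 P (\<lambda>j. W_term E X (Suc j)) (\<lambda>\<omega>. \<Sum>j. W_term E X (Suc j) \<omega>) \<and>
       weak_conv_m (N0_law kB E \<alpha> t (\<lambda>n. real n / ln (real n)))
         (distr P borel (\<lambda>\<omega>. (t / crit_temp kB L \<alpha>) * W_rv E L \<alpha> X \<omega>))) \<and>
    (1 < \<alpha> \<and> \<alpha> < 2 \<longrightarrow>
       (AE \<omega> in P. summable (\<lambda>j. W_term E X (Suc j) \<omega>)) \<and>
       series_converges_L2 P (\<lambda>j. W_term E X (Suc j)) (\<lambda>\<omega>. \<Sum>j. W_term E X (Suc j) \<omega>) \<and>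
       weak_conv_m (N0_law kB E \<alpha> t (\<lambda>n. real n powr (1 / \<alpha>)))
         (distr P borel (\<lambda>\<omega>. (t / crit_temp kB L \<alpha>) * W_rv E L \<alpha> X \<omega>))) \<and>
    (\<alpha> = 2 \<longrightarrow>
       weak_conv_m (N0_law kB E \<alpha> t (\<lambda>n. sqrt (real n * ln (real n))))
         (normal_dist 0 (3 * (t / crit_temp kB L \<alpha>)\<^sup>2 / pi\<^sup>2))) \<and>
    (2 < \<alpha> \<longrightarrow>
       weak_conv_m (N0_law kB E \<alpha> t (\<lambda>n. sqrt (real n)))
         (normal_dist 0 ((t / crit_temp kB L \<alpha>) powr \<alpha> * zeta_real (\<alpha> - 1) / zeta_real \<alpha>)))"
proof -
  interpret trapped_bosons E L \<alpha> kB t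
    by unfold_locales (use assms in auto)
  note series = W_AE_summable[OF P X_indep X_exp] W_L2[OF P X_indep X_exp]
  show ?thesis
  proof (intro conjI impI)
    assume \<alpha>: "\<alpha> = 1"
    then have \<alpha>2: "\<alpha> < 2" by simp
    show "AE \<omega> in P. summable (\<lambda>j. W_term E X (Suc j) \<omega>)"
      and "series_converges_L2 P (\<lambda>j. W_term E X (Suc j)) (\<lambda>\<omega>. \<Sum>j. W_term E X (Suc j) \<omega>)"
      using series[OF _ \<alpha>2] by blast+
    show "weak_conv_m (N0_law kB E \<alpha> t (\<lambda>n. real n / ln (real n)))
         (distr P borel (\<lambda>\<omega>. (t / crit_temp kB L \<alpha>) * W_rv E L \<alpha> X \<omega>))"
      by (rule N0_fluctuations_1[OF P X_indep X_exp \<alpha>2 \<alpha>])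
  next
    assume \<alpha>: "1 < \<alpha> \<and> \<alpha> < 2"
    then have \<alpha>2: "\<alpha> < 2" and \<alpha>1: "1 < \<alpha>" by simp_all
    show "AE \<omega> in P. summable (\<lambda>j. W_term E X (Suc j) \<omega>)"
      and "series_converges_L2 P (\<lambda>j. W_term E X (Suc j)) (\<lambda>\<omega>. \<Sum>j. W_term E X (Suc j) \<omega>)"
      using series[OF _ \<alpha>2] by blast+
    show "weak_conv_m (N0_law kB E \<alpha> t (\<lambda>n. real n powr (1 / \<alpha>)))
         (distr P borel (\<lambda>\<omega>. (t / crit_temp kB L \<alpha>) * W_rv E L \<alpha> X \<omega>))"
      by (rule N0_fluctuations_between_1_2[OF P X_indep X_exp \<alpha>2 \<alpha>1])
  qed (rule N0_fluctuations_2 N0_fluctuations_gt_2, assumption)+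
qed

end
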